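(* Let $k$ be an algebraically closed field of characteristic zero and let $n\ge 4$. Let $a_{ij}$, $1\le i,j\le n$, be deformation parameters subject to $a_{ij}+a_{ji}=0$ for all $1\le i,j\le n$. Let $B_n$ be the closed subscheme of the affine space with coordinates $a_{ij}$ ($i<j$) defined by the vanishing, for all pairwise distinct $i,j,k,l,m\in\{1,\dots,n\}$, of $$\Phi^i_{jl;km}=(a_{ik}-a_{ij})(a_{jk}-a_{ji})-(a_{ik}-a_{il})(a_{lk}-a_{li})-(a_{im}-a_{ij})(a_{jm}-a_{ji})+(a_{im}-a_{il})(a_{lm}-a_{li}).$$ Then the versal deformation of $L_{n+1}^n$ has base space $B_n$, and its total space is the closed subscheme of $\mathbb{A}^n\times B_n$ (with coordinates $z_1,\dots,z_n$ on $\mathbb{A}^n$) given by the polynomials, for pairwise distinct $i,j,k,l\in\{1,\dots,n\}$, $$\begin{aligned}F_{ij;il}&=z_iz_j-z_iz_l+(a_{ij}-a_{il})z_i+a_{ji}z_j-a_{li}z_l\\&\quad-a_{ij}a_{ik}-a_{ji}a_{jk}-a_{ki}a_{kj}+a_{il}a_{ik}+a_{li}a_{lk}+a_{ki}a_{kl}\\&=(z_i-a_{ij})(z_j-a_{ji})-(a_{ik}-a_{ij})(a_{jk}-a_{ji})\\&\quad-(z_i-a_{il})(z_l-a_{li})+(a_{ik}-a_{il})(a_{lk}-a_{li}).\end{aligned}$$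
   Context: $L_{n+1}^n\subset\mathbb{A}^n(k)$ is the curve singularity consisting of $n+1$ lines through the origin in generic position (any $n$ direction vectors linearly independent), here taken to be the $n$ coordinate axes together with the line through $(1,\dots,1)$; its ideal is generated by the polynomials $z_iz_j-z_kz_l$ with $i\ne j$, $k\ne l$. "Versal deformation" means the miniversal (semi-universal) deformation of the isolated singularity at the origin. Since $L_{n+1}^n$ has only deformations of negative weight, it can be taken $\mathbb{G}_m$-equivariant with good $\mathbb{G}_m$-action and with affine schemes of finite type as base and total space. In $F_{ij;il}$ the index $k$ is any index distinct from $i,j,l$; polynomials for different choices of $k$ differ by an element of the ideal of $B_n$. For $n=4$ there are no polynomials $\Phi^i_{jl;km}$, so $B_4$ is an affine space. (As a superscript-free index, $k$ is an element of $\{1,\dots,n\}$ and is not to be confused with the ground field.) *)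

theory Defs
  imports
    "HOL-Library.Poly_Mapping"
    "HOL-Library.Cardinality"
    "HOL-Computational_Algebra.Polynomial"
begin

section \<open>Rings, ideals and multivariate polynomials\<close>

definition is_ring_hom :: "('a::comm_ring_1 \<Rightarrow> 'b::comm_ring_1) \<Rightarrow> bool" where
  "is_ring_hom f \<longleftrightarrow> f 1 = 1 \<and> (\<forall>x y. f (x + y) = f x + f y) \<and> (\<forall>x y. f (x * y) = f x * f y)"

text \<open>Ideals are the submodules of a ring over itself.\<close>

lemma module_mult: "module ((*) :: 'a \<Rightarrow> 'a \<Rightarrow> 'a::comm_ring_1)"
  by unfold_locales (auto simp: algebra_simps)

abbreviation is_ideal :: "'a::comm_ring_1 set \<Rightarrow> bool" where
  "is_ideal \<equiv> module.subspace (*)"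

abbreviation ideal_gen :: "'a::comm_ring_1 set \<Rightarrow> 'a set" where
  "ideal_gen \<equiv> module.span (*)"

lemma ideal_gen_0: "(0::'a::comm_ring_1) \<in> ideal_gen G"
  and ideal_gen_add: "x \<in> ideal_gen G \<Longrightarrow> y \<in> ideal_gen G \<Longrightarrow> x + y \<in> ideal_gen G"
  and ideal_gen_diff: "x \<in> ideal_gen G \<Longrightarrow> y \<in> ideal_gen G \<Longrightarrow> x - y \<in> ideal_gen G"
  and ideal_gen_uminus: "x \<in> ideal_gen G \<Longrightarrow> - x \<in> ideal_gen G"
  and ideal_gen_mult: "x \<in> ideal_gen G \<Longrightarrow> c * x \<in> ideal_gen G"
  and ideal_gen_base: "x \<in> G \<Longrightarrow> x \<in> ideal_gen G"
  by (rule module.span_zero[OF module_mult] module.span_add[OF module_mult]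
    module.span_diff[OF module_mult] module.span_neg[OF module_mult]
    module.span_scale[OF module_mult] module.span_base[OF module_mult]; assumption?)+

lemma ideal_gen_mult2: "x \<in> ideal_gen G \<Longrightarrow> x * c \<in> ideal_gen G"
  for x :: "'a::comm_ring_1"
  using ideal_gen_mult[of x G c] by (simp add: mult.commute)

lemma ideal_congruence:
  fixes p p' q q' :: "'a::comm_ring_1"
  assumes "p - p' \<in> ideal_gen G" and "q - q' \<in> ideal_gen G"
  shows "p + q - (p' + q') \<in> ideal_gen G" and "p - q - (p' - q') \<in> ideal_gen G"
    and "- p - - p' \<in> ideal_gen G" and "p * q - p' * q' \<in> ideal_gen G"
proof -
  show "p + q - (p' + q') \<in> ideal_gen G"
    using ideal_gen_add[OF assms] by (simp add: algebra_simps)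
  show "p - q - (p' - q') \<in> ideal_gen G"
    using ideal_gen_diff[OF assms] by (simp add: algebra_simps)
  show "- p - - p' \<in> ideal_gen G"
    using ideal_gen_uminus[OF assms(1)] by (simp add: algebra_simps)
  have "q * (p - p') + p' * (q - q') \<in> ideal_gen G"
    by (intro ideal_gen_add ideal_gen_mult assms)
  then show "p * q - p' * q' \<in> ideal_gen G"
    by (simp add: algebra_simps)
qed

lemma ideal_equivp: "equivp (\<lambda>p q :: 'a::comm_ring_1. p - q \<in> ideal_gen G)"
proof (rule equivpI)
  show "reflp (\<lambda>p q. p - q \<in> ideal_gen G)"
    by (simp add: reflp_def ideal_gen_0)
  show "symp (\<lambda>p q. p - q \<in> ideal_gen G)"
    using ideal_gen_uminus by (fastforce simp: symp_def)
  show "transp (\<lambda>p q. p - q \<in> ideal_gen G)"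
    using ideal_gen_add by (fastforce simp: transp_def)
qed

lemma ring_hom_simps:
  assumes "is_ring_hom f"
  shows "f 0 = 0" "f 1 = 1" "f (x + y) = f x + f y" "f (x * y) = f x * f y"
    "f (- x) = - f x" "f (x - y) = f x - f y"
proof -
  have add: "f (x + y) = f x + f y" for x y using assms by (simp add: is_ring_hom_def)
  show z: "f 0 = 0" using add[of 0 0] by simp
  have m: "f (- x) = - f x" for x using add[of x "- x"] z by (simp add: add_eq_0_iff2)
  show "f (- x) = - f x" by (rule m)
  show "f (x - y) = f x - f y" using add[of x "- y"] m[of y] by simp
qed (use assms in \<open>auto simp: is_ring_hom_def\<close>)

lemma ring_hom_ideal_gen:
  assumes "is_ring_hom f" and "f ` G \<subseteq> ideal_gen H" and "x \<in> ideal_gen G"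
  shows "f x \<in> ideal_gen H"
  using assms(3)
proof (induction rule: module.span_induct_alt[OF module_mult, consumes 1])
  case 1
  then show ?case by (simp add: ring_hom_simps[OF assms(1)] ideal_gen_0)
next
  case (2 c x y)
  then show ?case
    using assms(2) by (auto simp: ring_hom_simps[OF assms(1)] intro!: ideal_gen_add ideal_gen_mult)
qed

lemma ring_hom_ideal_gen_0:
  assumes "is_ring_hom f" and "\<And>g. g \<in> G \<Longrightarrow> f g = 0" and "x \<in> ideal_gen G"
  shows "f x = 0"
  using assms(3)
proof (induction rule: module.span_induct_alt[OF module_mult, consumes 1])
  case 1
  then show ?case by (simp add: ring_hom_simps[OF assms(1)])
next
  case (2 c x y)
  then show ?case using assms(2) by (auto simp: ring_hom_simps[OF assms(1)])
qed

text \<open>\<open>('v, 'a) mpol\<close> is the polynomial ring over \<open>'a\<close> in variables indexed by \<open>'v\<close>.\<close>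

type_synonym ('v, 'a) mpol = "('v \<Rightarrow>\<^sub>0 nat) \<Rightarrow>\<^sub>0 'a"

definition pconst :: "'a \<Rightarrow> ('v, 'a::comm_ring_1) mpol" where
  "pconst c = Poly_Mapping.single 0 c"

definition pvar :: "'v \<Rightarrow> ('v, 'a::comm_ring_1) mpol" where
  "pvar v = Poly_Mapping.single (Poly_Mapping.single v 1) 1"

definition coeff_map :: "('a \<Rightarrow> 'b) \<Rightarrow> ('v, 'a::comm_ring_1) mpol \<Rightarrow> ('v, 'b::comm_ring_1) mpol" where
  "coeff_map f = Poly_Mapping.map f"

lemma pconst_hom: "is_ring_hom pconst"
  by (simp add: is_ring_hom_def pconst_def single_add mult_single)

lemma lookup_mult_0:
  "Poly_Mapping.lookup (p * q) 0 = Poly_Mapping.lookup p 0 * Poly_Mapping.lookup q 0"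
  for p q :: "('v, 'a::comm_ring_1) mpol"
proof -
  have z: "x + y = 0 \<longleftrightarrow> x = 0 \<and> y = 0" for x y :: "'v \<Rightarrow>\<^sub>0 nat"
    by (auto simp: poly_mapping_eq_iff lookup_add fun_eq_iff)
  have "Poly_Mapping.lookup p l * (\<Sum>r. Poly_Mapping.lookup q r when 0 = l + r)
      = (Poly_Mapping.lookup p l * Poly_Mapping.lookup q 0 when l = 0)" for l
    by (cases "l = 0") (auto simp: eq_commute[of 0] z)
  then show ?thesis by (simp add: lookup_mult)
qed

lemma const_coeff_hom: "is_ring_hom (\<lambda>p :: ('v, 'a::comm_ring_1) mpol. Poly_Mapping.lookup p 0)"
  by (auto simp: is_ring_hom_def lookup_add lookup_mult_0 lookup_one)

lemma const_coeff_simps [simp]: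
  "Poly_Mapping.lookup (pconst c) 0 = c" "Poly_Mapping.lookup (pvar v) 0 = 0"
  by (auto simp: pconst_def pvar_def lookup_single when_def poly_mapping_eq_iff fun_eq_iff)

lemma coeff_map_hom:
  assumes f: "is_ring_hom f"
  shows "is_ring_hom (coeff_map f :: ('v, 'a::comm_ring_1) mpol \<Rightarrow> ('v, 'b::comm_ring_1) mpol)"
proof -
  let ?m = "coeff_map f :: ('v, 'a) mpol \<Rightarrow> ('v, 'b) mpol"
  have lk: "Poly_Mapping.lookup (?m p) x = f (Poly_Mapping.lookup p x)" for p x
    by (auto simp: coeff_map_def map.rep_eq when_def ring_hom_simps[OF f])
  have add: "?m (p + q) = ?m p + ?m q" for p q
    by (rule poly_mapping_eqI) (simp add: lk lookup_add ring_hom_simps[OF f])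
  have sing: "?m (Poly_Mapping.single x c) = Poly_Mapping.single x (f c)" for x c
    by (rule poly_mapping_eqI) (simp add: lk lookup_single when_def ring_hom_simps[OF f])
  have s0: "?m 0 = 0"
    by (rule poly_mapping_eqI) (simp add: lk ring_hom_simps[OF f])
  have sm: "?m (sum h X) = (\<Sum>x\<in>X. ?m (h x))" for h and X :: "'z set"
    by (induction X rule: infinite_finite_induct) (simp_all add: s0 add)
  have ex: "p = (\<Sum>x\<in>Poly_Mapping.keys p. Poly_Mapping.single x (Poly_Mapping.lookup p x))"
    for p :: "('v, 'a) mpol"
    by (rule poly_mapping_eqI) (auto simp: lookup_sum lookup_single when_def in_keys_iff)
  have s: "?m (Poly_Mapping.single x c * Poly_Mapping.single y d)
      = ?m (Poly_Mapping.single x c) * ?m (Poly_Mapping.single y d)" for x y c d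
    by (simp add: mult_single sing ring_hom_simps[OF f])
  have "?m (p * q) = ?m p * ?m q" for p q
  proof -
    have "?m (sum g X * sum h Y) = ?m (sum g X) * ?m (sum h Y)"
      if "\<And>x y. ?m (g x * h y) = ?m (g x) * ?m (h y)"
      for g h and X Y :: "('v \<Rightarrow>\<^sub>0 nat) set"
      unfolding sum_product sm by (intro sum.cong refl that)
    note prod = this[of "\<lambda>x. Poly_Mapping.single x (Poly_Mapping.lookup p x)"
        "\<lambda>x. Poly_Mapping.single x (Poly_Mapping.lookup q x)"
        "Poly_Mapping.keys p" "Poly_Mapping.keys q", OF s]
    show ?thesis using prod by (simp only: ex[symmetric])
  qed
  moreover have "?m 1 = 1"
    using sing[of 0 1] by (simp add: ring_hom_simps[OF f])
  ultimately show ?thesis by (simp add: is_ring_hom_def add)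
qed

lemma coeff_map_simps:
  assumes "is_ring_hom f"
  shows "coeff_map f (pconst c) = pconst (f c)" "coeff_map f (pvar v) = pvar v"
  by (rule poly_mapping_eqI,
      simp add: coeff_map_def pconst_def pvar_def map.rep_eq lookup_single when_def
        ring_hom_simps[OF assms])+


section \<open>Tensor products, flatness and base change\<close>

text \<open>
  For homomorphisms \<open>f : A \<rightarrow> B\<close>, \<open>g : A \<rightarrow> C\<close> and an \<open>A\<close>-submodule \<open>N\<close> of \<open>B\<close>,
  \<open>N \<otimes>\<^sub>A C\<close> is the free abelian group on \<open>N \<times> C\<close> modulo \<open>tensor_relations f g N\<close>.
\<close>

definition tensor_relations ::
    "('a::comm_ring_1 \<Rightarrow> 'b::comm_ring_1) \<Rightarrow> ('a \<Rightarrow> 'c::comm_ring_1) \<Rightarrow> 'b set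
      \<Rightarrow> ('b \<times> 'c \<Rightarrow>\<^sub>0 int) set" where
  "tensor_relations f g N = module.span frag_cmul
     ({frag_of (x + x', y) - frag_of (x, y) - frag_of (x', y) | x x' y. x \<in> N \<and> x' \<in> N} \<union>
      {frag_of (x, y + y') - frag_of (x, y) - frag_of (x, y') | x y y'. x \<in> N} \<union>
      {frag_of (f a * x, y) - frag_of (x, g a * y) | a x y. x \<in> N})"

text \<open>The map \<open>\<Sum> n (x, y) \<mapsto> \<Sum> n p(x) q(y)\<close> on the free abelian group.\<close>

definition tensor_eval ::
    "('b \<Rightarrow> 'd::comm_ring_1) \<Rightarrow> ('c \<Rightarrow> 'd) \<Rightarrow> ('b \<times> 'c \<Rightarrow>\<^sub>0 int) \<Rightarrow> 'd" where
  "tensor_eval p q t =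
     (\<Sum>z\<in>Poly_Mapping.keys t. of_int (Poly_Mapping.lookup t z) * (p (fst z) * q (snd z)))"

text \<open>Flatness: \<open>I \<otimes>\<^sub>A R \<rightarrow> R\<close> is injective for every ideal \<open>I\<close> of \<open>A\<close>.\<close>

definition flat_hom :: "('a::comm_ring_1 \<Rightarrow> 'r::comm_ring_1) \<Rightarrow> bool" where
  "flat_hom \<phi> \<longleftrightarrow> (\<forall>I. is_ideal I \<longrightarrow>
     (\<forall>t. Poly_Mapping.keys t \<subseteq> I \<times> UNIV \<and> tensor_eval \<phi> id t = 0
        \<longrightarrow> t \<in> tensor_relations id \<phi> I))"

text \<open>The square formed by \<open>f : A \<rightarrow> B\<close>, \<open>g : A \<rightarrow> C\<close>, \<open>p : B \<rightarrow> D\<close>, \<open>q : C \<rightarrow> D\<close> commutes and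
  \<open>B \<otimes>\<^sub>A C \<rightarrow> D\<close> is bijective.\<close>

definition cocartesian ::
    "('a::comm_ring_1 \<Rightarrow> 'b::comm_ring_1) \<Rightarrow> ('a \<Rightarrow> 'c::comm_ring_1)
      \<Rightarrow> ('b \<Rightarrow> 'd::comm_ring_1) \<Rightarrow> ('c \<Rightarrow> 'd) \<Rightarrow> bool" where
  "cocartesian f g p q \<longleftrightarrow>
     is_ring_hom f \<and> is_ring_hom g \<and> is_ring_hom p \<and> is_ring_hom q \<and> p \<circ> f = q \<circ> g \<and>
     surj (tensor_eval p q) \<and> {t. tensor_eval p q t = 0} = tensor_relations f g UNIV"

definition is_localization :: "('a::comm_ring_1 \<Rightarrow> 'b::comm_ring_1) \<Rightarrow> 'a set \<Rightarrow> bool" where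
  "is_localization \<iota> M \<longleftrightarrow> is_ring_hom \<iota> \<and> (\<forall>s\<in>M. \<iota> s dvd 1) \<and>
     (\<forall>y. \<exists>x. \<exists>s\<in>M. y * \<iota> s = \<iota> x) \<and> (\<forall>x. \<iota> x = 0 \<longleftrightarrow> (\<exists>s\<in>M. s * x = 0))"


section \<open>Deformations\<close>

text \<open>
  A pair \<open>(\<eta>, \<rho>)\<close> is a \<open>k\<close>-algebra \<open>\<eta> : k \<rightarrow> A\<close> with a \<open>k\<close>-rational point \<open>\<rho> : A \<rightarrow> k\<close>.
  For a local Artinian \<open>k\<close>-algebra with residue field \<open>k\<close> this is the residue map, whose kernel
  is the maximal ideal.
\<close>

definition pointed_algebra ::
    "('k::field \<Rightarrow> 'a::comm_ring_1) \<Rightarrow> ('a \<Rightarrow> 'k) \<Rightarrow> bool" where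
  "pointed_algebra \<eta> \<rho> \<longleftrightarrow> is_ring_hom \<eta> \<and> is_ring_hom \<rho> \<and> (\<forall>c. \<rho> (\<eta> c) = c)"

definition local_artinian ::
    "('k::field \<Rightarrow> 'a::comm_ring_1) \<Rightarrow> ('a \<Rightarrow> 'k) \<Rightarrow> bool" where
  "local_artinian \<eta> \<rho> \<longleftrightarrow> pointed_algebra \<eta> \<rho> \<and> (\<forall>x. \<rho> x \<noteq> 0 \<longrightarrow> x dvd 1) \<and>
     (\<nexists>I :: nat \<Rightarrow> 'a set. \<forall>n. is_ideal (I n) \<and> I (Suc n) \<subset> I n)"

definition pointed_hom ::
    "('k::field \<Rightarrow> 'a::comm_ring_1) \<Rightarrow> ('a \<Rightarrow> 'k) \<Rightarrow> ('k \<Rightarrow> 'b::comm_ring_1) \<Rightarrow> ('b \<Rightarrow> 'k)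
      \<Rightarrow> ('a \<Rightarrow> 'b) \<Rightarrow> bool" where
  "pointed_hom \<eta> \<rho> \<eta>' \<rho>' u \<longleftrightarrow> is_ring_hom u \<and> u \<circ> \<eta> = \<eta>' \<and> \<rho>' \<circ> u = \<rho>"

text \<open>
  A deformation of the \<open>k\<close>-algebra \<open>\<xi> : k \<rightarrow> X\<close> over \<open>(A, \<rho>)\<close>: a flat \<open>A\<close>-algebra \<open>\<phi> : A \<rightarrow> R\<close>
  with an identification, via \<open>\<pi> : R \<rightarrow> X\<close>, of \<open>R \<otimes>\<^sub>A k\<close> with \<open>X\<close>.
\<close>

definition deformation ::
    "('k::field \<Rightarrow> 'x::comm_ring_1) \<Rightarrow> ('k \<Rightarrow> 'a::comm_ring_1) \<Rightarrow> ('a \<Rightarrow> 'k)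
      \<Rightarrow> ('a \<Rightarrow> 'r::comm_ring_1) \<Rightarrow> ('r \<Rightarrow> 'x) \<Rightarrow> bool" where
  "deformation \<xi> \<eta> \<rho> \<phi> \<pi> \<longleftrightarrow> pointed_algebra \<eta> \<rho> \<and> flat_hom \<phi> \<and> cocartesian \<phi> \<rho> \<pi> \<xi>"

text \<open>
  \<open>h : R \<rightarrow> R'\<close> exhibits the deformation \<open>(\<phi>', \<pi>')\<close> over \<open>A'\<close> as the pull-back of the deformation
  \<open>(\<phi>, \<pi>)\<close> over \<open>A\<close> along \<open>u : A \<rightarrow> A'\<close>, compatibly with the identifications of the special
  fibres.
\<close>

definition is_pullback_via ::
    "('a::comm_ring_1 \<Rightarrow> 'b::comm_ring_1) \<Rightarrow> ('a \<Rightarrow> 'r::comm_ring_1) \<Rightarrow> ('r \<Rightarrow> 'x::comm_ring_1)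
      \<Rightarrow> ('b \<Rightarrow> 's::comm_ring_1) \<Rightarrow> ('s \<Rightarrow> 'x) \<Rightarrow> ('r \<Rightarrow> 's) \<Rightarrow> bool" where
  "is_pullback_via u \<phi> \<pi> \<phi>' \<pi>' h \<longleftrightarrow> cocartesian \<phi> u h \<phi>' \<and> \<pi>' \<circ> h = \<pi>"

definition is_pullback ::
    "('a::comm_ring_1 \<Rightarrow> 'b::comm_ring_1) \<Rightarrow> ('a \<Rightarrow> 'r::comm_ring_1) \<Rightarrow> ('r \<Rightarrow> 'x::comm_ring_1)
      \<Rightarrow> ('b \<Rightarrow> 's::comm_ring_1) \<Rightarrow> ('s \<Rightarrow> 'x) \<Rightarrow> bool" where
  "is_pullback u \<phi> \<pi> \<phi>' \<pi>' \<longleftrightarrow> (\<exists>h. is_pullback_via u \<phi> \<pi> \<phi>' \<pi>' h)"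

datatype 'k dual = Dual (dual_re: 'k) (dual_eps: 'k)

instantiation dual :: (field) comm_ring_1
begin
definition "0 = Dual 0 0"
definition "1 = Dual 1 0"
definition "x + y = Dual (dual_re x + dual_re y) (dual_eps x + dual_eps y)"
definition "x - y = Dual (dual_re x - dual_re y) (dual_eps x - dual_eps y)"
definition "- x = Dual (- dual_re x) (- dual_eps x)"
definition "x * y = Dual (dual_re x * dual_re y) (dual_re x * dual_eps y + dual_eps x * dual_re y)"
instance
  by standard
    (auto simp: zero_dual_def one_dual_def plus_dual_def minus_dual_def uminus_dual_def
      times_dual_def algebra_simps)
end

definition dual_const :: "'k::field \<Rightarrow> 'k dual" where
  "dual_const c = Dual c 0"

text \<open>
  The deformation \<open>(\<Phi>, \<Pi>)\<close> of \<open>\<xi> : k \<rightarrow> X\<close> over the pointed algebra \<open>(\<eta>\<^sub>S, \<rho>\<^sub>S)\<close> is miniversal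
  (semi-universal) at the given point: the map from \<open>A \<mapsto> {pointed homomorphisms S \<rightarrow> A}\<close>, i.e.
  \<open>A \<mapsto> {local homomorphisms from the completion of S at the point to A}\<close>, to the functor
  \<open>A \<mapsto> {deformations of X over A} / \<cong>\<close> on local Artinian \<open>k\<close>-algebras with residue field \<open>k\<close> is
  smooth, and bijective for \<open>A = k[\<epsilon>]\<close>.  The first argument names the types carrying the Artinian
  algebras and the deformations over them; HOL cannot quantify over types inside a definition, so
  a miniversality statement has to be made for type variables here.
\<close>

definition miniversal ::
    "('a::comm_ring_1 \<times> 'b::comm_ring_1 \<times> 'r::comm_ring_1 \<times> 'q::comm_ring_1) itself
      \<Rightarrow> ('k::field \<Rightarrow> 'x::comm_ring_1) \<Rightarrow> ('k \<Rightarrow> 's::comm_ring_1) \<Rightarrow> ('s \<Rightarrow> 'k)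
      \<Rightarrow> ('s \<Rightarrow> 't::comm_ring_1) \<Rightarrow> ('t \<Rightarrow> 'x) \<Rightarrow> bool" where
  "miniversal _ \<xi> \<eta>\<^sub>S \<rho>\<^sub>S \<Phi> \<Pi> \<longleftrightarrow>
     deformation \<xi> \<eta>\<^sub>S \<rho>\<^sub>S \<Phi> \<Pi> \<and>
     (\<forall>(\<eta> :: 'k \<Rightarrow> 'a) \<rho> (\<eta>' :: 'k \<Rightarrow> 'b) \<rho>' f u (\<phi> :: 'a \<Rightarrow> 'r) \<pi> (\<phi>' :: 'b \<Rightarrow> 'q) \<pi>'.
        local_artinian \<eta> \<rho> \<and> local_artinian \<eta>' \<rho>' \<and>
        pointed_hom \<eta>' \<rho>' \<eta> \<rho> f \<and> surj f \<and> pointed_hom \<eta>\<^sub>S \<rho>\<^sub>S \<eta> \<rho> u \<and>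
        deformation \<xi> \<eta> \<rho> \<phi> \<pi> \<and> deformation \<xi> \<eta>' \<rho>' \<phi>' \<pi>' \<and>
        is_pullback f \<phi>' \<pi>' \<phi> \<pi> \<and> is_pullback u \<Phi> \<Pi> \<phi> \<pi>
        \<longrightarrow> (\<exists>u'. pointed_hom \<eta>\<^sub>S \<rho>\<^sub>S \<eta>' \<rho>' u' \<and> f \<circ> u' = u \<and> is_pullback u' \<Phi> \<Pi> \<phi>' \<pi>')) \<and>
     (\<forall>(\<phi> :: 'k dual \<Rightarrow> 'r) \<pi>. deformation \<xi> dual_const dual_re \<phi> \<pi>
        \<longrightarrow> (\<exists>!u. pointed_hom \<eta>\<^sub>S \<rho>\<^sub>S dual_const dual_re u \<and> is_pullback u \<Phi> \<Pi> \<phi> \<pi>))"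

text \<open>
  A \<open>\<G>\<^sub>m\<close>-action on an affine \<open>k\<close>-scheme as a coaction \<open>\<gamma>(s) = \<Sum> s\<^sub>d T\<^sup>d\<close>, where \<open>s\<^sub>d\<close> is the
  component of weight \<open>d\<close>.  It is good if all weights are nonnegative (the coaction takes values
  in polynomials rather than Laurent polynomials) and only constants have weight 0.
\<close>

definition good_Gm_action :: "('k::field \<Rightarrow> 's::comm_ring_1) \<Rightarrow> ('s \<Rightarrow> 's poly) \<Rightarrow> bool" where
  "good_Gm_action \<eta> \<gamma> \<longleftrightarrow> is_ring_hom \<gamma> \<and> (\<forall>c. \<gamma> (\<eta> c) = [:\<eta> c:]) \<and> (\<forall>s. poly (\<gamma> s) 1 = s) \<and>
     (\<forall>s d. \<gamma> (coeff (\<gamma> s) d) = monom (coeff (\<gamma> s) d) d) \<and> (\<forall>s. coeff (\<gamma> s) 0 \<in> range \<eta>)"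

definition Gm_equivariant ::
    "('s::comm_ring_1 \<Rightarrow> 's poly) \<Rightarrow> ('t::comm_ring_1 \<Rightarrow> 't poly) \<Rightarrow> ('s \<Rightarrow> 't) \<Rightarrow> bool" where
  "Gm_equivariant \<gamma>\<^sub>S \<gamma>\<^sub>T f \<longleftrightarrow> (\<forall>s. \<gamma>\<^sub>T (f s) = map_poly f (\<gamma>\<^sub>S s))"


section \<open>The coordinate ring of \<open>L\<close>\<close>

text \<open>The index set \<open>{1,\<dots>,n}\<close> is the finite type \<open>'n\<close>.  The generators below cut out the union of
  the coordinate axes and the line through \<open>(1,\<dots>,1)\<close>.\<close>

definition lines_ideal :: "('n::finite, 'k::field) mpol set" where
  "lines_ideal = ideal_gen {pvar i * pvar j - pvar k * pvar l | i j k l. i \<noteq> j \<and> k \<noteq> l}"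

quotient_type (overloaded) ('k, 'n) lines_ring =
  "('n::finite, 'k::field) mpol" / "\<lambda>p q. p - q \<in> lines_ideal"
  unfolding lines_ideal_def by (rule ideal_equivp)

lemma lines_ideal_const_coeff: "p \<in> lines_ideal \<Longrightarrow> Poly_Mapping.lookup p 0 = 0"
  unfolding lines_ideal_def
  by (rule ring_hom_ideal_gen_0[OF const_coeff_hom])
    (auto simp: lookup_minus lookup_mult_0)

instantiation lines_ring :: (field, finite) comm_ring_1
begin
lift_definition zero_lines_ring :: "('a, 'b) lines_ring" is 0 .
lift_definition one_lines_ring :: "('a, 'b) lines_ring" is 1 .
lift_definition plus_lines_ring ::
  "('a, 'b) lines_ring \<Rightarrow> ('a, 'b) lines_ring \<Rightarrow> ('a, 'b) lines_ring" is "(+)"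
  unfolding lines_ideal_def by (rule ideal_congruence)
lift_definition minus_lines_ring ::
  "('a, 'b) lines_ring \<Rightarrow> ('a, 'b) lines_ring \<Rightarrow> ('a, 'b) lines_ring" is "(-)"
  unfolding lines_ideal_def by (rule ideal_congruence)
lift_definition uminus_lines_ring :: "('a, 'b) lines_ring \<Rightarrow> ('a, 'b) lines_ring" is "uminus"
  unfolding lines_ideal_def by (rule ideal_congruence)
lift_definition times_lines_ring ::
  "('a, 'b) lines_ring \<Rightarrow> ('a, 'b) lines_ring \<Rightarrow> ('a, 'b) lines_ring" is "(*)"
  unfolding lines_ideal_def by (rule ideal_congruence)
instance
proof
  show "(0::('a, 'b) lines_ring) \<noteq> 1"
    by transfer (auto dest: lines_ideal_const_coeff simp: lookup_minus lookup_one)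
qed (transfer; simp add: algebra_simps lines_ideal_def ideal_gen_0)+
end

lift_definition lines_const :: "'k::field \<Rightarrow> ('k, 'n::finite) lines_ring" is pconst .

lift_definition lines_coord :: "'n::finite \<Rightarrow> ('k::field, 'n) lines_ring" is pvar .

lift_definition lines_origin :: "('k::field, 'n::finite) lines_ring \<Rightarrow> 'k"
  is "\<lambda>p. Poly_Mapping.lookup p 0"
  by (auto dest: lines_ideal_const_coeff simp: lookup_minus)


section \<open>The coordinate ring of \<open>B\<^sub>n\<close>\<close>

definition Phi :: "'n \<Rightarrow> 'n \<Rightarrow> 'n \<Rightarrow> 'n \<Rightarrow> 'n \<Rightarrow> ('n \<times> 'n, 'k::field) mpol" where
  "Phi i j l k m = (let a = (\<lambda>i j. pvar (i, j)) in
     (a i k - a i j) * (a j k - a j i) - (a i k - a i l) * (a l k - a l i)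
     - (a i m - a i j) * (a j m - a j i) + (a i m - a i l) * (a l m - a l i))"

text \<open>We take all \<open>a\<^sub>i\<^sub>j\<close> as variables and impose \<open>a\<^sub>i\<^sub>j + a\<^sub>j\<^sub>i = 0\<close>; in characteristic different
  from 2 this eliminates the variables with \<open>i \<ge> j\<close>.\<close>

definition base_ideal :: "('n::finite \<times> 'n, 'k::field) mpol set" where
  "base_ideal = ideal_gen
     ({pvar (i, j) + pvar (j, i) | i j. True} \<union>
      {Phi i j l k m | i j k l m. distinct [i, j, k, l, m]})"

quotient_type (overloaded) ('k, 'n) base_ring =
  "('n::finite \<times> 'n, 'k::field) mpol" / "\<lambda>p q. p - q \<in> base_ideal"
  unfolding base_ideal_def by (rule ideal_equivp)

lemma base_ideal_const_coeff: "p \<in> base_ideal \<Longrightarrow> Poly_Mapping.lookup p 0 = 0"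
  unfolding base_ideal_def
  by (rule ring_hom_ideal_gen_0[OF const_coeff_hom])
    (auto simp: lookup_minus lookup_add lookup_mult_0 Phi_def Let_def)

instantiation base_ring :: (field, finite) comm_ring_1
begin
lift_definition zero_base_ring :: "('a, 'b) base_ring" is 0 .
lift_definition one_base_ring :: "('a, 'b) base_ring" is 1 .
lift_definition plus_base_ring ::
  "('a, 'b) base_ring \<Rightarrow> ('a, 'b) base_ring \<Rightarrow> ('a, 'b) base_ring" is "(+)"
  unfolding base_ideal_def by (rule ideal_congruence)
lift_definition minus_base_ring ::
  "('a, 'b) base_ring \<Rightarrow> ('a, 'b) base_ring \<Rightarrow> ('a, 'b) base_ring" is "(-)"
  unfolding base_ideal_def by (rule ideal_congruence)
lift_definition uminus_base_ring :: "('a, 'b) base_ring \<Rightarrow> ('a, 'b) base_ring" is "uminus"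
  unfolding base_ideal_def by (rule ideal_congruence)
lift_definition times_base_ring ::
  "('a, 'b) base_ring \<Rightarrow> ('a, 'b) base_ring \<Rightarrow> ('a, 'b) base_ring" is "(*)"
  unfolding base_ideal_def by (rule ideal_congruence)
instance
proof
  show "(0::('a, 'b) base_ring) \<noteq> 1"
    by transfer (auto dest: base_ideal_const_coeff simp: lookup_minus lookup_one)
qed (transfer; simp add: algebra_simps base_ideal_def ideal_gen_0)+
end

lift_definition base_const :: "'k::field \<Rightarrow> ('k, 'n::finite) base_ring" is pconst .

lift_definition base_param :: "'n::finite \<Rightarrow> 'n \<Rightarrow> ('k::field, 'n) base_ring"
  is "\<lambda>i j. pvar (i, j)" .

lift_definition base_origin :: "('k::field, 'n::finite) base_ring \<Rightarrow> 'k"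
  is "\<lambda>p. Poly_Mapping.lookup p 0"
  by (auto dest: base_ideal_const_coeff simp: lookup_minus)

lemma base_origin_hom: "is_ring_hom (base_origin :: ('k::field, 'n::finite) base_ring \<Rightarrow> 'k)"
  unfolding is_ring_hom_def
  by (intro conjI allI; transfer; simp add: lookup_one lookup_add lookup_mult_0)

lemma base_origin_param: "base_origin (base_param i j) = 0"
  by transfer simp

lifting_forget base_ring.lifting


section \<open>The coordinate ring of the total space\<close>

text \<open>Polynomials in the \<open>z\<^sub>i\<close> over the coordinate ring of \<open>B\<^sub>n\<close>, i.e. functions on
  \<open>\<A>\<^sup>n \<times> B\<^sub>n\<close>.  \<open>family_poly i j l k\<close> is \<open>F\<^sub>i\<^sub>j\<^sub>;\<^sub>i\<^sub>l\<close> written with the auxiliary index \<open>k\<close>.\<close>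

definition family_poly :: "'n \<Rightarrow> 'n \<Rightarrow> 'n \<Rightarrow> 'n \<Rightarrow> ('n::finite, ('k::field, 'n) base_ring) mpol" where
  "family_poly i j l k = (let z = pvar; a = (\<lambda>i j. pconst (base_param i j)) in
     z i * z j - z i * z l + (a i j - a i l) * z i + a j i * z j - a l i * z l
     - a i j * a i k - a j i * a j k - a k i * a k j
     + a i l * a i k + a l i * a l k + a k i * a k l)"

definition family_poly_factored ::
    "'n \<Rightarrow> 'n \<Rightarrow> 'n \<Rightarrow> 'n \<Rightarrow> ('n::finite, ('k::field, 'n) base_ring) mpol" where
  "family_poly_factored i j l k = (let z = pvar; a = (\<lambda>i j. pconst (base_param i j)) in
     (z i - a i j) * (z j - a j i) - (a i k - a i j) * (a j k - a j i)
     - (z i - a i l) * (z l - a l i) + (a i k - a i l) * (a l k - a l i))"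

definition total_ideal :: "('n::finite, ('k::field, 'n) base_ring) mpol set" where
  "total_ideal = ideal_gen {family_poly i j l k | i j k l. distinct [i, j, k, l]}"

quotient_type (overloaded) ('k, 'n) total_ring =
  "('n::finite, ('k::field, 'n) base_ring) mpol" / "\<lambda>p q. p - q \<in> total_ideal"
  unfolding total_ideal_def by (rule ideal_equivp)

lemma total_ideal_specialize:
  assumes "p \<in> total_ideal"
  shows "coeff_map base_origin p \<in> lines_ideal"
proof -
  note h = coeff_map_hom[OF base_origin_hom]
  show ?thesis
    using assms unfolding total_ideal_def lines_ideal_def
    by (rule ring_hom_ideal_gen[OF h, rotated])
      (force simp: family_poly_def Let_def ring_hom_simps[OF h]
        coeff_map_simps[OF base_origin_hom] base_origin_param ring_hom_simps[OF pconst_hom]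
        intro!: ideal_gen_base)
qed

instantiation total_ring :: (field, finite) comm_ring_1
begin
lift_definition zero_total_ring :: "('a, 'b) total_ring" is 0 .
lift_definition one_total_ring :: "('a, 'b) total_ring" is 1 .
lift_definition plus_total_ring ::
  "('a, 'b) total_ring \<Rightarrow> ('a, 'b) total_ring \<Rightarrow> ('a, 'b) total_ring" is "(+)"
  unfolding total_ideal_def by (rule ideal_congruence)
lift_definition minus_total_ring ::
  "('a, 'b) total_ring \<Rightarrow> ('a, 'b) total_ring \<Rightarrow> ('a, 'b) total_ring" is "(-)"
  unfolding total_ideal_def by (rule ideal_congruence)
lift_definition uminus_total_ring :: "('a, 'b) total_ring \<Rightarrow> ('a, 'b) total_ring" is "uminus"
  unfolding total_ideal_def by (rule ideal_congruence)
lift_definition times_total_ring ::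
  "('a, 'b) total_ring \<Rightarrow> ('a, 'b) total_ring \<Rightarrow> ('a, 'b) total_ring" is "(*)"
  unfolding total_ideal_def by (rule ideal_congruence)
instance
proof
  note h = ring_hom_simps[OF coeff_map_hom[OF base_origin_hom]]
  have "1 \<notin> (total_ideal :: ('b, ('a, 'b) base_ring) mpol set)"
  proof
    assume "1 \<in> (total_ideal :: ('b, ('a, 'b) base_ring) mpol set)"
    from lines_ideal_const_coeff[OF total_ideal_specialize[OF this]] show False
      by (simp add: h lookup_one)
  qed
  then show "(0::('a, 'b) total_ring) \<noteq> 1"
    by transfer (auto dest: ideal_gen_uminus simp: total_ideal_def)
qed (transfer; simp add: algebra_simps total_ideal_def ideal_gen_0)+
end

lift_definition base_to_total :: "('k::field, 'n::finite) base_ring \<Rightarrow> ('k, 'n) total_ring"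
  is pconst .

text \<open>Restriction of functions to the fibre over the origin \<open>a = 0\<close>.\<close>

lift_definition total_to_lines :: "('k::field, 'n::finite) total_ring \<Rightarrow> ('k, 'n) lines_ring"
  is "coeff_map base_origin"
  using total_ideal_specialize
  by (fastforce simp: ring_hom_simps[OF coeff_map_hom[OF base_origin_hom], symmetric])

definition total_origin :: "('k::field, 'n::finite) total_ring \<Rightarrow> 'k" where
  "total_origin t = lines_origin (total_to_lines t)"

end

theory Submission
  imports Defs "HOL-Computational_Algebra.Formal_Laurent_Series"
begin

text \<open>
  Put \<open>S\<^sub>i\<^sub>j\<^sub>k = a\<^sub>i\<^sub>ja\<^sub>i\<^sub>k + a\<^sub>j\<^sub>ia\<^sub>j\<^sub>k + a\<^sub>k\<^sub>ia\<^sub>k\<^sub>j\<close>.  The equations of \<open>B\<^sub>n\<close> say that \<open>S\<^sub>i\<^sub>j\<^sub>k = c\<^sub>i + c\<^sub>j + c\<^sub>k\<close>, and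
  those of the total space that \<open>z\<^sub>iz\<^sub>j + a\<^sub>i\<^sub>j(z\<^sub>i - z\<^sub>j) - c\<^sub>i - c\<^sub>j\<close> is the same function \<open>W\<close> for all
  \<open>i \<noteq> j\<close>.  The powers of the \<open>z\<^sub>i\<close> and the \<open>Wz\<^sub>q\<^sup>m\<close> therefore span the total space over the base.
  They are linearly independent, because the fibres are genus one curves with \<open>n + 1\<close> punctures,
  along which the coordinates have explicit Laurent expansions; so the family is free, hence flat.

  Given a deformation over a local Artinian algebra, one extends a solution \<open>(a, c, z, W)\<close> of
  these equations along small extensions.  Comparing the two expansions of \<open>z\<^sub>iz\<^sub>jz\<^sub>k\<close> bounds the
  error, and flatness turns it into a linear problem on the lines, where it can be solved: this
  gives smoothness, since a morphism of flat families that is the identity on the special fibre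
  is an isomorphism.  Over the dual numbers the solution of the linear problem determines \<open>a\<close>.
\<close>

text \<open>The binder notation of \<open>HOL-Library.FuncSet\<close> would reserve the token \<open>\<Pi>\<close>.\<close>

no_syntax
  "_Pi" :: "pttrn \<Rightarrow> 'a set \<Rightarrow> 'b set \<Rightarrow> ('a \<Rightarrow> 'b) set"
    (\<open>(\<open>indent=3 notation=\<open>binder \<Pi>\<in>\<close>\<close>\<Pi> _\<in>_./ _)\<close> 10)

subsection \<open>Ring homomorphisms and ideals\<close>

text \<open>Where all differences c_i - c_j are invertible, the picture behind the formulas is a
  cubic y^2 = x^3 + G x + B through points (c_i, d_i): W is the abscissa x, z_i = (y - d_i) / (x -
  c_i) is the slope of the line through (c_i, d_i) and the moving point, and a_ij = (d_i + d_j) /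
  (c_i - c_j) is the value of z_i at the puncture (c_j, -d_j), the affine pole of z_j. The puncture
  at infinity belongs to the line (1,...,1). A line of slope z_i meets the cubic in three points
  whose abscissas add up to z_i^2, so W and z_i^2 - c_i - W are the two roots of one quadratic
  equation over the polynomials in z_i; the Laurent expansions solve this equation. The obstacle is
  that the coordinate ring of the base must be taken with whatever nilpotents and zero divisors it
  has, so that independence cannot be tested on a generic fibre. The expansions therefore have
  coefficients in that ring, and only series with constant term 1 are inverted.\<close>

lemma ring_hom_id: "is_ring_hom (id :: 'a::comm_ring_1 \<Rightarrow> 'a)"
  by (simp add: is_ring_hom_def)

lemma ring_hom_comp: "is_ring_hom f \<Longrightarrow> is_ring_hom g \<Longrightarrow> is_ring_hom (g \<circ> f)"
  by (simp add: is_ring_hom_def)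

lemma ring_hom_sum: "is_ring_hom f \<Longrightarrow> f (\<Sum>i\<in>I. g i) = (\<Sum>i\<in>I. f (g i))"
  by (induction I rule: infinite_finite_induct) (simp_all add: ring_hom_simps)

lemma ring_hom_power: "is_ring_hom f \<Longrightarrow> f (x ^ n) = f x ^ n"
  by (induction n) (simp_all add: ring_hom_simps)

lemma ring_hom_of_nat: "is_ring_hom f \<Longrightarrow> f (of_nat n) = of_nat n"
  by (induction n) (simp_all add: ring_hom_simps)

lemma ring_hom_numeral: "is_ring_hom f \<Longrightarrow> f (numeral n) = numeral n"
  using ring_hom_of_nat[of f "numeral n"] by simp

lemma is_ideal_ops:
  assumes "is_ideal I"
  shows "0 \<in> I" "x \<in> I \<Longrightarrow> y \<in> I \<Longrightarrow> x + y \<in> I" "x \<in> I \<Longrightarrow> y \<in> I \<Longrightarrow> x - y \<in> I"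
    "x \<in> I \<Longrightarrow> - x \<in> I" "x \<in> I \<Longrightarrow> c * x \<in> I" "x \<in> I \<Longrightarrow> x * c \<in> I"
proof -
  show "0 \<in> I" by (rule module.subspace_0[OF module_mult assms])
  show "x \<in> I \<Longrightarrow> y \<in> I \<Longrightarrow> x + y \<in> I" by (rule module.subspace_add[OF module_mult assms])
  show "x \<in> I \<Longrightarrow> y \<in> I \<Longrightarrow> x - y \<in> I" by (rule module.subspace_diff[OF module_mult assms])
  show "x \<in> I \<Longrightarrow> - x \<in> I" by (rule module.subspace_neg[OF module_mult assms])
  show s: "x \<in> I \<Longrightarrow> c * x \<in> I" by (rule module.subspace_scale[OF module_mult assms])
  then show "x \<in> I \<Longrightarrow> x * c \<in> I" by (simp add: mult.commute)
qed

lemma is_idealI: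
  "0 \<in> I \<Longrightarrow> (\<And>x y. x \<in> I \<Longrightarrow> y \<in> I \<Longrightarrow> x + y \<in> I) \<Longrightarrow> (\<And>c x. x \<in> I \<Longrightarrow> c * x \<in> I) \<Longrightarrow> is_ideal I"
  by (intro module.subspaceI[OF module_mult]) auto

lemma is_ideal_ideal_gen: "is_ideal (ideal_gen G)"
  by (rule module.subspace_span[OF module_mult])

lemma is_ideal_kernel: "is_ring_hom f \<Longrightarrow> is_ideal {x. f x = 0}"
  by (rule is_idealI) (auto simp: ring_hom_simps)

lemma ideal_gen_minimal: "G \<subseteq> I \<Longrightarrow> is_ideal I \<Longrightarrow> ideal_gen G \<subseteq> I"
  by (rule module.span_minimal[OF module_mult])

lemma ideal_gen_mono: "G \<subseteq> H \<Longrightarrow> ideal_gen G \<subseteq> ideal_gen H"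
  by (rule module.span_mono[OF module_mult])

lemma ideal_gen_induct [consumes 1, case_names zero add scale]:
  assumes "x \<in> ideal_gen G" "P 0" "\<And>x y. P x \<Longrightarrow> P y \<Longrightarrow> P (x + y)"
    "\<And>c g. g \<in> G \<Longrightarrow> P (c * g)"
  shows "P x"
  using assms(1)
  by (induction rule: module.span_induct_alt[OF module_mult, consumes 1]) (use assms in auto)

subsection \<open>Tensor products\<close>

lemma module_frag: "module (frag_cmul :: int \<Rightarrow> ('a \<Rightarrow>\<^sub>0 int) \<Rightarrow> _)"
  by unfold_locales (auto simp: frag_cmul_distrib frag_cmul_distrib2)

lemma frag_keys_induct [consumes 1, case_names zero frag_of diff]:
  assumes "Poly_Mapping.keys t \<subseteq> S" "P 0" "\<And>x. x \<in> S \<Longrightarrow> P (frag_of x)"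
    "\<And>s t. P s \<Longrightarrow> P t \<Longrightarrow> P (s - t)"
  shows "P t"
  using assms by (rule frag_induction)

lemma frag_induct [case_names zero frag_of diff]:
  assumes "P 0" "\<And>x y. P (frag_of (x, y))" "\<And>s t. P s \<Longrightarrow> P t \<Longrightarrow> P (s - t)"
  shows "P t"
  by (rule frag_induction[where S=UNIV]) (use assms in auto)

lemma tensor_eval_superset:
  assumes "finite K" "Poly_Mapping.keys t \<subseteq> K"
  shows "tensor_eval p q t =
    (\<Sum>z\<in>K. of_int (Poly_Mapping.lookup t z) * (p (fst z) * q (snd z)))"
  unfolding tensor_eval_def
  by (rule sum.mono_neutral_left) (use assms in \<open>auto simp: in_keys_iff\<close>)

lemma tensor_eval_0 [simp]: "tensor_eval p q 0 = 0"
  by (simp add: tensor_eval_def)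

lemma tensor_eval_of [simp]: "tensor_eval p q (frag_of (x, y)) = p x * q y"
  by (simp add: tensor_eval_def)

lemma tensor_eval_diff [simp]: "tensor_eval p q (s - t) = tensor_eval p q s - tensor_eval p q t"
proof -
  let ?K = "Poly_Mapping.keys s \<union> Poly_Mapping.keys t"
  have "tensor_eval p q r = (\<Sum>z\<in>?K. of_int (Poly_Mapping.lookup r z) * (p (fst z) * q (snd z)))"
    if "r \<in> {s, t, s - t}" for r
    using that keys_diff[of s t] by (intro tensor_eval_superset) auto
  then show ?thesis by (simp add: lookup_minus algebra_simps sum_subtractf)
qed

lemma tensor_eval_uminus [simp]: "tensor_eval p q (- t) = - tensor_eval p q t"
  using tensor_eval_diff[of p q 0 t] by simp

lemma tensor_eval_add [simp]: "tensor_eval p q (s + t) = tensor_eval p q s + tensor_eval p q t"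
  using tensor_eval_diff[of p q s "- t"] by simp

lemma tensor_eval_sum: "tensor_eval p q (\<Sum>i\<in>I. t i) = (\<Sum>i\<in>I. tensor_eval p q (t i))"
  by (induction I rule: infinite_finite_induct) simp_all

lemma tensor_relations_0 [simp]: "0 \<in> tensor_relations f g N"
  and tensor_relations_add:
    "s \<in> tensor_relations f g N \<Longrightarrow> t \<in> tensor_relations f g N \<Longrightarrow> s + t \<in> tensor_relations f g N"
  and tensor_relations_diff:
    "s \<in> tensor_relations f g N \<Longrightarrow> t \<in> tensor_relations f g N \<Longrightarrow> s - t \<in> tensor_relations f g N"
  unfolding tensor_relations_def
  by (rule module.span_zero[OF module_frag] module.span_add[OF module_frag]
      module.span_diff[OF module_frag]; assumption)+

lemma tensor_relations_uminus:
  "t \<in> tensor_relations f g N \<Longrightarrow> - t \<in> tensor_relations f g N"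
  using tensor_relations_diff[of 0 f g N t] by simp

lemma tensor_relations_sum:
  "(\<And>i. i \<in> I \<Longrightarrow> t i \<in> tensor_relations f g N) \<Longrightarrow> (\<Sum>i\<in>I. t i) \<in> tensor_relations f g N"
  by (induction I rule: infinite_finite_induct) (auto intro: tensor_relations_add)

lemma tensor_relations_trans:
  "s - t \<in> tensor_relations f g N \<Longrightarrow> t - r \<in> tensor_relations f g N \<Longrightarrow> s - r \<in> tensor_relations f g N"
  using tensor_relations_add[of "s - t" f g N "t - r"] by simp

lemma tensor_relations_diff_cong:
  "s - s' \<in> tensor_relations f g N \<Longrightarrow> t - t' \<in> tensor_relations f g N
    \<Longrightarrow> (s - t) - (s' - t') \<in> tensor_relations f g N"
  using tensor_relations_diff[of "s - s'" f g N "t - t'"] by (simp add: algebra_simps)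

lemma tensor_add_left:
    "x \<in> N \<Longrightarrow> x' \<in> N
      \<Longrightarrow> frag_of (x + x', y) - frag_of (x, y) - frag_of (x', y) \<in> tensor_relations f g N"
  and tensor_add_right:
    "x \<in> N \<Longrightarrow> frag_of (x, y + y') - frag_of (x, y) - frag_of (x, y') \<in> tensor_relations f g N"
  and tensor_scale:
    "x \<in> N \<Longrightarrow> frag_of (f a * x, y) - frag_of (x, g a * y) \<in> tensor_relations f g N"
  unfolding tensor_relations_def by (rule module.span_base[OF module_frag]; blast)+

lemma tensor_relations_induct [consumes 1, case_names zero diff add_left add_right scale]:
  assumes "t \<in> tensor_relations f g N" "P 0" "\<And>s t. P s \<Longrightarrow> P t \<Longrightarrow> P (s - t)"
    "\<And>x x' y. x \<in> N \<Longrightarrow> x' \<in> N \<Longrightarrow> P (frag_of (x + x', y) - frag_of (x, y) - frag_of (x', y))"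
    "\<And>x y y'. x \<in> N \<Longrightarrow> P (frag_of (x, y + y') - frag_of (x, y) - frag_of (x, y'))"
    "\<And>a x y. x \<in> N \<Longrightarrow> P (frag_of (f a * x, y) - frag_of (x, g a * y))"
  shows "P t"
proof -
  have add: "P (s + t)" if "P s" "P t" for s t
    using assms(3)[OF that(1) assms(3)[OF assms(2) that(2)]] by simp
  have "module.subspace frag_cmul {t. P t}"
  proof (rule module.subspaceI[OF module_frag]; unfold mem_Collect_eq)
    show "P (frag_cmul c x)" if "P x" for c x
      using assms(2,3) that by (rule frag_closure_minus_cmul)
  qed (fact assms(2) add)+
  then have "tensor_relations f g N \<subseteq> {t. P t}"
    unfolding tensor_relations_def
    by (intro module.span_minimal[OF module_frag]) (use assms(4-6) in auto)
  with assms(1) show ?thesis by auto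
qed

lemma tensor_zero_left: "0 \<in> N \<Longrightarrow> frag_of (0, y) \<in> tensor_relations f g N"
  using tensor_relations_uminus[OF tensor_add_left[of 0 N 0 y f g]] by simp

lemma tensor_zero_right: "x \<in> N \<Longrightarrow> frag_of (x, 0) \<in> tensor_relations f g N"
  using tensor_relations_uminus[OF tensor_add_right[of x N 0 0 f g]] by simp

lemma tensor_diff_left:
  assumes "x \<in> N" "x' \<in> N" "x - x' \<in> N"
  shows "frag_of (x, y) - frag_of (x', y) - frag_of (x - x', y) \<in> tensor_relations f g N"
  using tensor_add_left[of "x - x'" N x' y f g] assms by (simp add: algebra_simps)

lemma tensor_sum_right:
  assumes "x \<in> N"
  shows "frag_of (x, \<Sum>i\<in>F. y i) - (\<Sum>i\<in>F. frag_of (x, y i)) \<in> tensor_relations f g N"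
proof (induction F rule: infinite_finite_induct)
  case (insert i F)
  then show ?case
    using tensor_relations_add[OF tensor_add_right[OF assms, of "y i" "\<Sum>i\<in>F. y i" f g] insert.IH] insert(1,2)
    by (simp add: diff_diff_eq)
qed (simp_all add: tensor_zero_right assms)

lemma tensor_eval_relations:
  assumes "is_ring_hom p" "is_ring_hom q" "\<And>a. p (f a) = q (g a)" "t \<in> tensor_relations f g N"
  shows "tensor_eval p q t = 0"
  using assms(4)
  by (induction rule: tensor_relations_induct)
    (simp_all add: ring_hom_simps[OF assms(1)] ring_hom_simps[OF assms(2)] assms(3) algebra_simps)

lemma cocartesian_hom_commute:
  assumes "cocartesian f g p q"
  shows "is_ring_hom f" "is_ring_hom g" "is_ring_hom p" "is_ring_hom q" "p (f a) = q (g a)"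
  using assms by (auto simp: cocartesian_def fun_eq_iff)

text \<open>For surjective \<open>f\<close> every tensor reduces to the form x tensor 1, so the
  tensor product is R modulo the ideal generated by the image of ker f. This trades tensor relations
  for ideal membership, for special fibres as well as for pull-backs along surjections.\<close>

lemma cocartesian_surj_iff:
  fixes \<phi> :: "'a::comm_ring_1 \<Rightarrow> 'r::comm_ring_1" and f :: "'a \<Rightarrow> 'c::comm_ring_1"
    and g :: "'r \<Rightarrow> 'd::comm_ring_1"
  assumes "surj f"
  shows "cocartesian \<phi> f g \<psi> \<longleftrightarrow>
    is_ring_hom \<phi> \<and> is_ring_hom f \<and> is_ring_hom g \<and> is_ring_hom \<psi> \<and> g \<circ> \<phi> = \<psi> \<circ> f \<and> surj g \<and>
    {x. g x = 0} \<subseteq> ideal_gen (\<phi> ` {a. f a = 0})"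
    (is "?L \<longleftrightarrow> ?R")
proof -
  let ?Rel = "tensor_relations \<phi> f UNIV" and ?I = "ideal_gen (\<phi> ` {a. f a = 0})"
  have norm: "\<exists>x. t - frag_of (x, 1) \<in> ?Rel" for t
  proof (induction t rule: frag_induct)
    case zero
    have "- frag_of (0, 1) \<in> ?Rel"
      by (intro tensor_relations_uminus tensor_zero_left) simp
    then show ?case by force
  next
    case (frag_of x c)
    obtain a where a: "f a = c" using assms by (metis surjD)
    have "- (frag_of (\<phi> a * x, 1) - frag_of (x, f a * 1)) \<in> ?Rel"
      by (intro tensor_relations_uminus tensor_scale) simp
    then show ?case using a by auto
  next
    case (diff s t)
    then obtain x y where "s - frag_of (x, 1) \<in> ?Rel" "t - frag_of (y, 1) \<in> ?Rel" by auto
    then have "(s - t) - (frag_of (x, 1) - frag_of (y, 1)) \<in> ?Rel"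
      by (rule tensor_relations_diff_cong)
    moreover have "frag_of (x, 1) - frag_of (y, 1) - frag_of (x - y, 1) \<in> ?Rel"
      by (rule tensor_diff_left) auto
    ultimately show ?case by (meson tensor_relations_trans)
  qed
  show ?thesis
  proof
    assume L: ?L
    note h = cocartesian_hom_commute[OF L]
    note hs = ring_hom_simps[OF h(1)] ring_hom_simps[OF h(2)] ring_hom_simps[OF h(3)]
    obtain s where s: "f (s c) = c" for c using assms by (metis surj_f_inv_f)
    have phiI: "\<phi> a \<in> ?I" if "f a = 0" for a by (rule ideal_gen_base) (use that in auto)
    \<comment> \<open>The inverse map sends x tensor c to x times a lift of c. The section
      \<open>s\<close> is merely a choice of preimages, hence the map is additive and balanced only
      modulo \<open>?I\<close>, which is all that is required.\<close>
    have mu: "tensor_eval id (\<lambda>c. \<phi> (s c)) t \<in> ?I" if "t \<in> ?Rel" for t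
      using that
    proof (induction rule: tensor_relations_induct)
      case (add_right x y y')
      have "x * \<phi> (s (y + y') - s y - s y') \<in> ?I"
        by (intro ideal_gen_mult phiI) (simp add: hs s)
      then show ?case by (simp add: hs algebra_simps)
    next
      case (scale a x y)
      have "x * \<phi> (a * s y - s (f a * y)) \<in> ?I"
        by (intro ideal_gen_mult phiI) (simp add: hs s)
      then show ?case by (simp add: hs algebra_simps)
    qed (auto simp: ideal_gen_0 ideal_gen_diff algebra_simps)
    have "surj g"
    proof (rule surjI)
      fix d
      have "surj (tensor_eval g \<psi>)" using L by (simp add: cocartesian_def)
      then obtain t where t: "d = tensor_eval g \<psi> t" by blast
      obtain x where "t - frag_of (x, 1) \<in> ?Rel" using norm by blast
      then have "t - frag_of (x, 1) \<in> {t. tensor_eval g \<psi> t = 0}"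
        using L unfolding cocartesian_def by blast
      then have "g x = d" using t h(4) by (simp add: ring_hom_simps)
      then show "g (SOME x. g x = d) = d" by (rule someI)
    qed
    moreover have "x \<in> ?I" if "g x = 0" for x
    proof -
      have "tensor_eval g \<psi> (frag_of (x, 1)) = 0" using that by simp
      then have "frag_of (x, 1) \<in> ?Rel" using L unfolding cocartesian_def by blast
      from mu[OF this] have "x * \<phi> (s 1) \<in> ?I" by simp
      \<comment> \<open>The section need not send 1 to 1; \<open>1 - s 1\<close> only lies in the
        kernel of \<open>f\<close>.\<close>
      moreover have "x * \<phi> (1 - s 1) \<in> ?I" by (intro ideal_gen_mult phiI) (simp add: hs s)
      ultimately have "x * \<phi> (s 1) + x * \<phi> (1 - s 1) \<in> ?I" by (rule ideal_gen_add)
      then show ?thesis by (simp add: hs algebra_simps)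
    qed
    ultimately show ?R using h unfolding fun_eq_iff o_apply by blast
  next
    assume R: ?R
    then have h: "is_ring_hom \<phi>" "is_ring_hom f" "is_ring_hom g" "is_ring_hom \<psi>"
      and gf: "g (\<phi> a) = \<psi> (f a)" for a by (auto simp: fun_eq_iff)
    have "surj (tensor_eval g \<psi>)"
    proof (rule surjI)
      fix d
      obtain x where "g x = d" using R by (metis surjD)
      then have "tensor_eval g \<psi> (frag_of (x, 1)) = d" by (simp add: ring_hom_simps[OF h(4)])
      then show "tensor_eval g \<psi> (SOME t. tensor_eval g \<psi> t = d) = d" by (rule someI)
    qed
    moreover have "t \<in> ?Rel" if "tensor_eval g \<psi> t = 0" for t
    proof -
      obtain x where x: "t - frag_of (x, 1) \<in> ?Rel" using norm by blast
      from tensor_eval_relations[OF h(3,4) gf this] have "g x = 0"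
        using that by (simp add: ring_hom_simps[OF h(4)])
      then have "x \<in> ?I" using R by auto
      then have "frag_of (x, 1) \<in> ?Rel"
      proof (induction rule: ideal_gen_induct)
        case zero
        then show ?case by (rule tensor_zero_left) simp
      next
        case (add x y)
        from tensor_relations_add[OF tensor_add_left[of x UNIV y 1 \<phi> f] tensor_relations_add[OF add]]
        show ?case by simp
      next
        case (scale c i)
        then obtain a where "i = \<phi> a" "f a = 0" by auto
        then show ?case
          using tensor_relations_add[OF tensor_scale[of c UNIV \<phi> a 1 f] tensor_zero_right[of c UNIV]]
          by (simp add: mult.commute)
      qed
      then show ?thesis using tensor_relations_add[OF x, of "frag_of (x, 1)"] by simp
    qed
    moreover have "tensor_eval g \<psi> t = 0" if "t \<in> ?Rel" for t
      using that by (rule tensor_eval_relations[OF h(3,4) gf])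
    ultimately show ?L
      using R unfolding cocartesian_def by blast
  qed
qed


subsection \<open>Flatness\<close>

text \<open>Expanding the right factors in the basis turns an element of I tensor R into a sum of
  terms c_i tensor b_i with c_i in I. If its value in R is zero, independence makes every c_i
  vanish. The intended basis is infinite, hence the finite subsets \<open>F\<close>.\<close>

lemma flat_hom_free:
  fixes \<phi> :: "'a::comm_ring_1 \<Rightarrow> 'r::comm_ring_1" and b :: "'i \<Rightarrow> 'r"
  assumes \<phi>: "is_ring_hom \<phi>"
    and gen: "\<And>x. \<exists>F c. finite F \<and> F \<subseteq> B \<and> x = (\<Sum>i\<in>F. \<phi> (c i) * b i)"
    and ind: "\<And>F c i. finite F \<Longrightarrow> F \<subseteq> B \<Longrightarrow> (\<Sum>i\<in>F. \<phi> (c i) * b i) = 0 \<Longrightarrow> i \<in> F \<Longrightarrow> c i = 0"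
  shows "flat_hom \<phi>"
  unfolding flat_hom_def
proof (intro allI impI, elim conjE)
  fix I :: "'a set" and t
  assume I: "is_ideal I" and keys: "Poly_Mapping.keys t \<subseteq> I \<times> UNIV" and ev: "tensor_eval \<phi> id t = 0"
  let ?Rel = "tensor_relations id \<phi> I"
  note i = is_ideal_ops[OF I]
  have "\<exists>F c. finite F \<and> F \<subseteq> B \<and> (\<forall>j. c j \<in> I) \<and> t - (\<Sum>i\<in>F. frag_of (c i, b i)) \<in> ?Rel"
    using keys
  proof (induction t rule: frag_keys_induct)
    case (frag_of z)
    obtain a x where z: "z = (a, x)" and a: "a \<in> I" using frag_of by auto
    obtain F c where F: "finite F" "F \<subseteq> B" and x: "x = (\<Sum>i\<in>F. \<phi> (c i) * b i)"
      using gen by blast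
    have "frag_of (a, x) - (\<Sum>i\<in>F. frag_of (a, \<phi> (c i) * b i)) \<in> ?Rel"
      unfolding x by (rule tensor_sum_right[OF a])
    moreover have "(\<Sum>i\<in>F. frag_of (a, \<phi> (c i) * b i)) - (\<Sum>i\<in>F. frag_of (c i * a, b i)) \<in> ?Rel"
      unfolding sum_subtractf[symmetric]
      using tensor_relations_uminus[OF tensor_scale[OF a, of id _ _ \<phi>]]
      by (intro tensor_relations_sum) simp
    ultimately have "frag_of z - (\<Sum>i\<in>F. frag_of (c i * a, b i)) \<in> ?Rel"
      unfolding z by (rule tensor_relations_trans)
    with F i(5)[OF a] show ?case
      by (intro exI[of _ F] exI[of _ "\<lambda>i. c i * a"] conjI allI) assumption+
  next
    case (diff s t)
    obtain F c where F: "finite F" "F \<subseteq> B" "\<forall>j. c j \<in> I"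
      and s: "s - (\<Sum>i\<in>F. frag_of (c i, b i)) \<in> ?Rel" using diff(1) by blast
    obtain G d where G: "finite G" "G \<subseteq> B" "\<forall>j. d j \<in> I"
      and t: "t - (\<Sum>i\<in>G. frag_of (d i, b i)) \<in> ?Rel" using diff(2) by blast
    \<comment> \<open>Padding with zero coefficients brings two expansions to the common index set;
      the added terms 0 tensor b_i are relations.\<close>
    have ext: "(\<Sum>i\<in>H. frag_of (h i, b i)) - (\<Sum>i\<in>F\<union>G. frag_of (if i \<in> H then h i else 0, b i)) \<in> ?Rel"
      if "H \<subseteq> F \<union> G" for H and h :: "'i \<Rightarrow> 'a"
    proof -
      have "(\<Sum>i\<in>F\<union>G. frag_of (if i \<in> H then h i else 0, b i))
        = (\<Sum>i\<in>F\<union>G-H. frag_of (if i \<in> H then h i else 0, b i))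
          + (\<Sum>i\<in>H. frag_of (if i \<in> H then h i else 0, b i))"
        by (rule sum.subset_diff) (use F G that in auto)
      also have "(\<Sum>i\<in>H. frag_of (if i \<in> H then h i else 0, b i)) = (\<Sum>i\<in>H. frag_of (h i, b i))"
        by (rule sum.cong) auto
      also have "(\<Sum>i\<in>F\<union>G-H. frag_of (if i \<in> H then h i else 0, b i)) = (\<Sum>i\<in>F\<union>G-H. frag_of (0, b i))"
        by (rule sum.cong) auto
      finally show ?thesis
        using tensor_relations_uminus[OF tensor_relations_sum[of "F\<union>G-H" "\<lambda>i. frag_of (0, b i)" id \<phi> I]]
        by (simp add: tensor_zero_left i(1))
    qed
    let ?c = "\<lambda>i. if i \<in> F then c i else 0" and ?d = "\<lambda>i. if i \<in> G then d i else 0"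
    have mem: "?c i \<in> I" "?d i \<in> I" for i using F G i(1) by auto
    have "(s - t) - ((\<Sum>i\<in>F\<union>G. frag_of (?c i, b i)) - (\<Sum>i\<in>F\<union>G. frag_of (?d i, b i))) \<in> ?Rel"
      by (intro tensor_relations_diff_cong tensor_relations_trans[OF s] tensor_relations_trans[OF t] ext)
        auto
    moreover have "(\<Sum>i\<in>F\<union>G. frag_of (?c i, b i)) - (\<Sum>i\<in>F\<union>G. frag_of (?d i, b i))
        - (\<Sum>i\<in>F\<union>G. frag_of (?c i - ?d i, b i)) \<in> ?Rel"
      unfolding sum_subtractf[symmetric]
      by (intro tensor_relations_sum tensor_diff_left mem i(3))
    ultimately have "(s - t) - (\<Sum>i\<in>F\<union>G. frag_of (?c i - ?d i, b i)) \<in> ?Rel"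
      by (rule tensor_relations_trans)
    moreover have "finite (F\<union>G)" "F\<union>G \<subseteq> B" using F G by auto
    moreover have "?c i - ?d i \<in> I" for i by (intro i(3) mem)
    ultimately show ?case
      by (intro exI[of _ "F\<union>G"] exI[of _ "\<lambda>i. ?c i - ?d i"] conjI allI) assumption+
  next
    case zero
    show ?case by (intro exI[of _ "{}"] exI[of _ "\<lambda>_. 0"]) (simp add: i(1))
  qed
  then obtain F c where F: "finite F" "F \<subseteq> B" "\<forall>j. c j \<in> I"
    and t: "t - (\<Sum>i\<in>F. frag_of (c i, b i)) \<in> ?Rel" by blast
  from tensor_eval_relations[OF \<phi> ring_hom_id _ t] ev have "(\<Sum>i\<in>F. \<phi> (c i) * b i) = 0"
    by (simp add: tensor_eval_sum)
  from ind[OF F(1,2) this] have "(\<Sum>i\<in>F. frag_of (c i, b i)) = (\<Sum>i\<in>F. frag_of (0, b i))"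
    by (intro sum.cong) auto
  also have "\<dots> \<in> ?Rel" by (intro tensor_relations_sum tensor_zero_left i(1))
  finally show "t \<in> ?Rel" using tensor_relations_add[OF t, of "\<Sum>i\<in>F. frag_of (c i, b i)"] by simp
qed


text \<open>A tensor over the localization has a common denominator: it is the image of a tensor
  \<open>t0\<close> over R multiplied by an inverse of \<iota> s. If its value vanishes, some s' in
  \<open>M\<close> kills the value of \<open>t0\<close>, and flatness of R applies to s' t0.\<close>

lemma flat_hom_localization:
  fixes \<phi> :: "'a::comm_ring_1 \<Rightarrow> 'r::comm_ring_1" and \<iota> :: "'r \<Rightarrow> 's::comm_ring_1"
  assumes \<phi>: "is_ring_hom \<phi>" and flat: "flat_hom \<phi>" and loc: "is_localization \<iota> M"
    and M1: "1 \<in> M" and Mm: "\<And>x y. x \<in> M \<Longrightarrow> y \<in> M \<Longrightarrow> x * y \<in> M"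
  shows "flat_hom (\<iota> \<circ> \<phi>)"
  unfolding flat_hom_def
proof (intro allI impI, elim conjE)
  fix I :: "'a set" and t
  assume I: "is_ideal I" and keys: "Poly_Mapping.keys t \<subseteq> I \<times> UNIV"
    and ev: "tensor_eval (\<iota> \<circ> \<phi>) id t = 0"
  have \<iota>: "is_ring_hom \<iota>" using loc by (simp add: is_localization_def)
  note hs = ring_hom_simps[OF \<phi>] ring_hom_simps[OF \<iota>]
  let ?Rel = "tensor_relations id (\<iota> \<circ> \<phi>) I" and ?Rphi = "tensor_relations id \<phi> I"
  define E where "E w = frag_extend (\<lambda>(a, x). frag_of (a :: 'a, \<iota> x * w))" for w
  define scale where "scale s = frag_extend (\<lambda>(a, x). frag_of (a :: 'a, x * s))" for s :: 'r
  have E_simps: "E w 0 = 0" "E w (s - t) = E w s - E w t" "E w (frag_of (a, x)) = frag_of (a, \<iota> x * w)"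
    for w s t a x by (simp_all add: E_def frag_extend_diff)
  have sc_simps: "scale w 0 = 0" "scale w (s - t) = scale w s - scale w t"
    "scale w (frag_of (a, x)) = frag_of (a, x * w)"
    for w s t a x by (simp_all add: scale_def frag_extend_diff)
  have ES: "E w (scale s t) = E (\<iota> s * w) t" for w s t
    by (induction t rule: frag_induct) (auto simp: E_simps sc_simps hs mult.assoc)
  have sc_keys: "Poly_Mapping.keys (scale s t) \<subseteq> I \<times> UNIV" if "Poly_Mapping.keys t \<subseteq> I \<times> UNIV" for s t
    unfolding scale_def using keys_frag_extend[of "\<lambda>(a, x). frag_of (a :: 'a, x * s)" t] that by fastforce
  have ERel: "E w t \<in> ?Rel" if "t \<in> ?Rphi" for w t
    using that
  proof (induction rule: tensor_relations_induct)
    case (add_left x x' y)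
    then show ?case unfolding E_simps by (rule tensor_add_left)
  next
    case (add_right x y y')
    then show ?case unfolding E_simps using tensor_add_right[of x I "\<iota> y * w" "\<iota> y' * w" id "\<iota> \<circ> \<phi>"]
      by (simp only: hs distrib_right)
  next
    case (scale a x y)
    have "(\<iota> \<circ> \<phi>) a * (\<iota> y * w) = \<iota> (\<phi> a * y) * w" by (simp add: hs mult.assoc)
    then show ?case unfolding E_simps using tensor_scale[OF scale, of id a "\<iota> y * w" "\<iota> \<circ> \<phi>"]
      by (simp add: o_def id_def)
  qed (simp_all add: E_simps tensor_relations_diff)
  have Eev: "tensor_eval (\<iota> \<circ> \<phi>) id (E w t) = \<iota> (tensor_eval \<phi> id t) * w" for w t
    by (induction t rule: frag_induct) (simp_all add: E_simps hs left_diff_distrib mult.assoc)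
  have Sev: "tensor_eval \<phi> id (scale s t) = tensor_eval \<phi> id t * s" for s t
    by (induction t rule: frag_induct) (simp_all add: sc_simps hs left_diff_distrib mult.assoc)
  \<comment> \<open>The inverse \<open>w\<close> is quantified universally, so that multiplying
    denominators does not require any compatibility between chosen inverses.\<close>
  have "\<exists>s t0. s \<in> M \<and> Poly_Mapping.keys t0 \<subseteq> I \<times> UNIV \<and> (\<forall>w. \<iota> s * w = 1 \<longrightarrow> t = E w t0)"
    using keys
  proof (induction t rule: frag_keys_induct)
    case (frag_of z)
    obtain a y where z: "z = (a, y)" "a \<in> I" using frag_of by auto
    obtain x s where s: "s \<in> M" and x: "\<iota> x = y * \<iota> s" using loc unfolding is_localization_def by metis
    have "E w (frag_of (a, x)) = frag_of z" if "\<iota> s * w = 1" for w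
      using that by (simp add: E_simps x z mult.assoc)
    with s z show ?case by (intro exI[of _ s] exI[of _ "frag_of (a, x)"]) simp
  next
    case (diff t1 t2)
    obtain s1 u1 where 1: "s1 \<in> M" "Poly_Mapping.keys u1 \<subseteq> I \<times> UNIV" "\<forall>w. \<iota> s1 * w = 1 \<longrightarrow> t1 = E w u1"
      using diff(1) by blast
    obtain s2 u2 where 2: "s2 \<in> M" "Poly_Mapping.keys u2 \<subseteq> I \<times> UNIV" "\<forall>w. \<iota> s2 * w = 1 \<longrightarrow> t2 = E w u2"
      using diff(2) by blast
    show ?case
    proof (intro exI[of _ "s1 * s2"] exI[of _ "scale s2 u1 - scale s1 u2"] conjI allI impI)
      show "Poly_Mapping.keys (scale s2 u1 - scale s1 u2) \<subseteq> I \<times> UNIV"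
        using keys_diff[of "scale s2 u1" "scale s1 u2"] sc_keys[OF 1(2)] sc_keys[OF 2(2)] by blast
      fix w assume w: "\<iota> (s1 * s2) * w = 1"
      have "\<iota> s1 * (\<iota> s2 * w) = 1" "\<iota> s2 * (\<iota> s1 * w) = 1"
        using w by (simp_all add: hs mult_ac)
      then show "t1 - t2 = E w (scale s2 u1 - scale s1 u2)"
        using 1(3) 2(3) by (auto simp: E_simps ES)
    qed (use Mm 1 2 in auto)
  next
    case zero
    show ?case by (intro exI[of _ 1] exI[of _ 0]) (simp add: E_simps M1)
  qed
  then obtain s t0 where s: "s \<in> M" and t0: "Poly_Mapping.keys t0 \<subseteq> I \<times> UNIV"
    "\<forall>w. \<iota> s * w = 1 \<longrightarrow> t = E w t0" by blast
  have unit: "\<exists>w. \<iota> s * w = 1" if "s \<in> M" for s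
  proof -
    have "\<iota> s dvd 1" using loc that by (simp add: is_localization_def)
    then show ?thesis by (metis dvdE)
  qed
  obtain w where w: "\<iota> s * w = 1" using unit[OF s] by blast
  have "\<iota> (tensor_eval \<phi> id t0) * w = 0" using ev t0(2) w Eev[of w t0] by simp
  then have "\<iota> (tensor_eval \<phi> id t0) * (\<iota> s * w) = 0" by (simp add: mult.left_commute)
  then have "\<iota> (tensor_eval \<phi> id t0) = 0" using w by simp
  then obtain s' where s': "s' \<in> M" "s' * tensor_eval \<phi> id t0 = 0"
    using loc unfolding is_localization_def by blast
  then have "tensor_eval \<phi> id (scale s' t0) = 0" by (simp add: Sev mult.commute)
  then have "scale s' t0 \<in> ?Rphi" using flat I sc_keys[OF t0(1)] by (simp add: flat_hom_def)
  moreover obtain w' where w': "\<iota> s' * w' = 1" using unit[OF s'(1)] by blast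
  ultimately have "E (w * w') (scale s' t0) \<in> ?Rel" by (intro ERel)
  moreover have "\<iota> s' * (w * w') = w" using w' by (simp add: mult.left_commute)
  ultimately show "t \<in> ?Rel" using t0(2) w by (simp add: ES)
qed

subsection \<open>Deformations over local Artinian algebras\<close>

lemma deformationD:
  assumes "deformation \<xi> \<eta> \<rho> \<phi> \<pi>"
  shows "is_ring_hom \<eta>" "is_ring_hom \<rho>" "\<rho> (\<eta> c) = c" "is_ring_hom \<phi>" "is_ring_hom \<pi>" "is_ring_hom \<xi>"
    "\<pi> (\<phi> a) = \<xi> (\<rho> a)" "flat_hom \<phi>" "\<exists>r. \<pi> r = x"
    "\<pi> r = 0 \<Longrightarrow> r \<in> ideal_gen (\<phi> ` {a. \<rho> a = 0})"
proof -
  have p: "pointed_algebra \<eta> \<rho>" and c: "cocartesian \<phi> \<rho> \<pi> \<xi>" and "flat_hom \<phi>"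
    using assms by (simp_all add: deformation_def)
  then show "is_ring_hom \<eta>" "is_ring_hom \<rho>" "\<rho> (\<eta> c) = c" "flat_hom \<phi>" by (simp_all add: pointed_algebra_def)
  have "surj \<rho>" using p by (metis pointed_algebra_def surjI)
  from c[unfolded cocartesian_surj_iff[OF this]]
  show "is_ring_hom \<phi>" "is_ring_hom \<pi>" "is_ring_hom \<xi>" "\<pi> (\<phi> a) = \<xi> (\<rho> a)" "\<exists>r. \<pi> r = x"
    "\<pi> r = 0 \<Longrightarrow> r \<in> ideal_gen (\<phi> ` {a. \<rho> a = 0})"
    by (auto simp: fun_eq_iff) (metis surjD)
qed

text \<open>\<open>J' \<subseteq> J\<close> are ideals with \<open>J/J'\<close> one-dimensional over the residue field and spanned by \<open>e\<close>.\<close>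

definition colength_one ::
    "('k::field \<Rightarrow> 'a::comm_ring_1) \<Rightarrow> ('a \<Rightarrow> 'k) \<Rightarrow> 'a set \<Rightarrow> 'a set \<Rightarrow> 'a \<Rightarrow> bool" where
  "colength_one \<eta> \<rho> J' J e \<longleftrightarrow> is_ideal J' \<and> is_ideal J \<and> J' \<subseteq> J \<and> e \<in> J \<and> e \<notin> J' \<and>
     (\<forall>j\<in>J. \<exists>c. j - \<eta> c * e \<in> J') \<and> (\<forall>a j. \<rho> a = 0 \<longrightarrow> j \<in> J \<longrightarrow> a * j \<in> J')"

lemma colength_oneD:
  assumes "colength_one \<eta> \<rho> J' J e"
  shows "is_ideal J'" "is_ideal J" "J' \<subseteq> J" "e \<in> J" "e \<notin> J'" "j \<in> J \<Longrightarrow> \<exists>c. j - \<eta> c * e \<in> J'"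
    "\<rho> a = 0 \<Longrightarrow> j \<in> J \<Longrightarrow> a * j \<in> J'"
  using assms by (auto simp: colength_one_def)

text \<open>Brings membership in the extended ideal J R into the shape of a tensor in J tensor R, to
  which \<open>flat_hom\<close> speaks.\<close>

lemma ideal_gen_image_tensor:
  assumes \<phi>: "is_ring_hom \<phi>" and J: "is_ideal J" and x: "x \<in> ideal_gen (\<phi> ` J)"
  obtains t where "Poly_Mapping.keys t \<subseteq> J \<times> UNIV" "tensor_eval \<phi> id t = x"
proof -
  have "\<exists>t. Poly_Mapping.keys t \<subseteq> J \<times> UNIV \<and> tensor_eval \<phi> id t = x"
    using x
  proof (induction rule: ideal_gen_induct)
    case zero
    show ?case by (rule exI[of _ 0]) simp
  next
    case (add x y)
    then obtain s t where "Poly_Mapping.keys s \<subseteq> J \<times> UNIV" "tensor_eval \<phi> id s = x"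
      "Poly_Mapping.keys t \<subseteq> J \<times> UNIV" "tensor_eval \<phi> id t = y" by blast
    moreover from this have "Poly_Mapping.keys (s + t) \<subseteq> J \<times> UNIV"
      using Poly_Mapping.keys_add[of s t] by blast
    ultimately show ?case by (intro exI[of _ "s + t"]) (simp only: tensor_eval_add)
  next
    case (scale c g)
    then obtain j where "j \<in> J" "g = \<phi> j" by blast
    then show ?case by (intro exI[of _ "frag_of (j, c)"]) (auto simp: mult.commute)
  qed
  then show ?thesis using that by blast
qed

text \<open>Flatness embeds \<open>(J/J') \<otimes> R\<close>, a copy of the special fibre, into \<open>R/J'R\<close>.\<close>

lemma flat_colength_one:
  fixes \<phi> :: "'a::comm_ring_1 \<Rightarrow> 'r::comm_ring_1"
  assumes d: "deformation \<xi> \<eta> \<rho> \<phi> \<pi>" and c: "colength_one \<eta> \<rho> J' J e"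
    and r: "\<phi> e * r \<in> ideal_gen (\<phi> ` J')"
  shows "\<pi> r = 0"
proof -
  note D = deformationD[OF d] and C = colength_oneD[OF c]
  note hs = ring_hom_simps[OF D(1)] ring_hom_simps[OF D(2)] ring_hom_simps[OF D(4)]
    ring_hom_simps[OF D(5)] ring_hom_simps[OF D(6)]
  note i' = is_ideal_ops[OF C(1)] and i = is_ideal_ops[OF C(2)]
  have uniq: "b = b'" if "j - \<eta> b * e \<in> J'" "j - \<eta> b' * e \<in> J'" for j b b'
  proof (rule ccontr)
    assume ne: "b \<noteq> b'"
    have "(j - \<eta> b' * e) - (j - \<eta> b * e) \<in> J'" by (intro i'(3) that)
    then have "\<eta> (b - b') * e \<in> J'" by (simp add: hs algebra_simps)
    then have "\<eta> (1 / (b - b')) * (\<eta> (b - b') * e) \<in> J'" by (rule i'(5))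
    moreover have "\<eta> (1 / (b - b')) * \<eta> (b - b') = 1" using ne by (simp flip: hs(4) add: hs(2))
    ultimately show False using C(5) by (simp flip: mult.assoc)
  qed
  \<comment> \<open>The coordinate of J/J' with respect to \<open>e\<close>. It is linear over A
    through \<rho>, so that \<kappa> tensor \<pi> is well defined on J tensor R, with values in the
    special fibre.\<close>
  define \<kappa> where "\<kappa> j = (THE b. j - \<eta> b * e \<in> J')" for j
  have \<kappa>: "\<kappa> j = b" if "j - \<eta> b * e \<in> J'" for j b
    unfolding \<kappa>_def using that uniq by blast
  have \<kappa>2: "j - \<eta> (\<kappa> j) * e \<in> J'" if "j \<in> J" for j
    using C(6)[OF that] \<kappa> by blast
  have add: "\<kappa> (x + y) = \<kappa> x + \<kappa> y" if "x \<in> J" "y \<in> J" for x y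
    using i'(2)[OF \<kappa>2[OF that(1)] \<kappa>2[OF that(2)]] by (intro \<kappa>) (simp add: hs algebra_simps)
  have scale: "\<kappa> (a * x) = \<rho> a * \<kappa> x" if "x \<in> J" for a x
  proof (rule \<kappa>)
    have "(a - \<eta> (\<rho> a)) * x + \<eta> (\<rho> a) * (x - \<eta> (\<kappa> x) * e) \<in> J'"
      by (intro i'(2) i'(5) C(7) \<kappa>2 that) (simp add: hs D(3))
    then show "a * x - \<eta> (\<rho> a * \<kappa> x) * e \<in> J'" by (simp add: hs algebra_simps)
  qed
  have \<kappa>0: "\<kappa> j = 0" if "j \<in> J'" for j
    by (rule \<kappa>) (simp add: hs that)
  have \<kappa>e: "\<kappa> e = 1" by (rule \<kappa>) (simp add: hs i'(1))
  let ?L = "tensor_eval (\<lambda>j. \<xi> (\<kappa> j)) \<pi>"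
  have rel: "?L t = 0" if "t \<in> tensor_relations id \<phi> J" for t
    using that
    by (induction rule: tensor_relations_induct)
      (simp_all add: add scale hs D(7) algebra_simps)
  obtain t where t: "Poly_Mapping.keys t \<subseteq> J' \<times> UNIV" "tensor_eval \<phi> id t = \<phi> e * r"
    using ideal_gen_image_tensor[OF D(4) C(1) r] .
  \<comment> \<open>Both tensors have the value \<phi> e * r, so flatness for \<open>J\<close>
    identifies them; \<open>t\<close> lives on \<open>J'\<close>, where \<kappa> vanishes, whereas e
    tensor r goes to \<pi> r.\<close>
  have "frag_of (e, r) - t \<in> tensor_relations id \<phi> J"
  proof -
    have "Poly_Mapping.keys (frag_of (e, r) - t) \<subseteq> J \<times> UNIV"
      using keys_diff[of "frag_of (e, r)" t] t(1) C(3,4) by auto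
    moreover have "tensor_eval \<phi> id (frag_of (e, r) - t) = 0" using t(2) by simp
    ultimately show ?thesis using D(8) C(2) unfolding flat_hom_def by blast
  qed
  from rel[OF this] have "\<pi> r - ?L t = 0" by (simp add: \<kappa>e hs)
  moreover have "?L t = 0"
    using t(1) by (induction rule: frag_keys_induct) (auto simp: \<kappa>0 hs)
  ultimately show ?thesis by simp
qed

lemma colength_one_decomp:
  assumes \<phi>: "is_ring_hom \<phi>" and c: "colength_one \<eta> \<rho> J' J e" and x: "x \<in> ideal_gen (\<phi> ` J)"
  obtains r where "x - \<phi> e * r \<in> ideal_gen (\<phi> ` J')"
proof -
  note hs = ring_hom_simps[OF \<phi>]
  have "\<exists>r. x - \<phi> e * r \<in> ideal_gen (\<phi> ` J')"
    using x
  proof (induction rule: ideal_gen_induct)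
    case zero
    show ?case by (rule exI[of _ 0]) (simp add: ideal_gen_0)
  next
    case (add x y)
    then obtain r s where "x - \<phi> e * r \<in> ideal_gen (\<phi> ` J')" "y - \<phi> e * s \<in> ideal_gen (\<phi> ` J')" by blast
    from ideal_gen_add[OF this] show ?case
      by (intro exI[of _ "r + s"]) (simp add: algebra_simps)
  next
    case (scale b g)
    then obtain j where j: "j \<in> J" "g = \<phi> j" by blast
    obtain d where "j - \<eta> d * e \<in> J'" using colength_oneD(6)[OF c j(1)] by blast
    then have "b * \<phi> (j - \<eta> d * e) \<in> ideal_gen (\<phi> ` J')" by (intro ideal_gen_mult ideal_gen_base) blast
    then show ?case by (intro exI[of _ "b * \<phi> (\<eta> d)"]) (simp add: hs j algebra_simps)
  qed
  then show ?thesis using that by blast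
qed

lemma colength_one_mult:
  assumes \<phi>: "is_ring_hom \<phi>" and c: "colength_one \<eta> \<rho> J' J e"
    and j: "j \<in> J" and r: "r \<in> ideal_gen (\<phi> ` {a. \<rho> a = 0})"
  shows "\<phi> j * r \<in> ideal_gen (\<phi> ` J')"
  using r
proof (induction rule: ideal_gen_induct)
  case (scale b g)
  then obtain a where "\<rho> a = 0" "g = \<phi> a" by blast
  then have "b * \<phi> (a * j) \<in> ideal_gen (\<phi> ` J')"
    using colength_oneD(7)[OF c _ j] by (intro ideal_gen_mult ideal_gen_base) blast
  then show ?case by (simp add: ring_hom_simps[OF \<phi>] \<open>g = \<phi> a\<close> mult_ac)
qed (simp_all add: ideal_gen_0 ideal_gen_add distrib_left)

section \<open>Consequences of the descending chain condition\<close>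

lemma artinian_minimal_ideal:
  fixes \<eta> :: "'k::field \<Rightarrow> 'a::comm_ring_1" and J :: "'a set"
  assumes A: "local_artinian \<eta> \<rho>" and J: "is_ideal J" "P J"
  obtains I where "is_ideal I" "P I" "\<And>I'. is_ideal I' \<Longrightarrow> I' \<subset> I \<Longrightarrow> \<not> P I'"
proof -
  let ?r = "{(I' :: 'a set, I). is_ideal I' \<and> is_ideal I \<and> I' \<subset> I}"
  have "wf ?r"
    unfolding wf_iff_no_infinite_down_chain
  proof (intro notI, elim exE)
    fix I assume "\<forall>n. (I (Suc n), I n) \<in> ?r"
    then have "\<forall>n. is_ideal (I n) \<and> I (Suc n) \<subset> I n" by simp
    then have "\<exists>I :: nat \<Rightarrow> 'a set. \<forall>n. is_ideal (I n) \<and> I (Suc n) \<subset> I n" by (rule exI[of _ I])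
    then show False using A by (simp add: local_artinian_def)
  qed
  moreover have "J \<in> {I. is_ideal I \<and> P I}" using J by simp
  ultimately show ?thesis
  proof (rule wfE_min)
    fix I assume "I \<in> {I. is_ideal I \<and> P I}"
      and "\<And>I'. (I', I) \<in> ?r \<Longrightarrow> I' \<notin> {I. is_ideal I \<and> P I}"
    then show ?thesis by (intro that[of I]) auto
  qed
qed

text \<open>Nakayama's lemma without finite generation of \<open>J\<close>. Take an ideal L minimal
  among those that do not annihilate J, and x in L with x J nonzero. Since J = m J, some a in m has
  a x J nonzero, so by minimality L is generated by a x. Then x = b a x, and 1 - b a is a
  unit.\<close>

lemma artinian_nakayama:
  fixes \<eta> :: "'k::field \<Rightarrow> 'a::comm_ring_1"
  assumes A: "local_artinian \<eta> \<rho>" and J: "is_ideal J"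
    and sub: "J \<subseteq> ideal_gen {a * j | a j. \<rho> a = 0 \<and> j \<in> J}"
  shows "J = {0}"
proof (rule ccontr)
  assume "J \<noteq> {0}"
  then obtain j0 where "j0 \<in> J" "j0 \<noteq> 0" using is_ideal_ops(1)[OF J] by blast
  have \<rho>: "is_ring_hom \<rho>" using A by (simp add: local_artinian_def pointed_algebra_def)
  let ?P = "\<lambda>L. \<exists>x\<in>L. \<exists>j\<in>J. x * j \<noteq> 0"
  have "?P UNIV" using \<open>j0 \<in> J\<close> \<open>j0 \<noteq> 0\<close> by (metis UNIV_I mult_1)
  then obtain L where L: "is_ideal L" "?P L" and min: "\<And>L'. is_ideal L' \<Longrightarrow> L' \<subset> L \<Longrightarrow> \<not> ?P L'"
    using artinian_minimal_ideal[OF A, of UNIV ?P] is_idealI[of UNIV] by blast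
  obtain x j where x: "x \<in> L" "j \<in> J" "x * j \<noteq> 0" using L(2) by blast
  have "\<exists>a j'. \<rho> a = 0 \<and> j' \<in> J \<and> x * (a * j') \<noteq> 0"
  proof (rule ccontr)
    assume "\<not> ?thesis"
    then have "ideal_gen {a * j | a j. \<rho> a = 0 \<and> j \<in> J} \<subseteq> {y. x * y = 0}"
      by (intro ideal_gen_minimal is_idealI) (auto simp: distrib_left mult.left_commute)
    then show False using x sub by blast
  qed
  then obtain a j' where a: "\<rho> a = 0" "j' \<in> J" "x * (a * j') \<noteq> 0" by blast
  let ?L = "range (\<lambda>b. b * (a * x))"
  have "is_ideal ?L"
  proof (rule is_idealI)
    show "0 \<in> ?L" by (rule range_eqI[of _ _ 0]) simp
    show "y + z \<in> ?L" if yz: "y \<in> ?L" "z \<in> ?L" for y z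
    proof -
      obtain b c where "y = b * (a * x)" "z = c * (a * x)" using yz by blast
      then show ?thesis by (intro range_eqI[of _ _ "b + c"]) (simp add: distrib_right)
    qed
    show "c * y \<in> ?L" if y: "y \<in> ?L" for c y
    proof -
      obtain b where "y = b * (a * x)" using y by blast
      then show ?thesis by (intro range_eqI[of _ _ "c * b"]) (simp add: mult.assoc)
    qed
  qed
  moreover have "?P ?L"
  proof -
    have "a * x * j' \<noteq> 0" using a(3) by (simp add: mult_ac)
    moreover have "a * x \<in> ?L" by (rule range_eqI[of _ _ 1]) simp
    ultimately show ?thesis using a(2) by (intro bexI)
  qed
  moreover have "?L \<subseteq> L" using is_ideal_ops(5)[OF L(1)] x(1) by auto
  ultimately have "?L = L" using min by blast
  then obtain b where "x = b * (a * x)" using x(1) by blast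
  then have "x * (1 - b * a) = 0" by (simp add: algebra_simps)
  moreover have "(1 - b * a) dvd 1"
  proof -
    have "\<rho> (1 - b * a) \<noteq> 0" using a(1) by (simp add: ring_hom_simps[OF \<rho>])
    then show ?thesis using A by (simp add: local_artinian_def)
  qed
  then obtain v where "1 = (1 - b * a) * v" by (rule dvdE)
  ultimately have "x = 0" by (metis mult.assoc mult.right_neutral mult_zero_left)
  then show False using x(3) by simp
qed

text \<open>By Nakayama there is \<open>e\<close> in J outside m J. An ideal M between m J and J
  that is maximal among those avoiding \<open>e\<close> does it: modulo M, every nonzero line in the
  vector space J/M contains the class of \<open>e\<close>.\<close>

lemma exists_colength_one:
  fixes \<eta> :: "'k::field \<Rightarrow> 'a::comm_ring_1"
  assumes A: "local_artinian \<eta> \<rho>" and J: "is_ideal J" "J \<noteq> {0}"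
  obtains J' e where "colength_one \<eta> \<rho> J' J e"
proof -
  have \<rho>: "is_ring_hom \<rho>" and \<eta>: "is_ring_hom \<eta>" and \<rho>\<eta>: "\<rho> (\<eta> c) = c" for c
    using A by (auto simp: local_artinian_def pointed_algebra_def)
  note hs = ring_hom_simps[OF \<rho>] ring_hom_simps[OF \<eta>] and i = is_ideal_ops[OF J(1)]
  let ?mJ = "ideal_gen {a * j | a j. \<rho> a = 0 \<and> j \<in> J}"
  have mJ: "?mJ \<subseteq> J" by (rule ideal_gen_minimal[OF _ J(1)]) (auto simp: i)
  obtain e where e: "e \<in> J" "e \<notin> ?mJ" using artinian_nakayama[OF A J(1)] J(2) by blast
  let ?A = "{I. is_ideal I \<and> ?mJ \<subseteq> I \<and> I \<subseteq> J \<and> e \<notin> I}"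
  have "\<exists>M\<in>?A. \<forall>X\<in>?A. M \<subseteq> X \<longrightarrow> X = M"
  proof (rule subset_Zorn_nonempty)
    show "?A \<noteq> {}" using e mJ is_ideal_ideal_gen by blast
    fix C assume C: "C \<noteq> {}" "subset.chain ?A C"
    then have CA: "C \<subseteq> ?A" and tot: "\<And>X Y. X \<in> C \<Longrightarrow> Y \<in> C \<Longrightarrow> X \<subseteq> Y \<or> Y \<subseteq> X"
      by (auto simp: subset_chain_def)
    have "is_ideal (\<Union>C)"
    proof (rule is_idealI)
      show "0 \<in> \<Union>C" using C(1) CA is_ideal_ops(1) by blast
      show "c * x \<in> \<Union>C" if "x \<in> \<Union>C" for c x using that CA is_ideal_ops(5) by blast
      show "x + y \<in> \<Union>C" if xy: "x \<in> \<Union>C" "y \<in> \<Union>C" for x y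
      proof -
        obtain X Y where XY: "X \<in> C" "Y \<in> C" "x \<in> X" "y \<in> Y" using xy by blast
        then obtain Z where Z: "Z \<in> C" "x \<in> Z" "y \<in> Z" using tot by blast
        then have "is_ideal Z" using CA by blast
        then show ?thesis using Z is_ideal_ops(2) by blast
      qed
    qed
    then show "\<Union>C \<in> ?A" using C(1) CA by blast
  qed
  then obtain M where M: "is_ideal M" "?mJ \<subseteq> M" "M \<subseteq> J" "e \<notin> M"
    and max: "\<And>X. X \<in> ?A \<Longrightarrow> M \<subseteq> X \<Longrightarrow> X = M" by auto
  note iM = is_ideal_ops[OF M(1)]
  have mJM: "a * j \<in> M" if "\<rho> a = 0" "j \<in> J" for a j
  proof -
    have "a * j \<in> ?mJ" by (rule ideal_gen_base) (use that in blast)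
    then show ?thesis using M(2) by blast
  qed
  have "\<exists>c. j - \<eta> c * e \<in> M" if j: "j \<in> J" for j
  proof (cases "j \<in> M")
    case True
    then show ?thesis by (intro exI[of _ 0]) (simp add: hs)
  next
    case False
    \<comment> \<open>Adding the line spanned by \<open>j\<close> over the field already gives an
      ideal, because the maximal ideal sends \<open>j\<close> into M.\<close>
    let ?X = "{m + \<eta> c * j | m c. m \<in> M}"
    have X: "is_ideal ?X"
    proof (rule is_idealI)
      show "0 \<in> ?X" using iM(1) hs by (auto intro!: exI[of _ 0])
      fix x assume "x \<in> ?X"
      then obtain m b where x: "x = m + \<eta> b * j" "m \<in> M" by blast
      show "c * x \<in> ?X" for c
      proof (intro CollectI exI conjI)
        show "c * x = (c * m + (c - \<eta> (\<rho> c)) * (\<eta> b * j)) + \<eta> (\<rho> c * b) * j"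
          by (simp add: x hs algebra_simps)
        show "c * m + (c - \<eta> (\<rho> c)) * (\<eta> b * j) \<in> M"
          by (intro iM mJM x i j) (simp add: hs \<rho>\<eta>)
      qed
      fix y assume "y \<in> ?X"
      then obtain n d where y: "y = n + \<eta> d * j" "n \<in> M" by blast
      show "x + y \<in> ?X"
        using iM(2)[OF x(2) y(2)]
        by (intro CollectI exI[of _ "m + n"] exI[of _ "b + d"]) (simp add: x y hs algebra_simps)
    qed
    have MX: "M \<subseteq> ?X" by (force intro: exI[of _ 0] simp: hs)
    have "j \<in> ?X" using iM(1) by (intro CollectI exI[of _ 0] exI[of _ 1]) (simp add: hs)
    then have "?X \<notin> ?A" using max[OF _ MX] False by blast
    moreover have "?X \<subseteq> J"
    proof
      fix x assume "x \<in> ?X"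
      then obtain m b where "x = m + \<eta> b * j" "m \<in> M" by blast
      then show "x \<in> J" using i(2)[OF _ i(5)[OF j]] M(3) by blast
    qed
    moreover have "?mJ \<subseteq> ?X" using M(2) MX by (rule subset_trans)
    ultimately have "e \<in> ?X" using X unfolding mem_Collect_eq[of ?X] by meson
    then obtain m b where m: "e = m + \<eta> b * j" "m \<in> M" by blast
    then have b: "b \<noteq> 0" using M(4) by (auto simp: hs)
    have "\<eta> (1 / b) * \<eta> b = 1" using b by (simp flip: hs(10) add: hs(8))
    then have "j - \<eta> (1 / b) * e = - \<eta> (1 / b) * m"
      by (simp add: m(1) distrib_left flip: mult.assoc)
    then show ?thesis using iM(5)[OF m(2)] by metis
  qed
  then have "colength_one \<eta> \<rho> M J e"
    using M J(1) e(1) mJM by (simp add: colength_one_def)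
  then show ?thesis by (rule that)
qed

text \<open>Replaces induction on the length: a property passed on to one-dimensional steps J' below
  J descends from \<open>J0\<close> to the zero ideal.\<close>

lemma artinian_ideal_induct [consumes 2, case_names start step]:
  fixes \<eta> :: "'k::field \<Rightarrow> 'a::comm_ring_1" and J0 :: "'a set"
  assumes A: "local_artinian \<eta> \<rho>" and J0: "is_ideal J0" "P J0"
    and step: "\<And>J J' e. J \<subseteq> J0 \<Longrightarrow> colength_one \<eta> \<rho> J' J e \<Longrightarrow> P J \<Longrightarrow> P J'"
  shows "P {0}"
proof -
  obtain I where I: "is_ideal I" "P I \<and> I \<subseteq> J0"
    and min: "\<And>I'. is_ideal I' \<Longrightarrow> I' \<subset> I \<Longrightarrow> \<not> (P I' \<and> I' \<subseteq> J0)"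
    using artinian_minimal_ideal[OF A J0(1), of "\<lambda>I. P I \<and> I \<subseteq> J0"] J0(2) by blast
  have "I = {0}"
  proof (rule ccontr)
    assume "I \<noteq> {0}"
    then obtain J' e where c: "colength_one \<eta> \<rho> J' I e" using exists_colength_one[OF A I(1)] by blast
    then have "P J'" using step I(2) by blast
    moreover have "J' \<subset> I" "is_ideal J'" using colength_oneD[OF c] by blast+
    ultimately show False using min I(2) by blast
  qed
  then show ?thesis using I(2) by simp
qed

lemma ideal_gen_singleton_0: "ideal_gen {0 :: 'a::comm_ring_1} = {0}"
  using ideal_gen_minimal[of "{0}" "{0 :: 'a}"] is_idealI[of "{0 :: 'a}"] ideal_gen_0 by fastforce

text \<open>Newton's correction: if r v = 1 + e s modulo J' R, then v (1 - e s) is an inverse modulo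
  J' R, since the induction starts at the maximal ideal and thus e^2 lies in J'. The result later
  extends maps to the local ring of the total space.\<close>

lemma deformation_unit_lift:
  fixes \<phi> :: "'a::comm_ring_1 \<Rightarrow> 'r::comm_ring_1"
  assumes A: "local_artinian \<eta> \<rho>" and d: "deformation \<xi> \<eta> \<rho> \<phi> \<pi>" and r: "\<pi> r dvd 1"
  shows "r dvd 1"
proof -
  note D = deformationD[OF d]
  note hs = ring_hom_simps[OF D(4)] ring_hom_simps[OF D(5)]
  from A is_ideal_kernel[OF D(2)] have "\<exists>v. r * v - 1 \<in> ideal_gen (\<phi> ` {0})"
  proof (induction rule: artinian_ideal_induct)
    case start
    obtain x where "1 = \<pi> r * x" using r by (rule dvdE)
    moreover obtain v where "\<pi> v = x" using D(9) by blast
    ultimately have "\<pi> (r * v - 1) = 0" by (simp add: hs)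
    then show ?case using D(10) by blast
  next
    case (step J J' e)
    note C = colength_oneD[OF step(2)]
    obtain v where "r * v - 1 \<in> ideal_gen (\<phi> ` J)" using step(3) by blast
    then obtain s where s: "r * v - 1 - \<phi> e * s \<in> ideal_gen (\<phi> ` J')"
      by (rule colength_one_decomp[OF D(4) step(2)])
    have "\<phi> (e * e) \<in> ideal_gen (\<phi> ` J')"
      using C(4,7) step(1) by (intro ideal_gen_base imageI) blast
    then have "(r * v - 1 - \<phi> e * s) * (1 - \<phi> e * s) - s * s * \<phi> (e * e) \<in> ideal_gen (\<phi> ` J')"
      by (intro ideal_gen_diff ideal_gen_mult2[OF s] ideal_gen_mult)
    then show ?case by (intro exI[of _ "v * (1 - \<phi> e * s)"]) (simp add: hs algebra_simps)
  qed
  then obtain v where "r * v = 1" by (auto simp: hs ideal_gen_singleton_0)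
  then show ?thesis by (metis dvdI)
qed

text \<open>A map between flat families that is the identity on special fibres is an isomorphism.\<close>

lemma cocartesian_over_artinian:
  fixes \<phi> :: "'a::comm_ring_1 \<Rightarrow> 'r::comm_ring_1" and \<Phi> :: "'s::comm_ring_1 \<Rightarrow> 't::comm_ring_1"
  assumes A: "local_artinian \<eta> \<rho>" and d: "deformation \<xi> \<eta> \<rho> \<phi> \<pi>"
    and S: "deformation \<xi> \<eta>\<^sub>S \<rho>\<^sub>S \<Phi> \<Pi>" and u: "is_ring_hom u" "\<And>s. \<rho> (u s) = \<rho>\<^sub>S s"
    and h: "is_ring_hom h" "\<And>s. h (\<Phi> s) = \<phi> (u s)" "\<And>t. \<pi> (h t) = \<Pi> t"
  shows "cocartesian \<Phi> u h \<phi>"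
proof -
  note D = deformationD[OF d] and E = deformationD[OF S]
  note hs = ring_hom_simps[OF D(4)] ring_hom_simps[OF D(5)] ring_hom_simps[OF h(1)]
    ring_hom_simps[OF u(1)]
  let ?Rel = "tensor_relations \<Phi> u UNIV"
  \<comment> \<open>Starting at the unit ideal makes the comparison on the special fibre the first
    step of the induction: there J' is the maximal ideal and \<open>e\<close> a unit.\<close>
  have I0: "is_ideal (UNIV :: 'a set)" by (rule is_idealI) auto
  have "\<exists>t. tensor_eval h \<phi> t = r" for r
  proof -
    from A I0 have "\<exists>t. r - tensor_eval h \<phi> t \<in> ideal_gen (\<phi> ` {0})"
    proof (induction rule: artinian_ideal_induct)
      case start
      have "1 \<in> ideal_gen (range \<phi>)" by (rule ideal_gen_base) (metis hs(2) rangeI)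
      from ideal_gen_mult[OF this, of r] show ?case by (intro exI[of _ 0]) simp
    next
      case (step J J' e)
      note C = colength_oneD[OF step(2)]
      obtain t where "r - tensor_eval h \<phi> t \<in> ideal_gen (\<phi> ` J)" using step(3) by blast
      then obtain s where s: "r - tensor_eval h \<phi> t - \<phi> e * s \<in> ideal_gen (\<phi> ` J')"
        by (rule colength_one_decomp[OF D(4) step(2)])
      obtain x where "\<Pi> x = \<pi> s" using E(9) by blast
      then have "\<phi> e * (s - h x) \<in> ideal_gen (\<phi> ` J')"
        by (intro colength_one_mult[OF D(4) step(2) C(4)] D(10)) (simp add: hs h)
      from ideal_gen_add[OF s this] show ?case
        by (intro exI[of _ "t + frag_of (x, e)"]) (simp add: algebra_simps)
    qed
    then show ?thesis by (auto simp: hs ideal_gen_singleton_0)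
  qed
  then have "surj (tensor_eval h \<phi>)" by (metis surjI)
  moreover have ev: "tensor_eval h \<phi> t = 0" if "t \<in> ?Rel" for t
    using that by (rule tensor_eval_relations[OF h(1) D(4) h(2)])
  moreover have "t \<in> ?Rel" if t0: "tensor_eval h \<phi> t = 0" for t
  proof -
    from A I0 have "\<exists>t'. t - t' \<in> ?Rel \<and> Poly_Mapping.keys t' \<subseteq> UNIV \<times> {0}"
    proof (induction rule: artinian_ideal_induct)
      case start
      show ?case by (rule exI[of _ t]) simp
    next
      case (step J J' e)
      note C = colength_oneD[OF step(2)]
      have split: "\<exists>x t''. t' - (frag_of (x, e) + t'') \<in> ?Rel \<and> Poly_Mapping.keys t'' \<subseteq> UNIV \<times> J'"
        if "Poly_Mapping.keys t' \<subseteq> UNIV \<times> J" for t'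
        using that
      proof (induction rule: frag_keys_induct)
        case zero
        show ?case using tensor_relations_uminus[OF tensor_zero_left[of UNIV e \<Phi> u]]
          by (intro exI[of _ 0]) simp
      next
        case (frag_of z)
        then obtain x j where z: "z = (x, j)" "j \<in> J" by auto
        then obtain c where c: "j - \<eta> c * e \<in> J'" using C(6) by blast
        let ?j = "j - \<eta> c * e" and ?c = "\<eta>\<^sub>S c"
        \<comment> \<open>Only compatibility of \<open>u\<close> with the residue maps is at hand,
          so \<open>u ?c\<close> and \<eta> c agree modulo the maximal ideal; that maximal ideal
          sends \<open>e\<close> into J'.\<close>
        have uc: "u ?c * e - \<eta> c * e \<in> J'"
          using C(7)[OF _ C(4), of "u ?c - \<eta> c"] ring_hom_simps[OF D(2)]
          by (simp add: u(2) D(3) E(3) algebra_simps)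
        have j2: "j - u ?c * e \<in> J'" using is_ideal_ops(3)[OF C(1) c uc] by simp
        have "frag_of (x, u ?c * e + (j - u ?c * e)) - frag_of (x, u ?c * e)
            - frag_of (x, j - u ?c * e) \<in> ?Rel" by (rule tensor_add_right) simp
        moreover have "- (frag_of (\<Phi> ?c * x, e) - frag_of (x, u ?c * e)) \<in> ?Rel"
          by (intro tensor_relations_uminus tensor_scale) simp
        ultimately have "(frag_of (x, u ?c * e + (j - u ?c * e)) - frag_of (x, u ?c * e)
            - frag_of (x, j - u ?c * e)) + - (frag_of (\<Phi> ?c * x, e) - frag_of (x, u ?c * e)) \<in> ?Rel"
          by (rule tensor_relations_add)
        then show ?case using j2
          by (intro exI[of _ "\<Phi> ?c * x"] exI[of _ "frag_of (x, j - u ?c * e)"])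
            (simp add: z(1) algebra_simps)
      next
        case (diff s t)
        then obtain x s' y t' where s: "s - (frag_of (x, e) + s') \<in> ?Rel" "Poly_Mapping.keys s' \<subseteq> UNIV \<times> J'"
          and t: "t - (frag_of (y, e) + t') \<in> ?Rel" "Poly_Mapping.keys t' \<subseteq> UNIV \<times> J'" by blast
        have "frag_of (x, e) - frag_of (y, e) - frag_of (x - y, e) \<in> ?Rel"
          by (rule tensor_diff_left) auto
        from tensor_relations_add[OF tensor_relations_diff[OF s(1) t(1)] this]
        have "(s - t) - (frag_of (x - y, e) + (s' - t')) \<in> ?Rel" by (simp add: algebra_simps)
        moreover have "Poly_Mapping.keys (s' - t') \<subseteq> UNIV \<times> J'"
          using keys_diff[of s' t'] s(2) t(2) by blast
        ultimately show ?case by blast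
      qed
      obtain t' where t': "t - t' \<in> ?Rel" "Poly_Mapping.keys t' \<subseteq> UNIV \<times> J" using step(3) by blast
      obtain x t'' where x: "t' - (frag_of (x, e) + t'') \<in> ?Rel" "Poly_Mapping.keys t'' \<subseteq> UNIV \<times> J'"
        using split[OF t'(2)] by blast
      \<comment> \<open>Vanishing of the value puts e h(x) into J' R. Flatness then gives \<Pi> x =
        0, so x is a combination of parameters vanishing at the point, and moving these across the
        tensor sign turns x tensor e into a tensor with right entries in J'.\<close>
      have "tensor_eval h \<phi> t = h x * \<phi> e + tensor_eval h \<phi> t''"
        using ev[OF t'(1)] ev[OF x(1)] by simp
      then have "\<phi> e * h x = - tensor_eval h \<phi> t''" using t0 by (simp add: algebra_simps add_eq_0_iff)
      moreover have "tensor_eval h \<phi> t'' \<in> ideal_gen (\<phi> ` J')"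
        using x(2)
      proof (induction rule: frag_keys_induct)
        case (frag_of z)
        then show ?case by (cases z) (auto intro: ideal_gen_mult ideal_gen_base)
      qed (simp_all add: ideal_gen_0 ideal_gen_diff)
      ultimately have "\<phi> e * h x \<in> ideal_gen (\<phi> ` J')" by (simp add: ideal_gen_uminus)
      from flat_colength_one[OF d step(2) this] have "\<Pi> x = 0" by (simp add: h)
      then have "x \<in> ideal_gen (\<Phi> ` {a. \<rho>\<^sub>S a = 0})" by (rule E(10))
      then have "\<exists>t'. frag_of (x, e) - t' \<in> ?Rel \<and> Poly_Mapping.keys t' \<subseteq> UNIV \<times> J'"
      proof (induction rule: ideal_gen_induct)
        case zero
        then show ?case by (intro exI[of _ 0]) (simp add: tensor_zero_left)
      next
        case (add x y)
        then obtain s t where s: "frag_of (x, e) - s \<in> ?Rel" "Poly_Mapping.keys s \<subseteq> UNIV \<times> J'"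
          and t: "frag_of (y, e) - t \<in> ?Rel" "Poly_Mapping.keys t \<subseteq> UNIV \<times> J'" by blast
        from tensor_relations_add[OF tensor_add_left[of x UNIV y e \<Phi> u] tensor_relations_add[OF s(1) t(1)]]
        have "frag_of (x + y, e) - (s + t) \<in> ?Rel" by (simp add: algebra_simps)
        moreover have "Poly_Mapping.keys (s + t) \<subseteq> UNIV \<times> J'"
          using Poly_Mapping.keys_add[of s t] s(2) t(2) by blast
        ultimately show ?case by blast
      next
        case (scale b g)
        then obtain a where a: "\<rho>\<^sub>S a = 0" "g = \<Phi> a" by blast
        have "u a * e \<in> J'" using C(7)[OF _ C(4)] u(2) a(1) by simp
        moreover have "frag_of (\<Phi> a * b, e) - frag_of (b, u a * e) \<in> ?Rel" by (rule tensor_scale) simp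
        ultimately show ?case using a(2)
          by (intro exI[of _ "frag_of (b, u a * e)"]) (simp add: mult.commute)
      qed
      then obtain s where s: "frag_of (x, e) - s \<in> ?Rel" "Poly_Mapping.keys s \<subseteq> UNIV \<times> J'" by blast
      have "(t - t') + (t' - (frag_of (x, e) + t'')) + (frag_of (x, e) - s) \<in> ?Rel"
        by (intro tensor_relations_add t' x s)
      then have "t - (s + t'') \<in> ?Rel" by (simp add: algebra_simps)
      moreover have "Poly_Mapping.keys (s + t'') \<subseteq> UNIV \<times> J'"
        using Poly_Mapping.keys_add[of s t''] s(2) x(2) by blast
      ultimately show ?case by blast
    qed
    then obtain t' where t': "t - t' \<in> ?Rel" "Poly_Mapping.keys t' \<subseteq> UNIV \<times> {0}" by blast
    have "t' \<in> ?Rel"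
      using t'(2)
      by (induction rule: frag_keys_induct) (auto intro: tensor_zero_right tensor_relations_diff)
    then show ?thesis using tensor_relations_add[OF t'(1), of t'] by simp
  qed
  ultimately show ?thesis
    using E(4) u(1) h(1,2) D(4) unfolding cocartesian_def fun_eq_iff o_apply by blast
qed

subsection \<open>Universal properties of the coordinate rings\<close>

definition meval :: "('a::comm_ring_1 \<Rightarrow> 'b::comm_ring_1) \<Rightarrow> ('v \<Rightarrow> 'b) \<Rightarrow> ('v, 'a) mpol \<Rightarrow> 'b" where
  "meval f v p = (\<Sum>m\<in>Poly_Mapping.keys p. f (Poly_Mapping.lookup p m) *
     (\<Prod>x\<in>Poly_Mapping.keys m. v x ^ Poly_Mapping.lookup m x))"

lemma poly_mapping_sum_single:
  "p = (\<Sum>x\<in>Poly_Mapping.keys p. Poly_Mapping.single x (Poly_Mapping.lookup p x))"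
  by (rule poly_mapping_eqI) (auto simp: lookup_sum lookup_single when_def in_keys_iff)

lemma mpol_induct [case_names const var add mult]:
  fixes p :: "('v, 'a::comm_ring_1) mpol"
  assumes const: "\<And>c. P (pconst c)" and var: "\<And>v. P (pvar v)"
    and add: "\<And>p q. P p \<Longrightarrow> P q \<Longrightarrow> P (p + q)" and mult: "\<And>p q. P p \<Longrightarrow> P q \<Longrightarrow> P (p * q)"
  shows "P p"
proof -
  have P0: "P 0" using const[of 0] by (simp add: pconst_def)
  have P1: "P 1" using const[of 1] by (simp add: pconst_def)
  have pw: "P (Poly_Mapping.single (Poly_Mapping.single v n) 1)" for v and n :: nat
  proof (induction n)
    case (Suc n)
    have "Poly_Mapping.single (Poly_Mapping.single v (Suc n)) 1
      = pvar v * Poly_Mapping.single (Poly_Mapping.single v n) (1 :: 'a)"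
      by (simp add: pvar_def mult_single flip: single_add)
    then show ?case using mult[OF var Suc] by simp
  qed (use P1 in simp)
  have mon: "P (Poly_Mapping.single (\<Sum>v\<in>K. Poly_Mapping.single v (m v)) 1)" for K and m :: "'v \<Rightarrow> nat"
  proof (induction K rule: infinite_finite_induct)
    case (insert v K)
    then show ?case using mult[OF pw insert.IH] by (simp add: mult_single)
  qed (use P1 in simp_all)
  have sing: "P (Poly_Mapping.single m c)" for m c
    using mult[OF const[of c] mon[of "Poly_Mapping.lookup m" "Poly_Mapping.keys m"]]
    by (simp add: pconst_def mult_single flip: poly_mapping_sum_single)
  have "P (\<Sum>m\<in>K. Poly_Mapping.single m (f m))" for K f
    by (induction K rule: infinite_finite_induct) (simp_all add: P0 add sing)
  then show ?thesis using poly_mapping_sum_single[of p] by metis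
qed

lemma meval_hom:
  fixes f :: "'a::comm_ring_1 \<Rightarrow> 'b::comm_ring_1" and v :: "'v \<Rightarrow> 'b"
  assumes f: "is_ring_hom f"
  shows "is_ring_hom (meval f v)" "meval f v (pconst c) = f c" "meval f v (pvar x) = v x"
proof -
  note hs = ring_hom_simps[OF f]
  define \<mu> where "\<mu> m = (\<Prod>x\<in>Poly_Mapping.keys m. v x ^ Poly_Mapping.lookup m x)" for m :: "'v \<Rightarrow>\<^sub>0 nat"
  have \<mu>_sup: "\<mu> m = (\<Prod>x\<in>K. v x ^ Poly_Mapping.lookup m x)"
    if "finite K" "Poly_Mapping.keys m \<subseteq> K" for m K
    unfolding \<mu>_def by (rule prod.mono_neutral_left) (use that in \<open>auto simp: in_keys_iff\<close>)
  have \<mu>_add: "\<mu> (m + n) = \<mu> m * \<mu> n" for m n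
  proof -
    let ?K = "Poly_Mapping.keys m \<union> Poly_Mapping.keys n"
    have "\<mu> r = (\<Prod>x\<in>?K. v x ^ Poly_Mapping.lookup r x)" if "r \<in> {m, n, m + n}" for r
      by (rule \<mu>_sup) (use that Poly_Mapping.keys_add[of m n] in auto)
    then show ?thesis by (simp add: lookup_add power_add prod.distrib)
  qed
  have ev: "meval f v p = (\<Sum>m\<in>K. f (Poly_Mapping.lookup p m) * \<mu> m)"
    if "finite K" "Poly_Mapping.keys p \<subseteq> K" for p K
    unfolding meval_def \<mu>_def
    by (rule sum.mono_neutral_left) (use that in \<open>auto simp: in_keys_iff hs\<close>)
  have add: "meval f v (p + q) = meval f v p + meval f v q" for p q
  proof -
    let ?K = "Poly_Mapping.keys p \<union> Poly_Mapping.keys q"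
    have "meval f v r = (\<Sum>m\<in>?K. f (Poly_Mapping.lookup r m) * \<mu> m)" if "r \<in> {p, q, p + q}" for r
      by (rule ev) (use that Poly_Mapping.keys_add[of p q] in auto)
    then show ?thesis by (simp add: lookup_add hs distrib_right sum.distrib)
  qed
  have sing: "meval f v (Poly_Mapping.single m c) = f c * \<mu> m" for m c
    by (subst ev[of "{m}"]) auto
  have sum: "meval f v (sum h K) = (\<Sum>x\<in>K. meval f v (h x))" for h and K :: "('v \<Rightarrow>\<^sub>0 nat) set"
  proof (induction K rule: infinite_finite_induct)
  qed (simp_all add: add, simp_all add: meval_def)
  have prod: "meval f v (sum g X * sum h Y) = meval f v (sum g X) * meval f v (sum h Y)"
    if "\<And>x y. meval f v (g x * h y) = meval f v (g x) * meval f v (h y)"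
    for g h and X Y :: "('v \<Rightarrow>\<^sub>0 nat) set"
    unfolding sum_product sum by (intro sum.cong refl that)
  have "meval f v (p * q) = meval f v p * meval f v q" for p q
    using prod[of "\<lambda>x. Poly_Mapping.single x (Poly_Mapping.lookup p x)"
        "\<lambda>x. Poly_Mapping.single x (Poly_Mapping.lookup q x)"
        "Poly_Mapping.keys p" "Poly_Mapping.keys q"]
    by (simp add: mult_single sing hs \<mu>_add mult_ac flip: poly_mapping_sum_single)
  moreover have c: "meval f v (pconst c) = f c" for c
    by (simp add: pconst_def sing \<mu>_def)
  moreover have "meval f v 1 = 1" using c[of 1] by (simp add: pconst_def hs)
  ultimately show "is_ring_hom (meval f v)" "meval f v (pconst c) = f c"
    by (simp_all add: is_ring_hom_def add)
  show "meval f v (pvar x) = v x"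
    by (simp add: pvar_def sing \<mu>_def hs)
qed

text \<open>One universal property for all three quotient types. \<open>F \<circ> rep\<close> is a
  homomorphism despite the arbitrary representatives because F identifies whatever
  \<open>proj\<close> identifies.\<close>

lemma quotient_hom:
  fixes proj :: "'p::comm_ring_1 \<Rightarrow> 'q::comm_ring_1" and F :: "'p \<Rightarrow> 'b::comm_ring_1"
  assumes "\<And>x. proj (rep x) = x" "\<And>p q. proj p = proj q \<longleftrightarrow> p - q \<in> I" "is_ring_hom proj"
    and F: "is_ring_hom F" "\<And>p. p \<in> I \<Longrightarrow> F p = 0"
  shows "is_ring_hom (F \<circ> rep)" "(F \<circ> rep) (proj p) = F p"
proof -
  note hs = ring_hom_simps[OF F(1)] ring_hom_simps[OF assms(3)]
  have *: "F p = F q" if "proj p = proj q" for p q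
    using F(2)[of "p - q"] assms(2) that by (simp add: hs)
  show "is_ring_hom (F \<circ> rep)"
    unfolding is_ring_hom_def o_apply hs(2)[symmetric] hs(3)[symmetric] hs(4)[symmetric]
    by (intro conjI allI *) (simp_all add: hs assms(1))
  show "(F \<circ> rep) (proj p) = F p" unfolding o_apply by (rule *) (rule assms(1))
qed

lemma abs_base_ring:
  "abs_base_ring (rep_base_ring x) = x" "abs_base_ring p = abs_base_ring q \<longleftrightarrow> p - q \<in> base_ideal"
  "is_ring_hom abs_base_ring" "abs_base_ring (pconst c) = base_const c"
  "abs_base_ring (pvar (i, j)) = base_param i j"
proof -
  show "abs_base_ring (rep_base_ring x) = x"
    by (rule Quotient_abs_rep[OF Quotient_base_ring])
  show "abs_base_ring p = abs_base_ring q \<longleftrightarrow> p - q \<in> base_ideal" by (rule base_ring.abs_eq_iff)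
  show "is_ring_hom abs_base_ring"
    by (simp add: is_ring_hom_def one_base_ring_def plus_base_ring.abs_eq times_base_ring.abs_eq)
  show "abs_base_ring (pconst c) = base_const c" by (simp add: base_const.abs_eq)
  show "abs_base_ring (pvar (i, j)) = base_param i j" by (simp add: base_param.abs_eq)
qed

lemma base_const_hom: "is_ring_hom base_const"
  using ring_hom_comp[OF pconst_hom abs_base_ring(3)] by (simp add: o_def abs_base_ring)

lemma base_ring_induct [case_names const param add mult]:
  fixes x :: "('k::field, 'n::finite) base_ring"
  assumes "\<And>c. P (base_const c)" "\<And>i j. P (base_param i j)" "\<And>x y. P x \<Longrightarrow> P y \<Longrightarrow> P (x + y)"
    "\<And>x y. P x \<Longrightarrow> P y \<Longrightarrow> P (x * y)"
  shows "P x"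
proof -
  have "P (abs_base_ring p)" for p :: "('n \<times> 'n, 'k) mpol"
    by (induction p rule: mpol_induct)
      (auto simp: abs_base_ring ring_hom_simps[OF abs_base_ring(3)] assms)
  then show ?thesis by (metis abs_base_ring(1))
qed

lemma base_param_antisym: "base_param i j + base_param j i = 0"
proof -
  have "pvar (i, j) + pvar (j, i) \<in> base_ideal" unfolding base_ideal_def by (rule ideal_gen_base) blast
  then have "abs_base_ring (pvar (i, j) + pvar (j, i)) = abs_base_ring 0" by (simp add: abs_base_ring(2))
  then show ?thesis by (simp add: ring_hom_simps[OF abs_base_ring(3)] abs_base_ring)
qed

lemma base_param_Phi:
  fixes i :: "'n::finite"
  assumes "distinct [i, j, k, l, m]"
  defines "a \<equiv> (base_param :: _ \<Rightarrow> _ \<Rightarrow> ('k::field, 'n) base_ring)"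
  shows "(a i k - a i j) * (a j k - a j i) - (a i k - a i l) * (a l k - a l i)
     - (a i m - a i j) * (a j m - a j i) + (a i m - a i l) * (a l m - a l i) = 0"
proof -
  have "Phi i j k l m \<in> base_ideal" if "distinct [i, j, k, l, m]" for i j k l m :: 'n
    unfolding base_ideal_def using that
    by (intro ideal_gen_base UnI2 CollectI exI[of _ i] exI[of _ j] exI[of _ l] exI[of _ k] exI[of _ m]) auto
  then have "abs_base_ring (Phi i j k l m :: ('n \<times> 'n, 'k) mpol) = abs_base_ring 0"
    if "distinct [i, j, k, l, m]" for i j k l m
    unfolding abs_base_ring(2) using that by simp
  \<comment> \<open>The parameters of \<open>Phi\<close> come in the order i, j, l, k, m.\<close>
  moreover have "distinct [i, j, l, k, m]" using assms(1) by auto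
  ultimately have "abs_base_ring (Phi i j l k m :: ('n \<times> 'n, 'k) mpol) = abs_base_ring 0" by blast
  then show ?thesis
    by (simp add: Phi_def ring_hom_simps[OF abs_base_ring(3)] abs_base_ring a_def)
qed

lemma base_ring_hom_exists:
  fixes f :: "'k::field \<Rightarrow> 'b::comm_ring_1" and a :: "'n::finite \<Rightarrow> 'n \<Rightarrow> 'b"
  assumes f: "is_ring_hom f" and anti: "\<And>i j. a i j + a j i = 0"
    and Phi: "\<And>i j k l m. distinct [i, j, k, l, m] \<Longrightarrow>
      (a i k - a i j) * (a j k - a j i) - (a i k - a i l) * (a l k - a l i)
     - (a i m - a i j) * (a j m - a j i) + (a i m - a i l) * (a l m - a l i) = 0"
  obtains u :: "('k, 'n) base_ring \<Rightarrow> 'b" where "is_ring_hom u" "\<And>c. u (base_const c) = f c"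
    "\<And>i j. u (base_param i j) = a i j"
proof -
  let ?F = "meval f (\<lambda>(i, j). a i j)"
  note F = meval_hom[OF f, of "\<lambda>(i, j). a i j"]
  have "?F p = 0" if "p \<in> base_ideal" for p
    using F(1) _ that[unfolded base_ideal_def]
    by (rule ring_hom_ideal_gen_0)
      (auto simp: ring_hom_simps[OF F(1)] F anti Phi_def Let_def Phi[simplified])
  note q = quotient_hom[OF abs_base_ring(1-3) F(1) this]
  show ?thesis
    by (rule that[OF q(1)]) (simp_all only: abs_base_ring(4,5)[symmetric] q(2) F prod.case)
qed

definition total_coord :: "'n::finite \<Rightarrow> ('k::field, 'n) total_ring" where
  "total_coord i = abs_total_ring (pvar i)"

lemma abs_total_ring:
  "abs_total_ring (rep_total_ring x) = x" "abs_total_ring p = abs_total_ring q \<longleftrightarrow> p - q \<in> total_ideal"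
  "is_ring_hom abs_total_ring" "abs_total_ring (pconst b) = base_to_total b"
  "abs_total_ring (pvar i) = total_coord i"
proof -
  show "abs_total_ring (rep_total_ring x) = x"
    by (rule Quotient_abs_rep[OF Quotient_total_ring])
  show "abs_total_ring p = abs_total_ring q \<longleftrightarrow> p - q \<in> total_ideal" by (rule total_ring.abs_eq_iff)
  show "is_ring_hom abs_total_ring"
    by (simp add: is_ring_hom_def one_total_ring_def plus_total_ring.abs_eq times_total_ring.abs_eq)
  show "abs_total_ring (pconst b) = base_to_total b" by (simp add: base_to_total.abs_eq)
qed (simp add: total_coord_def)

lemma base_to_total_hom: "is_ring_hom base_to_total"
  using ring_hom_comp[OF pconst_hom abs_total_ring(3)] by (simp add: o_def abs_total_ring)

lemma total_ring_induct [case_names base coord add mult]: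
  fixes x :: "('k::field, 'n::finite) total_ring"
  assumes "\<And>b. P (base_to_total b)" "\<And>i. P (total_coord i)" "\<And>x y. P x \<Longrightarrow> P y \<Longrightarrow> P (x + y)"
    "\<And>x y. P x \<Longrightarrow> P y \<Longrightarrow> P (x * y)"
  shows "P x"
proof -
  have "P (abs_total_ring p)" for p :: "('n, ('k, 'n) base_ring) mpol"
    by (induction p rule: mpol_induct)
      (auto simp: abs_total_ring ring_hom_simps[OF abs_total_ring(3)] assms)
  then show ?thesis by (metis abs_total_ring(1))
qed

lemma family_poly_total:
  fixes i :: "'n::finite"
  assumes "distinct [i, j, k, l]"
  defines "a \<equiv> \<lambda>i j. base_to_total (base_param i j :: ('k::field, 'n) base_ring)" and "z \<equiv> total_coord"
  shows "z i * z j - z i * z l + (a i j - a i l) * z i + a j i * z j - a l i * z l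
     - a i j * a i k - a j i * a j k - a k i * a k j
     + a i l * a i k + a l i * a l k + a k i * a k l = 0"
proof -
  have "(family_poly i j l k :: ('n, ('k, 'n) base_ring) mpol) - 0 \<in> total_ideal"
    unfolding total_ideal_def using assms(1) by (intro ideal_gen_base) auto
  then have "abs_total_ring (family_poly i j l k :: ('n, ('k, 'n) base_ring) mpol) = abs_total_ring 0"
    unfolding abs_total_ring(2) .
  then show ?thesis
    by (simp add: family_poly_def Let_def ring_hom_simps[OF abs_total_ring(3)] abs_total_ring a_def z_def)
qed

lemma total_ring_hom_exists:
  fixes u :: "('k::field, 'n::finite) base_ring \<Rightarrow> 'b::comm_ring_1" and z :: "'n \<Rightarrow> 'b"
  assumes u: "is_ring_hom u" and a: "\<And>i j. a i j = u (base_param i j)"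
    and rel: "\<And>i j k l. distinct [i, j, k, l] \<Longrightarrow>
      z i * z j - z i * z l + (a i j - a i l) * z i + a j i * z j - a l i * z l
     - a i j * a i k - a j i * a j k - a k i * a k j
     + a i l * a i k + a l i * a l k + a k i * a k l = 0"
  obtains h :: "('k, 'n) total_ring \<Rightarrow> 'b" where "is_ring_hom h" "\<And>b. h (base_to_total b) = u b"
    "\<And>i. h (total_coord i) = z i"
proof -
  note F = meval_hom[OF u, of z]
  have "meval u z p = 0" if "p \<in> total_ideal" for p
    using F(1) _ that[unfolded total_ideal_def]
    by (rule ring_hom_ideal_gen_0)
      (auto simp: ring_hom_simps[OF F(1)] F family_poly_def Let_def rel[simplified] simp flip: a)
  note q = quotient_hom[OF abs_total_ring(1-3) F(1) this]
  show ?thesis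
    by (rule that[OF q(1)]) (simp_all only: abs_total_ring(4,5)[symmetric] q(2) F)
qed

lemma abs_lines_ring:
  "abs_lines_ring (rep_lines_ring x) = x" "abs_lines_ring p = abs_lines_ring q \<longleftrightarrow> p - q \<in> lines_ideal"
  "is_ring_hom abs_lines_ring" "abs_lines_ring (pconst c) = lines_const c"
  "abs_lines_ring (pvar i) = lines_coord i"
proof -
  show "abs_lines_ring (rep_lines_ring x) = x"
    by (rule Quotient_abs_rep[OF Quotient_lines_ring])
  show "abs_lines_ring p = abs_lines_ring q \<longleftrightarrow> p - q \<in> lines_ideal" by (rule lines_ring.abs_eq_iff)
  show "is_ring_hom abs_lines_ring"
    by (simp add: is_ring_hom_def one_lines_ring_def plus_lines_ring.abs_eq times_lines_ring.abs_eq)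
  show "abs_lines_ring (pconst c) = lines_const c" by (simp add: lines_const.abs_eq)
  show "abs_lines_ring (pvar i) = lines_coord i" by (simp add: lines_coord.abs_eq)
qed

lemma lines_const_hom: "is_ring_hom lines_const"
  using ring_hom_comp[OF pconst_hom abs_lines_ring(3)] by (simp add: o_def abs_lines_ring)

lemma lines_ring_induct [case_names const coord add mult]:
  fixes x :: "('k::field, 'n::finite) lines_ring"
  assumes "\<And>c. P (lines_const c)" "\<And>i. P (lines_coord i)" "\<And>x y. P x \<Longrightarrow> P y \<Longrightarrow> P (x + y)"
    "\<And>x y. P x \<Longrightarrow> P y \<Longrightarrow> P (x * y)"
  shows "P x"
proof -
  have "P (abs_lines_ring p)" for p :: "('n, 'k) mpol"
    by (induction p rule: mpol_induct)
      (auto simp: abs_lines_ring ring_hom_simps[OF abs_lines_ring(3)] assms)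
  then show ?thesis by (metis abs_lines_ring(1))
qed

lemma lines_coord_mult:
  assumes "i \<noteq> j" "k \<noteq> l"
  shows "lines_coord i * lines_coord j = (lines_coord k * lines_coord l :: ('k::field, 'n::finite) lines_ring)"
proof -
  have "pvar i * pvar j - pvar k * pvar l \<in> lines_ideal"
    unfolding lines_ideal_def using assms by (intro ideal_gen_base) blast
  then have "abs_lines_ring (pvar i * pvar j) = (abs_lines_ring (pvar k * pvar l) :: ('k, 'n) lines_ring)"
    by (simp add: abs_lines_ring(2))
  then show ?thesis by (simp add: ring_hom_simps[OF abs_lines_ring(3)] abs_lines_ring)
qed

lemma lines_ring_hom_exists:
  fixes f :: "'k::field \<Rightarrow> 'b::comm_ring_1" and z :: "'n::finite \<Rightarrow> 'b"
  assumes f: "is_ring_hom f" and rel: "\<And>i j k l. i \<noteq> j \<Longrightarrow> k \<noteq> l \<Longrightarrow> z i * z j = z k * z l"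
  obtains h :: "('k, 'n) lines_ring \<Rightarrow> 'b" where "is_ring_hom h" "\<And>b. h (lines_const b) = f b"
    "\<And>i. h (lines_coord i) = z i"
proof -
  note F = meval_hom[OF f, of z]
  have "meval f z p = 0" if "p \<in> lines_ideal" for p
    using F(1) _ that[unfolded lines_ideal_def]
    by (rule ring_hom_ideal_gen_0) (auto simp: ring_hom_simps[OF F(1)] F intro: rel)
  note q = quotient_hom[OF abs_lines_ring(1-3) F(1) this]
  show ?thesis
    by (rule that[OF q(1)]) (simp_all only: abs_lines_ring(4,5)[symmetric] q(2) F)
qed

lemma base_origin_const [simp]: "base_origin (base_const c) = c"
  using base_origin.abs_eq[of "pconst c"] by (simp add: abs_base_ring)

lemma lines_origin: "is_ring_hom lines_origin" "lines_origin (lines_const c) = c"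
  "lines_origin (lines_coord i) = 0"
proof -
  show "is_ring_hom (lines_origin :: ('a::field, 'b::finite) lines_ring \<Rightarrow> 'a)"
    unfolding is_ring_hom_def
    by (intro conjI allI; transfer; simp add: lookup_one lookup_add lookup_mult_0)
qed (transfer; simp)+

lemma total_to_lines:
  "is_ring_hom (total_to_lines :: ('k::field, 'n::finite) total_ring \<Rightarrow> _)"
  "total_to_lines (base_to_total b) = lines_const (base_origin b)"
  "total_to_lines (total_coord i) = lines_coord i"
proof -
  note c = coeff_map_hom[OF base_origin_hom]
  have *: "total_to_lines (abs_total_ring p) = abs_lines_ring (coeff_map base_origin p)" for p
    by (simp add: total_to_lines.abs_eq)
  show "is_ring_hom (total_to_lines :: ('k, 'n) total_ring \<Rightarrow> _)"
    unfolding is_ring_hom_def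
  proof (intro conjI allI)
    fix x y :: "('k, 'n) total_ring"
    obtain p q where "x = abs_total_ring p" "y = abs_total_ring q" by (metis abs_total_ring(1))
    then show "total_to_lines (x + y) = total_to_lines x + total_to_lines y"
      "total_to_lines (x * y) = total_to_lines x * total_to_lines y"
      by (simp_all add: * ring_hom_simps[OF c] ring_hom_simps[OF abs_lines_ring(3)]
          flip: ring_hom_simps(3,4)[OF abs_total_ring(3)])
  next
    show "total_to_lines 1 = 1"
      using *[of 1] by (simp add: ring_hom_simps[OF c] ring_hom_simps[OF abs_lines_ring(3)]
          ring_hom_simps[OF abs_total_ring(3)])
  qed
  show "total_to_lines (base_to_total b) = lines_const (base_origin b)"
    using *[of "pconst b"] by (simp add: coeff_map_simps[OF base_origin_hom] abs_total_ring abs_lines_ring)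
  show "total_to_lines (total_coord i) = lines_coord i"
    using *[of "pvar i"] by (simp add: coeff_map_simps[OF base_origin_hom] abs_total_ring abs_lines_ring)
qed

lemma total_origin_hom: "is_ring_hom total_origin"
  using ring_hom_comp[OF total_to_lines(1) lines_origin(1)] by (simp add: o_def flip: total_origin_def)

subsection \<open>Additive form of the base equations\<close>

lemma obtain_other:
  fixes F :: "'n::finite set"
  assumes "card F < CARD('n)"
  obtains x where "x \<notin> F"
proof -
  have "F \<noteq> UNIV" using assms by auto
  then show ?thesis using that by blast
qed

text \<open>Entries may coincide: \<open>{i, i, i}\<close> is the idiom for a second index and
  \<open>{i, j, j}\<close> for a third one.\<close>

lemma obtain_fourth:
  fixes i j k :: "'n::finite"
  assumes "CARD('n) \<ge> 4"
  obtains l where "l \<notin> {i, j, k}"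
proof -
  have "card {i, j, k} \<le> 3" by (intro card_insert_le_m1) auto
  then show ?thesis using assms obtain_other[of "{i, j, k}"] that by force
qed

text \<open>If S_ijk = c_i + c_j + c_k, then S_ijk + S_ijl + S_ikl - 2 S_jkl = 3 c_i. The exchange
  property makes this combination \<open>C\<close> independent of j, k, l, and t = 1/3 recovers c_i.
  With four indices there is nothing to exchange, and the symmetry of \<open>C\<close> alone
  suffices.\<close>

lemma symmetric_exchange_sum:
  fixes S :: "'n::finite \<Rightarrow> 'n \<Rightarrow> 'n \<Rightarrow> 'a::comm_ring_1" and t :: 'a
  assumes n: "CARD('n) \<ge> 4" and t: "3 * t = 1"
    and sym: "\<And>i j k. S i j k = S j i k" "\<And>i j k. S i j k = S i k j"
    and ex: "\<And>i j k l m. distinct [i, j, k, l, m] \<Longrightarrow> S i j k - S i l k = S i j m - S i l m"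
  obtains c where "\<And>i j k. distinct [i, j, k] \<Longrightarrow> S i j k = c i + c j + c k"
proof -
  define C where "C i j k l = S i j k + S i j l + S i k l - 2 * S j k l" for i j k l
  have Csym: "C i j k l = C i k j l" "C i j k l = C i j l k" for i j k l
    unfolding C_def sym(2)[of i k j] sym(1)[of k j l] sym(2)[of i l k] sym(2)[of j l k]
    by (simp_all add: algebra_simps)
  \<comment> \<open>The last index enters only through S_ijx - S_jkx and S_ikx - S_jkx, which are
    exchange differences with j and k in front.\<close>
  have swap: "C i j k l = C i j k m" if "distinct [i, j, k, l]" "distinct [i, j, k, m]" for i j k l m
  proof (cases "l = m")
    case False
    have "S j i l - S j k l = S j i m - S j k m" "S k i l - S k j l = S k i m - S k j m"
      by (rule ex; use that False in auto)+
    then have f: "S i j l - S j k l = S i j m - S j k m" "S i k l - S j k l = S i k m - S j k m"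
      unfolding sym(1)[of j i] sym(1)[of k i] sym(1)[of k j] .
    have e: "C i j k x = S i j k + (S i j x - S j k x) + (S i k x - S j k x)" for x
      by (simp add: C_def)
    show ?thesis unfolding e f ..
  qed simp
  \<comment> \<open>Together with the symmetry of \<open>C\<close> in its last three indices,
    replacing one index at a time connects any two triples.\<close>
  have step: "\<exists>k' l'. distinct [i, j', k', l'] \<and> C i j k l = C i j' k' l'"
    if "distinct [i, j, k, l]" "j' \<noteq> i" for i j k l j'
  proof (cases "j' \<in> {j, k, l}")
    case True
    then consider "j' = j" | "j' = k" | "j' = l" by blast
    then show ?thesis
    proof cases
      case 1
      then show ?thesis using that by (intro exI[of _ k] exI[of _ l]) auto
    next
      case 2
      then show ?thesis using that Csym(1)[of i j k l] by (intro exI[of _ j] exI[of _ l]) auto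
    next
      case 3
      then show ?thesis using that Csym(2)[of i j k l] Csym(1)[of i j l k]
        by (intro exI[of _ j] exI[of _ k]) auto
    qed
  next
    case False
    then have "C i j k l = C i j k j'" by (intro swap) (use that in auto)
    then have "C i j k l = C i j' j k" using Csym(2)[of i j k j'] Csym(1)[of i j j' k] by simp
    moreover have "distinct [i, j', j, k]" using False that by auto
    ultimately show ?thesis by blast
  qed
  have step2: "\<exists>l'. distinct [i, j, k', l'] \<and> C i j k l = C i j k' l'"
    if "distinct [i, j, k, l]" "k' \<noteq> i" "k' \<noteq> j" for i j k l k'
  proof (cases "k' \<in> {k, l}")
    case True
    then consider "k' = k" | "k' = l" by blast
    then show ?thesis
    proof cases
      case 1
      then show ?thesis using that by (intro exI[of _ l]) auto
    next
      case 2
      then show ?thesis using that Csym(2)[of i j k l] by (intro exI[of _ k]) auto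
    qed
  next
    case False
    then have "C i j k l = C i j k k'" by (intro swap) (use that in auto)
    then have "C i j k l = C i j k' k" using Csym(2)[of i j k k'] by simp
    moreover have "distinct [i, j, k', k]" using False that by auto
    ultimately show ?thesis by blast
  qed
  have indep: "C i j k l = C i j' k' l'"
    if d: "distinct [i, j, k, l]" and d': "distinct [i, j', k', l']" for i j k l j' k' l'
  proof -
    have ne: "j' \<noteq> i" "k' \<noteq> i" "k' \<noteq> j'" using d' by auto
    obtain k1 l1 where 1: "distinct [i, j', k1, l1]" "C i j k l = C i j' k1 l1"
      using step[OF d ne(1)] by blast
    obtain l2 where 2: "distinct [i, j', k', l2]" "C i j' k1 l1 = C i j' k' l2"
      using step2[OF 1(1) ne(2,3)] by blast
    show ?thesis unfolding 1(2) 2(2) by (rule swap[OF 2(1) d'])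
  qed
  have "\<exists>x. \<forall>j k l. distinct [i, j, k, l] \<longrightarrow> C i j k l = x" for i
    using indep by blast
  then have "\<exists>D. \<forall>i j k l. distinct [i, j, k, l] \<longrightarrow> C i j k l = D i" by (intro choice) blast
  then obtain D where D: "\<And>i j k l. distinct [i, j, k, l] \<Longrightarrow> C i j k l = D i" by blast
  show ?thesis
  proof (rule that[of "\<lambda>i. t * D i"])
    fix i j k :: 'n assume d: "distinct [i, j, k]"
    obtain l where l: "l \<notin> {i, j, k}" using n by (rule obtain_fourth)
    have eq: "D i = C i j k l" "D j = C j i k l" "D k = C k i j l"
      using D[of i j k l] D[of j i k l] D[of k i j l] d l by auto
    have sy: "S j i k = S i j k" "S k i j = S i j k" "S j i l = S i j l" "S k i l = S i k l" "S k j l = S j k l"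
      unfolding sym(1)[of j i] sym(1)[of k i] sym(1)[of k j] sym(2)[of i k j] by (rule refl)+
    have "D i + D j + D k = 3 * S i j k" unfolding eq C_def sy by (simp add: algebra_simps)
    then have "t * (D i + D j + D k) = 3 * t * S i j k" by simp
    then have "t * D i + t * D j + t * D k = 3 * t * S i j k" by (simp only: distrib_left)
    then show "S i j k = t * D i + t * D j + t * D k" by (simp add: t)
  qed
qed

text \<open>\<open>\<Phi>\<^sup>i\<^sub>j\<^sub>l\<^sub>;\<^sub>k\<^sub>m = S\<^sub>i\<^sub>j\<^sub>k - S\<^sub>i\<^sub>l\<^sub>k - S\<^sub>i\<^sub>j\<^sub>m + S\<^sub>i\<^sub>l\<^sub>m\<close> for the symmetric expression
  \<open>S\<^sub>i\<^sub>j\<^sub>k = a\<^sub>i\<^sub>ja\<^sub>i\<^sub>k + a\<^sub>j\<^sub>ia\<^sub>j\<^sub>k + a\<^sub>k\<^sub>ia\<^sub>k\<^sub>j\<close>, so that \<open>B\<^sub>n\<close> is the locus where \<open>S\<close> is additive.\<close>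

definition split_params :: "('n \<Rightarrow> 'n \<Rightarrow> 'a::comm_ring_1) \<Rightarrow> ('n \<Rightarrow> 'a) \<Rightarrow> bool" where
  "split_params a c \<longleftrightarrow> (\<forall>i j. a i j + a j i = 0) \<and>
     (\<forall>i j k. distinct [i, j, k] \<longrightarrow> a i j * a i k + a j i * a j k + a k i * a k j = c i + c j + c k)"

lemma split_params_antisym: "split_params a c \<Longrightarrow> a j i = - a i j"
  unfolding split_params_def by (simp add: eq_neg_iff_add_eq_0)

lemma split_params_sum:
  "split_params a c \<Longrightarrow> distinct [i, j, k]
    \<Longrightarrow> a i j * a i k + a j i * a j k + a k i * a k j = c i + c j + c k"
  by (simp add: split_params_def)

lemma split_params_hom:
  assumes "is_ring_hom f" "split_params a c"
  shows "split_params (\<lambda>i j. f (a i j)) (\<lambda>i. f (c i))"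
  using assms(2) unfolding split_params_def
  by (simp flip: ring_hom_simps(3,4)[OF assms(1)] add: ring_hom_simps(1)[OF assms(1)])

lemma Phi_difference:
  fixes a :: "'n \<Rightarrow> 'n \<Rightarrow> 'a::comm_ring_1"
  assumes anti: "\<And>i j. a j i = - a i j"
  defines "S \<equiv> \<lambda>i j k. a i j * a i k + a j i * a j k + a k i * a k j"
  shows "(a i k - a i j) * (a j k - a j i) - (a i k - a i l) * (a l k - a l i)
     - (a i m - a i j) * (a j m - a j i) + (a i m - a i l) * (a l m - a l i)
     = (S i j k - S i l k) - (S i j m - S i l m)"
  unfolding S_def anti[of j i] anti[of k i] anti[of l i] anti[of m i] anti[of j k] anti[of l k]
    anti[of j m] anti[of l m] by (simp add: algebra_simps)

lemma split_params_exists: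
  fixes a :: "'n::finite \<Rightarrow> 'n \<Rightarrow> 'a::comm_ring_1" and t :: 'a
  assumes n: "CARD('n) \<ge> 4" and t: "3 * t = 1" and anti: "\<And>i j. a i j + a j i = 0"
    and Phi: "\<And>i j k l m. distinct [i, j, k, l, m] \<Longrightarrow>
      (a i k - a i j) * (a j k - a j i) - (a i k - a i l) * (a l k - a l i)
     - (a i m - a i j) * (a j m - a j i) + (a i m - a i l) * (a l m - a l i) = 0"
  obtains c where "split_params a c"
proof -
  have anti': "a j i = - a i j" for i j using anti[of j i] by (simp add: eq_neg_iff_add_eq_0)
  let ?S = "\<lambda>i j k. a i j * a i k + a j i * a j k + a k i * a k j"
  have "?S i j k - ?S i l k = ?S i j m - ?S i l m" if "distinct [i, j, k, l, m]" for i j k l m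
    using Phi[OF that] unfolding Phi_difference[of a, OF anti'] by simp
  then obtain c where "\<And>i j k. distinct [i, j, k] \<Longrightarrow> ?S i j k = c i + c j + c k"
    by (rule symmetric_exchange_sum[OF n t, of ?S, rotated 2]) (simp_all add: algebra_simps)
  then show ?thesis using that anti by (auto simp: split_params_def)
qed

lemma split_params_Phi:
  assumes s: "split_params a c" and d: "distinct [i, j, k, l, m]"
  shows "(a i k - a i j) * (a j k - a j i) - (a i k - a i l) * (a l k - a l i)
     - (a i m - a i j) * (a j m - a j i) + (a i m - a i l) * (a l m - a l i) = 0"
proof -
  have "distinct [i, j, k]" "distinct [i, l, k]" "distinct [i, j, m]" "distinct [i, l, m]" using d by auto
  note S = this[THEN split_params_sum[OF s]]
  show ?thesis unfolding Phi_difference[of a, OF split_params_antisym[OF s]] S by simp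
qed

text \<open>With a_ij (c_i - c_j) = d_i + d_j both sides would be d_1 + d_2 + d_3 + d_4. To avoid
  the d_i, each difference c_i - c_j is written as a difference of two of the four hypotheses, after
  which the claim is a polynomial identity in the slopes.\<close>

lemma edge_identity:
  fixes a12 a13 a14 a23 a24 a34 c1 c2 c3 c4 :: "'a::comm_ring_1"
  assumes "c1 + c2 + c3 = a12 * a13 - a12 * a23 + a13 * a23"
    "c1 + c2 + c4 = a12 * a14 - a12 * a24 + a14 * a24"
    "c1 + c3 + c4 = a13 * a14 - a13 * a34 + a14 * a34"
    "c2 + c3 + c4 = a23 * a24 - a23 * a34 + a24 * a34"
  shows "a12 * (c1 - c2) + a34 * (c3 - c4) = a13 * (c1 - c3) + a24 * (c2 - c4)"
proof -
  have d: "c1 - c2 = (c1 + c3 + c4) - (c2 + c3 + c4)" "c3 - c4 = (c1 + c2 + c3) - (c1 + c2 + c4)"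
    "c1 - c3 = (c1 + c2 + c4) - (c2 + c3 + c4)" "c2 - c4 = (c1 + c2 + c3) - (c1 + c3 + c4)"
    by simp_all
  show ?thesis unfolding d assms by (simp add: algebra_simps)
qed

text \<open>The slopes \<open>a\<^sub>i\<^sub>j\<close> satisfy \<open>a\<^sub>i\<^sub>j(c\<^sub>i - c\<^sub>j) = d\<^sub>i + d\<^sub>j\<close>, which is the content of this exchange
  property: the fibres are affine parts of genus one curves through the points \<open>(c\<^sub>i, d\<^sub>i)\<close>.\<close>

lemma split_params_edge:
  assumes s: "split_params a c" and d: "distinct [i, j, l, m]"
  shows "a i l * (c i - c l) + a j m * (c j - c m) = a i m * (c i - c m) + a j l * (c j - c l)"
proof -
  note anti = split_params_antisym[OF s]
  have "distinct [i, m, l]" "distinct [i, l, j]" "distinct [i, m, j]" "distinct [l, m, j]" using d by auto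
  note S = this[THEN split_params_sum[OF s]]
  have "a i l * (c i - c l) + a m j * (c m - c j) = a i m * (c i - c m) + a l j * (c l - c j)"
    using S[symmetric]
    by (intro edge_identity[where ?a23.0 = "a l m" and ?a14.0 = "a i j"]) (simp_all add: anti[of l i] anti[of m i] anti[of j i] anti[of m l] anti[of j l]
        anti[of j m] algebra_simps)
  then show ?thesis by (simp add: anti[of m j] anti[of l j] algebra_simps)
qed

text \<open>In the picture of the cubic y^2 = x^3 + G x + B, \<open>g\<close> computes the
  coefficient G from three of the points. Changing the third point alters it by a_ij times the
  exchange relation of \<open>split_params_edge\<close>.\<close>

lemma split_params_quartic:
  assumes s: "split_params a c" and d: "distinct [i, j, l, m]"
  defines "g \<equiv> \<lambda>i j l. c i * c j + c i * c l + c j * c l - (c j + c l) * (a i j * a i l)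
    - (c i + c j) * (a l i * a l j) - (c i + c l) * (a j i * a j l)"
  shows "g i j l = g i j m"
proof -
  note anti = split_params_antisym[OF s]
  have "distinct [i, j, l]" "distinct [i, j, m]" using d by auto
  note S = this[THEN split_params_sum[OF s]]
  have "c l - c m = (a i j * a i l + a j i * a j l + a l i * a l j)
      - (a i j * a i m + a j i * a j m + a m i * a m j)" unfolding S by simp
  then have L: "c l = c m + (a i j * a i l + a j i * a j l + a l i * a l j)
      - (a i j * a i m + a j i * a j m + a m i * a m j)" by (simp add: algebra_simps)
  have "(c i + c j) * (c l - c m) = (c i + c j) * ((a i j * a i l + a j i * a j l + a l i * a l j)
      - (a i j * a i m + a j i * a j m + a m i * a m j))" unfolding S by simp
  then have "g i j l - g i j m = a i j * ((a i l * (c i - c l) + a j m * (c j - c m))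
      - (a i m * (c i - c m) + a j l * (c j - c l)))"
    unfolding g_def by (simp add: anti[of j i] algebra_simps)
  then show ?thesis unfolding split_params_edge[OF s d] by simp
qed

text \<open>Four vanishing triple sums already determine c. This makes c vanish at the origin and,
  to first order, over the dual numbers.\<close>

lemma split_params_zero:
  fixes c :: "'n::finite \<Rightarrow> 'k::field_char_0"
  assumes n: "CARD('n) \<ge> 4" and s: "split_params (\<lambda>i j. 0) c"
  shows "c i = 0"
proof -
  note S = split_params_sum[OF s, simplified, symmetric]
  obtain j where j: "j \<notin> {i, i, i}" using n by (rule obtain_fourth)
  obtain k where k: "k \<notin> {i, j, j}" using n by (rule obtain_fourth)
  obtain l where l: "l \<notin> {i, j, k}" using n by (rule obtain_fourth)
  have "c i + c j + c k = 0" "c i + c j + c l = 0" "c i + c k + c l = 0" "c j + c k + c l = 0"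
    using S[of i j k] S[of i j l] S[of i k l] S[of j k l] j k l by auto
  moreover have "3 * c i = (c i + c j + c k) + (c i + c j + c l) + (c i + c k + c l) - 2 * (c j + c k + c l)"
    by (simp add: algebra_simps)
  ultimately show ?thesis by simp
qed

text \<open>The auxiliary index enters through S_ijk - S_ilk = c_j - c_l only, so it drops out and a
  difference of two candidates for W remains.\<close>

lemma split_params_family:
  fixes a :: "'n \<Rightarrow> 'n \<Rightarrow> 'a::comm_ring_1"
  assumes s: "split_params a c" and d: "distinct [i, j, k, l]"
  shows "z i * z j - z i * z l + (a i j - a i l) * z i + a j i * z j - a l i * z l
     - a i j * a i k - a j i * a j k - a k i * a k j + a i l * a i k + a l i * a l k + a k i * a k l
    = (z i * z j + a i j * (z i - z j) - c i - c j) - (z i * z l + a i l * (z i - z l) - c i - c l)"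
proof -
  note anti = split_params_antisym[OF s]
  have "distinct [i, j, k]" "distinct [i, l, k]" using d by auto
  note S = this[THEN split_params_sum[OF s]]
  have "z i * z j - z i * z l + (a i j - a i l) * z i + a j i * z j - a l i * z l
     - a i j * a i k - a j i * a j k - a k i * a k j + a i l * a i k + a l i * a l k + a k i * a k l
    = (z i * z j + a i j * (z i - z j)) - (z i * z l + a i l * (z i - z l))
     - (a i j * a i k + a j i * a j k + a k i * a k j) + (a i l * a i k + a l i * a l k + a k i * a k l)"
    by (simp add: anti[of j i] anti[of l i] algebra_simps)
  then show ?thesis unfolding S by simp
qed

lemma base_ring_split:
  assumes n: "CARD('n) \<ge> 4"
  obtains c :: "'n::finite \<Rightarrow> ('k::field_char_0, 'n) base_ring" where "split_params base_param c"
    "\<And>i. base_origin (c i) = 0"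
proof -
  have "3 * base_const (1 / 3) = (base_const (3 * (1 / 3)) :: ('k, 'n) base_ring)"
    by (simp only: ring_hom_simps[OF base_const_hom] ring_hom_numeral[OF base_const_hom])
  then have "3 * base_const (1 / 3) = (1 :: ('k, 'n) base_ring)"
    by (simp add: ring_hom_simps[OF base_const_hom])
  then obtain c :: "'n \<Rightarrow> ('k, 'n) base_ring" where c: "split_params base_param c"
    by (rule split_params_exists[OF n _ base_param_antisym base_param_Phi]) auto
  have "base_origin (c i) = 0" for i
    using split_params_hom[OF base_origin_hom c] by (intro split_params_zero[OF n]) (simp add: base_origin_param)
  with c show ?thesis by (rule that)
qed

section \<open>Product form of the equations of the total space\<close>

definition product_form ::
    "('n \<Rightarrow> 'n \<Rightarrow> 'r::comm_ring_1) \<Rightarrow> ('n \<Rightarrow> 'r) \<Rightarrow> ('n \<Rightarrow> 'r) \<Rightarrow> 'r \<Rightarrow> bool" where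
  "product_form a c z W \<longleftrightarrow> (\<forall>i j. i \<noteq> j \<longrightarrow> z i * z j = W + c i + c j - a i j * (z i - z j))"

lemma product_formD: "product_form a c z W \<Longrightarrow> i \<noteq> j \<Longrightarrow> z i * z j = W + c i + c j - a i j * (z i - z j)"
  by (simp add: product_form_def)

lemma product_form_family:
  assumes s: "split_params a c" and p: "product_form a c z W" and d: "distinct [i, j, k, l]"
  shows "z i * z j - z i * z l + (a i j - a i l) * z i + a j i * z j - a l i * z l
     - a i j * a i k - a j i * a j k - a k i * a k j + a i l * a i k + a l i * a l k + a k i * a k l = 0"
proof -
  have "i \<noteq> j" "i \<noteq> l" using d by auto
  note P = this[THEN product_formD[OF p]]
  show ?thesis unfolding split_params_family[OF s d] unfolding P by simp
qed

lemma product_form_exists: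
  fixes a :: "'n::finite \<Rightarrow> 'n \<Rightarrow> 'a::comm_ring_1"
  assumes n: "CARD('n) \<ge> 4" and s: "split_params a c"
    and F: "\<And>i j k l. distinct [i, j, k, l] \<Longrightarrow>
      z i * z j - z i * z l + (a i j - a i l) * z i + a j i * z j - a l i * z l
     - a i j * a i k - a j i * a j k - a k i * a k j + a i l * a i k + a l i * a l k + a k i * a k l = 0"
  obtains W where "product_form a c z W"
proof -
  define G where "G i j = z i * z j + a i j * (z i - z j) - c i - c j" for i j
  have G: "G i j = G i l" if "distinct [i, j, l]" for i j l
  proof -
    obtain k where "k \<notin> {i, j, l}" using n by (rule obtain_fourth)
    then have "distinct [i, j, k, l]" using that by auto
    note d = this
    from F[OF d] show ?thesis
      unfolding split_params_family[OF s d] G_def by (simp only: right_minus_eq)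
  qed
  have sym: "G i j = G j i" for i j
    unfolding G_def split_params_antisym[OF s, of j i] by (simp add: algebra_simps)
  have all: "G i j = G k l" if "i \<noteq> j" "k \<noteq> l" for i j k l
  proof -
    obtain m where "m \<notin> {i, i, k}" using n by (rule obtain_fourth)
    then have m: "m \<noteq> i" "m \<noteq> k" by auto
    have "G i j = G i m" using G[of i j m] m that by (cases "j = m") auto
    also have "\<dots> = G m i" by (rule sym)
    also have "\<dots> = G m k" using G[of m i k] m that by (cases "i = k") auto
    also have "\<dots> = G k m" by (rule sym)
    also have "\<dots> = G k l" using G[of k m l] m that by (cases "l = m") auto
    finally show ?thesis .
  qed
  obtain p :: 'n where True by simp
  obtain q where "q \<notin> {p, p, p}" using n by (rule obtain_fourth)
  then have "p \<noteq> q" by auto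
  have "product_form a c z (G p q)"
    unfolding product_form_def
  proof (intro allI impI)
    fix i j :: 'n assume "i \<noteq> j"
    from all[OF \<open>p \<noteq> q\<close> this] show "z i * z j = G p q + c i + c j - a i j * (z i - z j)"
      by (simp add: G_def)
  qed
  then show ?thesis by (rule that)
qed

text \<open>The two ways of expanding \<open>z\<^sub>iz\<^sub>jz\<^sub>k\<close>, allowing for errors in the product form.\<close>

lemma associativity_defect:
  fixes zi zj zk :: "'a::comm_ring_1"
  assumes "zi * zj = W + ci + cj - aij * (zi - zj) + eij"
    and "zj * zk = W + cj + ck - ajk * (zj - zk) + ejk"
    and "zi * zk = W + ci + ck - aik * (zi - zk) + eik"
  shows "zk * (W - ck - (aij * aik - aij * ajk + aik * ajk - ci - cj - ck) + eij) - aij * (ci - cj)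
     - (zi * (W - ci - (aij * aik - aij * ajk + aik * ajk - ci - cj - ck) + ejk) - ajk * (cj - ck))
     = aij * (eik - ejk) + ajk * (eik - eij)"
proof -
  let ?d1 = "ci - cj - aik * (zi - zk) + ajk * (zj - zk) + eik - ejk"
  let ?d2 = "cj - ck - aij * (zi - zj) + aik * (zi - zk) + eij - eik"
  have "zk * (W + ci + cj - aij * (zi - zj) + eij) = zi * (W + cj + ck - ajk * (zj - zk) + ejk)"
    by (simp only: assms(1,2)[symmetric] mult_ac)
  then have "zk * (W + ci + cj + eij) - aij * (zi * zk - zj * zk)
      = zi * (W + cj + ck + ejk) - ajk * (zi * zj - zi * zk)"
    by (simp add: algebra_simps)
  moreover have "zi * zk - zj * zk = ?d1" "zi * zj - zi * zk = ?d2"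
    unfolding assms by simp_all
  ultimately have "zk * (W + ci + cj + eij) - aij * ?d1 - (zi * (W + cj + ck + ejk) - ajk * ?d2) = 0"
    by simp
  then show ?thesis
    by (subst right_minus_eq[symmetric], elim trans[rotated]) (simp add: algebra_simps)
qed

text \<open>Rewrites W z_k as W z_i plus terms linear in the coordinates. For this reason the
  products of W with powers of a single coordinate z_q are enough for a basis.\<close>

lemma product_form_associativity:
  assumes s: "split_params a c" and p: "product_form a c z W" and d: "distinct [i, j, k]"
  shows "z k * (W - c k) - a i j * (c i - c j) = z i * (W - c i) - a j k * (c j - c k)"
proof -
  note anti = split_params_antisym[OF s]
  have "i \<noteq> j" "j \<noteq> k" "i \<noteq> k" using d by auto
  note P = this[THEN product_formD[OF p]]
  have S: "a i j * a i k - a i j * a j k + a i k * a j k - c i - c j - c k = 0"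
    using split_params_sum[OF s d] by (simp add: anti[of j i] anti[of k i] anti[of k j])
  show ?thesis
    using associativity_defect[of "z i" "z j" W "c i" "c j" "a i j" 0 "z k" "c k" "a j k" 0 "a i k" 0] P S
    by simp
qed

subsection \<open>Laurent expansions at the punctures\<close>

text \<open>Coefficients of the power series root of w = a - d s + s^2 (w^2 + a w + e). The factor
  s^2 lets the coefficient of index n + 2 depend on those up to n only.\<close>

fun quad_coeff :: "'a::comm_ring_1 \<Rightarrow> 'a \<Rightarrow> 'a \<Rightarrow> nat \<Rightarrow> 'a" where
  "quad_coeff a d e 0 = a"
| "quad_coeff a d e (Suc 0) = - d"
| "quad_coeff a d e (Suc (Suc n)) = (\<Sum>i\<le>n. quad_coeff a d e i * quad_coeff a d e (n - i))
     + a * quad_coeff a d e n + (if n = 0 then e else 0)"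

lemma fps_quadratic_root:
  fixes a d e :: "'a::comm_ring_1"
  defines "w \<equiv> Abs_fps (quad_coeff a d e)"
  shows "w = fps_const a - fps_const d * fps_X + fps_X\<^sup>2 * (w\<^sup>2 + fps_const a * w + fps_const e)"
proof (rule fps_ext)
  fix n
  show "w $ n = (fps_const a - fps_const d * fps_X + fps_X\<^sup>2 * (w\<^sup>2 + fps_const a * w + fps_const e)) $ n"
  proof (cases "n < 2")
    case True
    then have "n = 0 \<or> n = 1" by auto
    then show ?thesis by (auto simp: w_def fps_X_power_mult_nth)
  next
    case False
    then obtain m where "n = Suc (Suc m)" by (metis add_2_eq_Suc le_Suc_ex not_less)
    moreover from this have "(fps_X\<^sup>2 * f) $ n = f $ m" for f :: "'a fps"
      by (simp add: fps_X_power_mult_nth)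
    moreover have "w\<^sup>2 $ m = (\<Sum>i\<le>m. quad_coeff a d e i * quad_coeff a d e (m - i))"
      by (simp add: power2_eq_square fps_mult_nth atLeast0AtMost w_def)
    moreover have "w $ l = quad_coeff a d e l" for l by (simp add: w_def)
    ultimately show ?thesis by simp
  qed
qed

lemma fls_const_hom: "is_ring_hom (fls_const :: 'a::comm_ring_1 \<Rightarrow> _)"
  by (simp add: is_ring_hom_def fls_plus_const)

lemma fls_X_X_inv: "fls_X * fls_X_inv = (1 :: 'a::comm_ring_1 fls)"
  by (simp add: fls_X_inv_times_conv_shift mult.commute[of fls_X])

lemma fps_unit_constant_one:
  fixes u :: "'a::comm_ring_1 fps"
  assumes "u $ 0 = 1"
  obtains v where "u * v = 1"
  using fps_right_inverse[of u 1] assms that by simp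

lemma symmetric_pair_constant:
  fixes f :: "'n::finite \<Rightarrow> 'n \<Rightarrow> 'a"
  assumes n: "CARD('n) \<ge> 4" and sym: "\<And>j l. f j l = f l j"
    and swap: "\<And>j l m. distinct [p, j, l, m] \<Longrightarrow> f j l = f j m"
  obtains x where "\<And>j l. distinct [p, j, l] \<Longrightarrow> f j l = x"
proof -
  have swap': "f j l = f j m" if "distinct [p, j, l]" "distinct [p, j, m]" for j l m
    using swap[of j l m] that by (cases "l = m") auto
  have all: "f j l = f j' l'" if d: "distinct [p, j, l]" "distinct [p, j', l']" for j l j' l'
  proof -
    obtain m where m: "m \<notin> {p, j, j'}" using n by (rule obtain_fourth)
    have "f j l = f j m" by (rule swap') (use d m in auto)
    also have "\<dots> = f m j" by (rule sym)
    also have "\<dots> = f m j'" by (rule swap') (use d m in auto)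
    also have "\<dots> = f j' m" by (rule sym)
    also have "\<dots> = f j' l'" by (rule swap') (use d m in auto)
    finally show ?thesis .
  qed
  obtain j where j: "j \<notin> {p, p, p}" using n by (rule obtain_fourth)
  obtain l where l: "l \<notin> {p, p, j}" using n by (rule obtain_fourth)
  show ?thesis
    by (rule that[of "f j l"], rule all) (use j l in auto)
qed

text \<open>In the picture of points (c_i, d_i) on y^2 = x^3 + G x + B with a_ij (c_i - c_j) = d_i +
  d_j, the constant D is 2 d_p. Together with c_p they are the data of the quadratic equation for W
  over z_p.\<close>

lemma split_params_curve:
  fixes a :: "'n::finite \<Rightarrow> 'n \<Rightarrow> 'a::comm_ring_1"
  assumes n: "CARD('n) \<ge> 4" and s: "split_params a c"
  obtains D G where
    "\<And>j l. distinct [p, j, l] \<Longrightarrow> a p j * (c p - c j) + a p l * (c p - c l) - a j l * (c j - c l) = D"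
    "\<And>j l. distinct [p, j, l] \<Longrightarrow> c p * c j + c p * c l + c j * c l - (c j + c l) * (a p j * a p l)
      - (c p + c j) * (a l p * a l j) - (c p + c l) * (a j p * a j l) = G"
proof -
  note anti = split_params_antisym[OF s]
  let ?d = "\<lambda>j l. a p j * (c p - c j) + a p l * (c p - c l) - a j l * (c j - c l)"
  let ?g = "\<lambda>j l. c p * c j + c p * c l + c j * c l - (c j + c l) * (a p j * a p l)
      - (c p + c j) * (a l p * a l j) - (c p + c l) * (a j p * a j l)"
  have "?d j l = ?d l j" for j l by (simp add: anti[of l j] algebra_simps)
  moreover have "?d j l = ?d j m" if "distinct [p, j, l, m]" for j l m
    using split_params_edge[OF s that] by (simp add: algebra_simps)
  ultimately obtain D where D: "\<And>j l. distinct [p, j, l] \<Longrightarrow> ?d j l = D"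
    by (rule symmetric_pair_constant[OF n, of ?d p]) auto
  have "?g j l = ?g l j" for j l by (simp add: algebra_simps)
  moreover have "?g j l = ?g j m" if "distinct [p, j, l, m]" for j l m
    by (rule split_params_quartic[OF s that])
  ultimately obtain G where G: "\<And>j l. distinct [p, j, l] \<Longrightarrow> ?g j l = G"
    by (rule symmetric_pair_constant[OF n, of ?g p]) auto
  show ?thesis using D G by (rule that)
qed

text \<open>With \<open>s = 1/z\<^sub>p\<close>, the numerators and denominators of \<open>z\<^sub>j\<close> and \<open>z\<^sub>l\<close> satisfy the product relation
  because of the quadratic equation for \<open>\<omega> = W\<close>.\<close>

lemma expansion_identity:
  fixes s \<omega> :: "'a::comm_ring_1"
  assumes \<omega>: "\<omega> = c0 - D * s + s\<^sup>2 * (\<omega>\<^sup>2 + c0 * \<omega> + (c0\<^sup>2 + G))"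
    and R: "a1 * a2 - a1 * a3 + a2 * a3 = c0 + c1 + c2"
    and D: "a1 * (c0 - c1) + a2 * (c0 - c2) - a3 * (c1 - c2) = D"
    and G: "c0 * c1 + c0 * c2 + c1 * c2 - (c1 + c2) * (a1 * a2) - (c0 + c1) * (a2 * a3)
      + (c0 + c2) * (a1 * a3) = G"
  defines "N1 \<equiv> s * (\<omega> + c0 + c1) - a1" and "N2 \<equiv> s * (\<omega> + c0 + c2) - a2"
  shows "N1 * N2 = (\<omega> + c1 + c2) * ((1 - s * a1) * (1 - s * a2)) - a3 * (N1 * (1 - s * a2) - N2 * (1 - s * a1))"
proof -
  let ?R = "a1 * a2 - a1 * a3 + a2 * a3 - (c0 + c1 + c2)"
  let ?K = "\<omega> - (c0 - D * s + s\<^sup>2 * (\<omega>\<^sup>2 + c0 * \<omega> + (c0\<^sup>2 + G)))"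
  \<comment> \<open>The discrepancy is an explicit combination of the defect \<open>?R\<close> of
    the triple relation and the defect \<open>?K\<close> of the quadratic equation.\<close>
  have "N1 * N2 - ((\<omega> + c1 + c2) * ((1 - s * a1) * (1 - s * a2)) - a3 * (N1 * (1 - s * a2) - N2 * (1 - s * a1)))
    = ?R * (1 - s\<^sup>2 * \<omega>) - ?K"
    unfolding D[symmetric] G[symmetric] N1_def N2_def by (simp add: algebra_simps power2_eq_square)
  also have "\<dots> = 0" using \<omega> R by simp
  finally show ?thesis by simp
qed

definition total_basis :: "('k::field, 'n::finite) total_ring \<Rightarrow> 'n \<Rightarrow> ('n \<times> nat) + nat \<Rightarrow> ('k, 'n) total_ring" where
  "total_basis W q = case_sum (\<lambda>(i, m). total_coord i ^ m) (\<lambda>m. W * total_coord q ^ m)"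

definition basis_index :: "'n \<Rightarrow> (('n \<times> nat) + nat) set" where
  "basis_index q = {Inl (i, m) | i m. m > 0 \<or> i = q} \<union> range Inr"

lemma total_basis_simps [simp]:
  "total_basis W q (Inl (i, m)) = total_coord i ^ m" "total_basis W q (Inr m) = W * total_coord q ^ m"
  by (simp_all add: total_basis_def)

context
  fixes c :: "'n::finite \<Rightarrow> ('k::field, 'n) base_ring" and W :: "('k, 'n) total_ring"
  assumes n: "CARD('n) \<ge> 4" and split: "split_params base_param c"
    and W: "product_form (\<lambda>i j. base_to_total (base_param i j)) (\<lambda>i. base_to_total (c i)) total_coord W"
begin

text \<open>Evaluation along a puncture where z_p has a simple pole, with s = 1/z_p as parameter.
  Any root \<omega> of the quadratic equation is allowed: the power series root is the puncture of
  the p-th axis, the other one that of the line (1,...,1).\<close>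

lemma place_hom:
  assumes D: "\<And>j l. distinct [p, j, l] \<Longrightarrow> base_param p j * (c p - c j) + base_param p l * (c p - c l)
      - base_param j l * (c j - c l) = D"
    and G: "\<And>j l. distinct [p, j, l] \<Longrightarrow> c p * c j + c p * c l + c j * c l
      - (c j + c l) * (base_param p j * base_param p l)
      - (c p + c j) * (base_param l p * base_param l j) - (c p + c l) * (base_param j p * base_param j l) = G"
    and \<omega>: "\<omega> = fls_const (c p) - fls_const D * fls_X
      + fls_X\<^sup>2 * (\<omega>\<^sup>2 + fls_const (c p) * \<omega> + fls_const ((c p)\<^sup>2 + G))"
  obtains \<chi> v where "is_ring_hom \<chi>" "\<And>b. \<chi> (base_to_total b) = fls_const b"
    "\<chi> (total_coord p) = fls_X_inv" "\<chi> W = \<omega>"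
    "\<And>j. j \<noteq> p \<Longrightarrow> \<chi> (total_coord j) =
      (fls_X * (\<omega> + fls_const (c p) + fls_const (c j)) - fls_const (base_param p j)) * fps_to_fls (v j)"
proof -
  let ?a = "\<lambda>i j. fls_const (base_param i j :: ('k, 'n) base_ring)" and ?c = "\<lambda>i. fls_const (c i)" and ?s = fls_X
  note anti = split_params_antisym[OF split]
  note hs = ring_hom_simps[OF fls_const_hom]
  have "\<exists>v. (1 - fps_X * fps_const (base_param p j :: ('k, 'n) base_ring)) * v = 1" for j
    by (rule fps_unit_constant_one[of "1 - fps_X * fps_const (base_param p j)"]) auto
  then obtain v where "(1 - fps_X * fps_const (base_param p j :: ('k, 'n) base_ring)) * v j = 1" for j
    by metis
  then have v: "(1 - ?s * ?a p j) * fps_to_fls (v j) = 1" for j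
    by (simp flip: fls_times_fps_to_fls fps_to_fls_minus fps_const_to_fls fps_X_to_fls fps_one_to_fls)
  \<comment> \<open>Solving the product relation of z_p = 1/s and z_j for z_j gives z_j (1 - s a_pj)
    = N_j; the factor has constant term 1 and is inverted by \<open>v j\<close>.\<close>
  define N where "N j = ?s * (\<omega> + ?c p + ?c j) - ?a p j" for j
  define z where "z j = (if j = p then fls_X_inv else N j * fps_to_fls (v j))" for j
  have sX: "?s * fls_X_inv = (1 :: ('k, 'n) base_ring fls)" by (rule fls_X_X_inv)
  have cancel: "x = y" if "x * (1 - ?s * ?a p j) = y * (1 - ?s * ?a p j)" for x y j
    using arg_cong[OF that, of "\<lambda>x. x * fps_to_fls (v j)"] by (simp add: mult.assoc v)
  have zN: "z j * (1 - ?s * ?a p j) = N j" if "j \<noteq> p" for j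
    using that v[of j] by (simp add: z_def mult_ac)
  have zp: "z p * z j = \<omega> + ?c p + ?c j - ?a p j * (z p - z j)" if "j \<noteq> p" for j
  proof (rule cancel[of _ j])
    have "z p * z j * (1 - ?s * ?a p j) = fls_X_inv * N j"
      using zN[OF that] by (simp add: z_def mult.assoc)
    also have "\<dots> = (?s * fls_X_inv) * (\<omega> + ?c p + ?c j) - fls_X_inv * ?a p j"
      by (simp add: N_def algebra_simps)
    also have "\<dots> = (\<omega> + ?c p + ?c j) - fls_X_inv * ?a p j" by (simp add: sX)
    finally have L: "z p * z j * (1 - ?s * ?a p j) = (\<omega> + ?c p + ?c j) - fls_X_inv * ?a p j" .
    have "(\<omega> + ?c p + ?c j - ?a p j * (z p - z j)) * (1 - ?s * ?a p j)
      = (\<omega> + ?c p + ?c j) * (1 - ?s * ?a p j) - ?a p j * fls_X_inv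
        + ?a p j * ?a p j * (?s * fls_X_inv) + ?a p j * (z j * (1 - ?s * ?a p j))"
      by (simp add: z_def algebra_simps)
    also have "\<dots> = (\<omega> + ?c p + ?c j) - fls_X_inv * ?a p j"
      unfolding zN[OF that] sX by (simp add: N_def algebra_simps)
    finally show "z p * z j * (1 - ?s * ?a p j)
      = (\<omega> + ?c p + ?c j - ?a p j * (z p - z j)) * (1 - ?s * ?a p j)" using L by simp
  qed
  have zz: "z j * z l = \<omega> + ?c j + ?c l - ?a j l * (z j - z l)" if d: "distinct [p, j, l]" for j l
  proof (rule cancel[of _ j], rule cancel[of _ l])
    have ne: "j \<noteq> p" "l \<noteq> p" using d by auto
    have "N j * N l = (\<omega> + ?c j + ?c l) * ((1 - ?s * ?a p j) * (1 - ?s * ?a p l))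
      - ?a j l * (N j * (1 - ?s * ?a p l) - N l * (1 - ?s * ?a p j))"
      unfolding N_def
    proof (rule expansion_identity)
      show "\<omega> = ?c p - fls_const D * ?s + ?s\<^sup>2 * (\<omega>\<^sup>2 + ?c p * \<omega> + ((?c p)\<^sup>2 + fls_const G))"
        using \<omega> by (simp add: hs fls_const_power)
      show "?a p j * ?a p l - ?a p j * ?a j l + ?a p l * ?a j l = ?c p + ?c j + ?c l"
        using split_params_sum[OF split d]
        by (simp add: anti[of j p] anti[of l p] anti[of l j] flip: hs)
      show "?a p j * (?c p - ?c j) + ?a p l * (?c p - ?c l) - ?a j l * (?c j - ?c l) = fls_const D"
        using D[OF d] by (simp flip: hs)
      show "?c p * ?c j + ?c p * ?c l + ?c j * ?c l - (?c j + ?c l) * (?a p j * ?a p l)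
        - (?c p + ?c j) * (?a p l * ?a j l) + (?c p + ?c l) * (?a p j * ?a j l) = fls_const G"
        using G[OF d] by (simp add: anti[of j p] anti[of l p] anti[of l j] flip: hs)
    qed
    then show "z j * z l * (1 - ?s * ?a p j) * (1 - ?s * ?a p l)
      = (\<omega> + ?c j + ?c l - ?a j l * (z j - z l)) * (1 - ?s * ?a p j) * (1 - ?s * ?a p l)"
      unfolding zN[OF ne(1), symmetric] zN[OF ne(2), symmetric] by (simp add: algebra_simps)
  qed
  have pf: "product_form ?a ?c z \<omega>"
    unfolding product_form_def
  proof (intro allI impI)
    fix i j :: 'n assume ij: "i \<noteq> j"
    consider "i = p" | "j = p" | "distinct [p, i, j]" using ij by auto
    then show "z i * z j = \<omega> + ?c i + ?c j - ?a i j * (z i - z j)"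
    proof cases
      case 1
      then show ?thesis using zp[of j] ij by auto
    next
      case 2
      then show ?thesis using zp[of i] ij by (simp add: anti[of i p] algebra_simps)
    next
      case 3
      then show ?thesis by (rule zz)
    qed
  qed
  have sp: "split_params ?a ?c" by (rule split_params_hom[OF fls_const_hom split])
  obtain \<chi> :: "('k, 'n) total_ring \<Rightarrow> ('k, 'n) base_ring fls"
    where \<chi>: "is_ring_hom \<chi>" "\<And>b. \<chi> (base_to_total b) = fls_const b" "\<And>i. \<chi> (total_coord i) = z i"
    by (rule total_ring_hom_exists[OF fls_const_hom refl product_form_family[OF sp pf]]) (assumption | (rule that; assumption))+
  have "\<chi> W = \<omega>"
  proof -
    obtain j where "j \<notin> {p, p, p}" using n by (rule obtain_fourth)
    then have "p \<noteq> j" by auto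
    from arg_cong[OF product_formD[OF W this], of \<chi>] product_formD[OF pf this]
    show ?thesis by (simp add: ring_hom_simps[OF \<chi>(1)] \<chi>)
  qed
  with \<chi> show ?thesis by (intro that[of \<chi> v]) (auto simp: z_def N_def)
qed

text \<open>At the puncture of an axis p other than q only the powers of z_p have poles, so their
  coefficients are read off directly. What remains is P + W Q = 0 with P and Q polynomials in z_q.
  The two punctures over z_q = infinity give this relation for both roots W, whose difference is a
  unit up to a power of s.\<close>

lemma total_basis_independent:
  assumes F: "finite F" "F \<subseteq> basis_index q"
    and sum0: "(\<Sum>i\<in>F. base_to_total (x i) * total_basis W q i) = 0" and i: "i \<in> F"
  shows "x i = 0"
proof -
  have expand: "(\<Sum>i\<in>F. fls_const (x i) * \<chi> (total_basis W q i)) = 0"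
    if "is_ring_hom \<chi>" "\<And>b. \<chi> (base_to_total b) = fls_const b" for \<chi>
    using arg_cong[OF sum0, of \<chi>] by (simp add: ring_hom_sum[OF that(1)] ring_hom_simps[OF that(1)] that(2))
  have root: "\<exists>w D G. (\<forall>j l. distinct [p, j, l] \<longrightarrow> base_param p j * (c p - c j)
      + base_param p l * (c p - c l) - base_param j l * (c j - c l) = D) \<and>
    (\<forall>j l. distinct [p, j, l] \<longrightarrow> c p * c j + c p * c l + c j * c l
      - (c j + c l) * (base_param p j * base_param p l)
      - (c p + c j) * (base_param l p * base_param l j) - (c p + c l) * (base_param j p * base_param j l) = G) \<and>
    fps_to_fls w = fls_const (c p) - fls_const D * fls_X + fls_X\<^sup>2 *
      ((fps_to_fls w)\<^sup>2 + fls_const (c p) * fps_to_fls w + fls_const ((c p)\<^sup>2 + G))" for p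
  proof -
    obtain D G where DG: "\<And>j l. distinct [p, j, l] \<Longrightarrow> base_param p j * (c p - c j)
        + base_param p l * (c p - c l) - base_param j l * (c j - c l) = D"
      "\<And>j l. distinct [p, j, l] \<Longrightarrow> c p * c j + c p * c l + c j * c l
        - (c j + c l) * (base_param p j * base_param p l)
        - (c p + c j) * (base_param l p * base_param l j) - (c p + c l) * (base_param j p * base_param j l) = G"
      by (rule split_params_curve[OF n split, of p]) blast
    let ?w = "Abs_fps (quad_coeff (c p) D ((c p)\<^sup>2 + G))"
    have "fps_to_fls ?w = fls_const (c p) - fls_const D * fls_X + fls_X\<^sup>2 *
      ((fps_to_fls ?w)\<^sup>2 + fls_const (c p) * fps_to_fls ?w + fls_const ((c p)\<^sup>2 + G))"
      using arg_cong[OF fps_quadratic_root[of "c p" D "(c p)\<^sup>2 + G"], of fps_to_fls]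
      by (simp add: fls_times_fps_to_fls fps_to_fls_power)
    with DG show ?thesis by blast
  qed
  have x0: "x (Inl (p, m)) = 0" if "p \<noteq> q" "Inl (p, m) \<in> F" for p m
  proof -
    have m: "m > 0" using F(2) that by (auto simp: basis_index_def)
    obtain w D G where "\<And>j l. distinct [p, j, l] \<Longrightarrow> base_param p j * (c p - c j)
        + base_param p l * (c p - c l) - base_param j l * (c j - c l) = D"
      "\<And>j l. distinct [p, j, l] \<Longrightarrow> c p * c j + c p * c l + c j * c l
        - (c j + c l) * (base_param p j * base_param p l)
        - (c p + c j) * (base_param l p * base_param l j) - (c p + c l) * (base_param j p * base_param j l) = G"
      "fps_to_fls w = fls_const (c p) - fls_const D * fls_X + fls_X\<^sup>2 *
      ((fps_to_fls w)\<^sup>2 + fls_const (c p) * fps_to_fls w + fls_const ((c p)\<^sup>2 + G))"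
      using root[of p] by blast
    note DGw = this
    obtain \<chi> v where \<chi>: "is_ring_hom \<chi>" "\<And>b. \<chi> (base_to_total b) = fls_const b"
      "\<chi> (total_coord p) = fls_X_inv" "\<chi> W = fps_to_fls w"
      "\<And>j. j \<noteq> p \<Longrightarrow> \<chi> (total_coord j) = (fls_X * (fps_to_fls w + fls_const (c p) + fls_const (c j))
        - fls_const (base_param p j)) * fps_to_fls (v j)"
      by (rule place_hom[OF DGw]) (assumption | (rule that; assumption))+
    have reg: "\<exists>f. \<chi> (total_coord j) = fps_to_fls f" if "j \<noteq> p" for j
      unfolding \<chi>(5)[OF that]
      by (rule exI[of _ "(fps_X * (w + fps_const (c p) + fps_const (c j)) - fps_const (base_param p j)) * v j"])
        (simp add: fls_times_fps_to_fls)
    \<comment> \<open>All other basis elements expand into power series in s, so the coefficient of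
      s^(-m) isolates z_p^m; here m > 0 is essential.\<close>
    have co: "fls_nth (\<chi> (total_basis W q i)) (- int m) = (if i = Inl (p, m) then 1 else 0)" for i
    proof (cases i)
      case (Inl jm)
      obtain j m' where jm: "jm = (j, m')" by fastforce
      show ?thesis
      proof (cases "j = p")
        case True
        then show ?thesis using Inl jm by (simp add: ring_hom_power[OF \<chi>(1)] \<chi>)
      next
        case False
        then obtain f where "\<chi> (total_coord j) = fps_to_fls f" using reg by blast
        then show ?thesis using Inl jm False m
          by (simp add: ring_hom_power[OF \<chi>(1)] flip: fps_to_fls_power)
      qed
    next
      case (Inr m')
      obtain f where "\<chi> (total_coord q) = fps_to_fls f" using reg \<open>p \<noteq> q\<close> by metis
      then show ?thesis using Inr m
        by (simp add: ring_hom_power[OF \<chi>(1)] ring_hom_simps[OF \<chi>(1)] \<chi>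
            flip: fps_to_fls_power fls_times_fps_to_fls)
    qed
    have "(\<Sum>i\<in>F. x i * (if i = Inl (p, m) then 1 else 0)) = 0"
      using arg_cong[OF expand[OF \<chi>(1,2)], of "\<lambda>f. fls_nth f (- int m)"] by (simp add: fls_nth_sum co)
    moreover have "x i * (if i = Inl (p, m) then 1 else 0) = (if i = Inl (p, m) then x i else 0)" for i
      by simp
    ultimately show ?thesis using that(2) sum.delta[OF F(1), of "Inl (p, m)" x] by simp
  qed
  let ?F1 = "{m. Inl (q, m) \<in> F}" and ?F2 = "{m. Inr m \<in> F}"
  have fin: "finite ?F1" "finite ?F2"
    using finite_vimageI[OF F(1), of "\<lambda>m. Inl (q, m)"] finite_vimageI[OF F(1), of Inr]
    by (simp_all add: vimage_def inj_on_def)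
  define P where "P = (\<Sum>m\<in>?F1. fls_const (x (Inl (q, m))) * fls_X_inv ^ m)"
  define Q where "Q = (\<Sum>m\<in>?F2. fls_const (x (Inr m)) * fls_X_inv ^ m)"
  have PQ: "P + \<chi> W * Q = 0"
    if \<chi>: "is_ring_hom \<chi>" "\<And>b. \<chi> (base_to_total b) = fls_const b" "\<chi> (total_coord q) = fls_X_inv" for \<chi>
  proof -
    let ?t = "\<lambda>i. fls_const (x i) * \<chi> (total_basis W q i)"
    have "(\<Sum>i\<in>F. ?t i) = (\<Sum>i\<in>(\<lambda>m. Inl (q, m)) ` ?F1 \<union> Inr ` ?F2. ?t i)"
    proof (rule sum.mono_neutral_right[OF F(1)])
      show "\<forall>i\<in>F - ((\<lambda>m. Inl (q, m)) ` ?F1 \<union> Inr ` ?F2). ?t i = 0"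
      proof
        fix i assume i: "i \<in> F - ((\<lambda>m. Inl (q, m)) ` ?F1 \<union> Inr ` ?F2)"
        then obtain p m where "i = Inl (p, m)" "p \<noteq> q" by (cases i) (auto simp: image_iff)
        then show "?t i = 0" using x0[of p m] i by simp
      qed
    qed auto
    also have "\<dots> = (\<Sum>i\<in>(\<lambda>m. Inl (q, m)) ` ?F1. ?t i) + (\<Sum>i\<in>Inr ` ?F2. ?t i)"
      by (rule sum.union_disjoint) (use fin in auto)
    also have "\<dots> = P + \<chi> W * Q"
      unfolding P_def Q_def sum_distrib_left
      by (simp add: sum.reindex inj_on_def ring_hom_power[OF \<chi>(1)] ring_hom_simps[OF \<chi>(1)] \<chi> mult_ac)
    finally show ?thesis using expand[OF \<chi>(1,2)] by simp
  qed
  obtain w D G where DG: "\<And>j l. distinct [q, j, l] \<Longrightarrow> base_param q j * (c q - c j)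
      + base_param q l * (c q - c l) - base_param j l * (c j - c l) = D"
    "\<And>j l. distinct [q, j, l] \<Longrightarrow> c q * c j + c q * c l + c j * c l
      - (c j + c l) * (base_param q j * base_param q l)
      - (c q + c j) * (base_param l q * base_param l j) - (c q + c l) * (base_param j q * base_param j l) = G"
    and w: "fps_to_fls w = fls_const (c q) - fls_const D * fls_X + fls_X\<^sup>2 *
      ((fps_to_fls w)\<^sup>2 + fls_const (c q) * fps_to_fls w + fls_const ((c q)\<^sup>2 + G))"
    using root[of q] by blast
  obtain \<chi>1 where "is_ring_hom \<chi>1" "\<And>b. \<chi>1 (base_to_total b) = fls_const b"
      "\<chi>1 (total_coord q) = fls_X_inv" "\<chi>1 W = fps_to_fls w"
    by (rule place_hom[OF DG w]) (assumption | (rule that; assumption))+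
  from PQ[OF this(1-3)] this(4) have PQ1: "P + fps_to_fls w * Q = 0" by simp
  \<comment> \<open>The other root of the quadratic equation belongs to the line \<open>(1,\<dots>,1)\<close>.\<close>
  let ?\<omega> = "fls_X_inv\<^sup>2 - fls_const (c q) - fps_to_fls w"
  have "?\<omega> = fls_const (c q) - fls_const D * fls_X
    + fls_X\<^sup>2 * (?\<omega>\<^sup>2 + fls_const (c q) * ?\<omega> + fls_const ((c q)\<^sup>2 + G))"
  proof -
    define s t C E r A where "s = (fls_X :: ('k, 'n) base_ring fls)" and "t = (fls_X_inv :: ('k, 'n) base_ring fls)"
      and "C = fls_const (c q)" and "E = fls_const D" and "r = fps_to_fls w" and "A = fls_const ((c q)\<^sup>2 + G)"
    have st: "s * t = 1" unfolding s_def t_def by (rule fls_X_X_inv)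
    have "s\<^sup>2 * t\<^sup>2 = 1" using st by (metis power_mult_distrib power_one)
    then have u: "s\<^sup>2 * t\<^sup>2 * x = x" for x by simp
    have "s\<^sup>2 * ((t\<^sup>2 - C - r)\<^sup>2 + C * (t\<^sup>2 - C - r) + A)
      = s\<^sup>2 * t\<^sup>2 * (t\<^sup>2 - C - r) - s\<^sup>2 * t\<^sup>2 * r + s\<^sup>2 * (r\<^sup>2 + C * r + A)"
      by (simp add: power2_eq_square algebra_simps)
    moreover have "r = C - E * s + s\<^sup>2 * (r\<^sup>2 + C * r + A)"
      using w unfolding s_def C_def E_def r_def A_def .
    then have "s\<^sup>2 * (r\<^sup>2 + C * r + A) = r - C + E * s" by (simp add: algebra_simps)
    ultimately have "s\<^sup>2 * ((t\<^sup>2 - C - r)\<^sup>2 + C * (t\<^sup>2 - C - r) + A) = (t\<^sup>2 - C - r) - r + (r - C + E * s)"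
      by (simp only: u)
    then have "t\<^sup>2 - C - r = C - E * s + s\<^sup>2 * ((t\<^sup>2 - C - r)\<^sup>2 + C * (t\<^sup>2 - C - r) + A)"
      by (simp add: algebra_simps)
    then show ?thesis unfolding s_def t_def C_def E_def r_def A_def .
  qed
  note w2 = this
  obtain \<chi>2 where "is_ring_hom \<chi>2" "\<And>b. \<chi>2 (base_to_total b) = fls_const b"
      "\<chi>2 (total_coord q) = fls_X_inv" "\<chi>2 W = ?\<omega>"
    by (rule place_hom[OF DG w2]) (assumption | (rule that; assumption))+
  from PQ[OF this(1-3)] this(4) have PQ2: "P + ?\<omega> * Q = 0" by simp
  have "(?\<omega> - fps_to_fls w) * Q = (P + ?\<omega> * Q) - (P + fps_to_fls w * Q)"
    by (simp only: left_diff_distrib add_diff_add diff_self add_0)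
  then have "(?\<omega> - fps_to_fls w) * Q = 0" unfolding PQ1 PQ2 by simp
  then have "fls_X\<^sup>2 * ((?\<omega> - fps_to_fls w) * Q) = 0" by simp
  \<comment> \<open>The roots differ by z_q^2 - c_q - 2 w, in which s^(-2) dominates: multiplied by
    s^2 it is a power series with constant term 1, hence invertible over any ring of
    coefficients.\<close>
  moreover have "fls_X\<^sup>2 * (?\<omega> - fps_to_fls w) = fps_to_fls (1 - fps_X\<^sup>2 * (fps_const (c q) + 2 * w))"
  proof -
    have "fls_X\<^sup>2 * fls_X_inv\<^sup>2 = (1 :: ('k, 'n) base_ring fls)"
      using fls_X_X_inv by (metis power_mult_distrib power_one)
    then show ?thesis by (simp add: fls_times_fps_to_fls fps_to_fls_power algebra_simps)
  qed
  ultimately have uQ: "fps_to_fls (1 - fps_X\<^sup>2 * (fps_const (c q) + 2 * w)) * Q = 0"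
    by (simp flip: mult.assoc)
  obtain u where "(1 - fps_X\<^sup>2 * (fps_const (c q) + 2 * w)) * u = 1"
    by (rule fps_unit_constant_one[of "1 - fps_X\<^sup>2 * (fps_const (c q) + 2 * w)"])
      (simp add: fps_X_power_mult_nth)
  then have "fps_to_fls (1 - fps_X\<^sup>2 * (fps_const (c q) + 2 * w)) * fps_to_fls u = 1"
    by (simp only: fls_times_fps_to_fls[symmetric] fps_one_to_fls)
  then have "Q = fps_to_fls u * (fps_to_fls (1 - fps_X\<^sup>2 * (fps_const (c q) + 2 * w)) * Q)"
    by (metis mult.assoc mult.commute mult_1)
  then have Q0: "Q = 0" unfolding uQ by simp
  then have P0: "P = 0" using PQ1 by simp
  have co: "fls_nth (\<Sum>m\<in>M. fls_const (y m) * fls_X_inv ^ m) (- int m) = (if m \<in> M then y m else 0)"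
    if "finite M" for M and y :: "nat \<Rightarrow> ('k, 'n) base_ring" and m
    by (simp add: fls_nth_sum that if_distrib cong: if_cong)
  show ?thesis
  proof (cases i)
    case (Inl pm)
    obtain p m where pm: "pm = (p, m)" by fastforce
    show ?thesis
    proof (cases "p = q")
      case True
      then show ?thesis using co[OF fin(1), of "\<lambda>m. x (Inl (q, m))" m] P0 Inl pm i by (simp add: P_def)
    next
      case False
      then show ?thesis using x0 Inl pm i by simp
    qed
  next
    case (Inr m)
    then show ?thesis using co[OF fin(2), of "\<lambda>m. x (Inr m)" m] Q0 i by (simp add: Q_def)
  qed
qed

end

subsection \<open>The total space is free over the base\<close>

lemma module_base_to_total: "module (\<lambda>b x. base_to_total b * x)"
  by unfold_locales (simp_all add: ring_hom_simps[OF base_to_total_hom] algebra_simps)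

lemma module_span_finite_sum:
  fixes sc :: "'a::comm_ring_1 \<Rightarrow> 'b::ab_group_add \<Rightarrow> 'b"
  assumes "module sc" "x \<in> module.span sc (b ` D)"
  obtains F y where "finite F" "F \<subseteq> D" "x = (\<Sum>i\<in>F. sc (y i) (b i))"
proof -
  interpret module sc by (rule assms(1))
  have "\<exists>F y. finite F \<and> F \<subseteq> D \<and> x = (\<Sum>i\<in>F. sc (y i) (b i))"
    using assms(2)
  proof (induction rule: span_induct_alt)
    case base
    show ?case by (intro exI[of _ "{}"]) simp
  next
    case (step r g x)
    then obtain F y where F: "finite F" "F \<subseteq> D" and x: "x = (\<Sum>i\<in>F. sc (y i) (b i))" by blast
    obtain k where k: "k \<in> D" "g = b k" using step by blast
    let ?e = "\<lambda>i. if i \<in> F then y i else 0"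
    let ?d = "\<lambda>i. ?e i + (if i = k then r else 0)"
    have "(\<Sum>i\<in>insert k F. sc (?d i) (b i))
      = (\<Sum>i\<in>insert k F. sc (?e i) (b i) + (if i = k then sc r (b k) else 0))"
      by (intro sum.cong refl) (simp add: scale_left_distrib)
    also have "\<dots> = (\<Sum>i\<in>insert k F. sc (?e i) (b i)) + (\<Sum>i\<in>insert k F. if i = k then sc r (b k) else 0)"
      by (rule sum.distrib)
    also have "(\<Sum>i\<in>insert k F. sc (?e i) (b i)) = x"
      unfolding x by (rule sum.mono_neutral_cong_right) (use F in auto)
    also have "(\<Sum>i\<in>insert k F. if i = k then sc r (b k) else 0) = sc r g"
      using F by (subst sum.delta) (auto simp: k)
    finally have "sc r g + x = (\<Sum>i\<in>insert k F. sc (?d i) (b i))" by (simp add: add.commute)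
    moreover have "finite (insert k F)" "insert k F \<subseteq> D" using F k by auto
    ultimately show ?case by (intro exI[of _ "insert k F"] exI[of _ ?d] conjI)
  qed
  then show ?thesis using that by blast
qed

text \<open>W counts as a product of two coordinates.\<close>

fun basis_degree :: "('n \<times> nat) + nat \<Rightarrow> nat" where
  "basis_degree (Inl (i, m)) = m"
| "basis_degree (Inr m) = m + 2"

text \<open>Multiplying a basis element by a coordinate leaves correction terms that have to be
  reduced again; the degree bound makes this reduction terminate.\<close>

definition total_filtration :: "('k::field, 'n::finite) total_ring \<Rightarrow> 'n \<Rightarrow> nat \<Rightarrow> ('k, 'n) total_ring set" where
  "total_filtration W q d = module.span (\<lambda>b x. base_to_total b * x)
     (total_basis W q ` {i \<in> basis_index q. basis_degree i \<le> d})"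

context
  fixes c :: "'n::finite \<Rightarrow> ('k::field, 'n) base_ring" and W :: "('k, 'n) total_ring"
  assumes n: "CARD('n) \<ge> 4" and split: "split_params base_param c"
    and W: "product_form (\<lambda>i j. base_to_total (base_param i j)) (\<lambda>i. base_to_total (c i)) total_coord W"
begin

lemma W_coord:
  obtains b where
    "W * total_coord i = W * total_coord q + base_to_total (c i) * total_coord i
      - base_to_total (c q) * total_coord q + base_to_total b"
proof (cases "i = q")
  case True
  then show ?thesis using that[of 0] by (simp add: ring_hom_simps[OF base_to_total_hom])
next
  case False
  note hs = ring_hom_simps[OF base_to_total_hom]
  obtain j where "j \<notin> {i, i, q}" using n by (rule obtain_fourth)
  then have "distinct [q, j, i]" using False by auto
  from product_form_associativity[OF split_params_hom[OF base_to_total_hom split] W this]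
  have "W * total_coord i = W * total_coord q + base_to_total (c i) * total_coord i
      - base_to_total (c q) * total_coord q
      + base_to_total (base_param q j * (c q - c j) - base_param j i * (c j - c i))"
    by (simp add: hs algebra_simps)
  then show ?thesis by (rule that)
qed

lemma total_filtration_ops:
  "0 \<in> total_filtration W q d"
  "x \<in> total_filtration W q d \<Longrightarrow> y \<in> total_filtration W q d \<Longrightarrow> x + y \<in> total_filtration W q d"
  "x \<in> total_filtration W q d \<Longrightarrow> y \<in> total_filtration W q d \<Longrightarrow> x - y \<in> total_filtration W q d"
  "x \<in> total_filtration W q d \<Longrightarrow> base_to_total b * x \<in> total_filtration W q d"
  "d \<le> d' \<Longrightarrow> x \<in> total_filtration W q d \<Longrightarrow> x \<in> total_filtration W q d'"
  "m \<le> d \<Longrightarrow> total_coord i ^ m \<in> total_filtration W q d"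
  "m + 2 \<le> d \<Longrightarrow> W * total_coord q ^ m \<in> total_filtration W q d"
proof -
  interpret M: module "\<lambda>b x. base_to_total b * x" by (rule module_base_to_total)
  show "0 \<in> total_filtration W q d" unfolding total_filtration_def by (rule M.span_zero)
  show "x \<in> total_filtration W q d \<Longrightarrow> y \<in> total_filtration W q d \<Longrightarrow> x + y \<in> total_filtration W q d"
    unfolding total_filtration_def by (rule M.span_add)
  show "x \<in> total_filtration W q d \<Longrightarrow> y \<in> total_filtration W q d \<Longrightarrow> x - y \<in> total_filtration W q d"
    unfolding total_filtration_def by (rule M.span_diff)
  show "x \<in> total_filtration W q d \<Longrightarrow> base_to_total b * x \<in> total_filtration W q d"
    unfolding total_filtration_def by (rule M.span_scale)
  show "x \<in> total_filtration W q d'" if "d \<le> d'" "x \<in> total_filtration W q d"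
    using that(2) unfolding total_filtration_def by (rule subsetD[OF M.span_mono, rotated]) (use that(1) in auto)
  show "total_coord i ^ m \<in> total_filtration W q d" if "m \<le> d"
  proof (cases "m = 0")
    case True
    then show ?thesis unfolding total_filtration_def
      by (intro M.span_base image_eqI[of _ _ "Inl (q, 0)"])
        (auto simp: basis_index_def total_basis_def)
  next
    case False
    then show ?thesis unfolding total_filtration_def using that
      by (intro M.span_base image_eqI[of _ _ "Inl (i, m)"])
        (auto simp: basis_index_def total_basis_def)
  qed
  show "W * total_coord q ^ m \<in> total_filtration W q d" if "m + 2 \<le> d"
    unfolding total_filtration_def using that
    by (intro M.span_base image_eqI[of _ _ "Inr m"]) (auto simp: basis_index_def total_basis_def)
qed

text \<open>The product relation replaces z_j z_i by W and linear terms, and \<open>W_coord\<close>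
  moves powers of z_i next to W to powers of z_q. Each correction contains a product of a coordinate
  with an element of smaller degree, covered by the strong induction.\<close>

lemma total_filtration_coord:
  "x \<in> total_filtration W q d \<Longrightarrow> total_coord j * x \<in> total_filtration W q (Suc d)"
proof (induction d arbitrary: x j rule: less_induct)
  case (less d)
  interpret M: module "\<lambda>b x. base_to_total b * x" by (rule module_base_to_total)
  note f = total_filtration_ops
  note IH = less.IH
  \<comment> \<open>Both products have degree k + 2; the point is that their difference has degree
    at most k + 1.\<close>
  have Wpow: "W * total_coord i ^ k - W * total_coord q ^ k \<in> total_filtration W q (Suc k)" if "k < d" for i k
    using that
  proof (induction k)
    case 0
    then show ?case by (simp add: f(1))
  next
    case (Suc k)
    obtain b where b: "W * total_coord i = W * total_coord q + base_to_total (c i) * total_coord i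
      - base_to_total (c q) * total_coord q + base_to_total b" by (rule W_coord)
    have "W * total_coord i ^ Suc k - W * total_coord q ^ Suc k
      = (W * total_coord i) * total_coord i ^ k - W * total_coord q ^ Suc k" by (simp add: mult.assoc)
    also have "\<dots> = total_coord q * (W * total_coord i ^ k - W * total_coord q ^ k)
      + base_to_total (c i) * total_coord i ^ Suc k
      - base_to_total (c q) * (total_coord q * total_coord i ^ k) + base_to_total b * total_coord i ^ k"
      unfolding b by (simp add: algebra_simps)
    also have "\<dots> \<in> total_filtration W q (Suc (Suc k))"
    proof (intro f(2) f(3) f(4))
      show "total_coord q * (W * total_coord i ^ k - W * total_coord q ^ k) \<in> total_filtration W q (Suc (Suc k))"
        using Suc by (intro IH Suc.IH) auto
      show "total_coord q * total_coord i ^ k \<in> total_filtration W q (Suc (Suc k))"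
        using Suc.prems by (intro f(5)[OF _ IH[of k]] f(6)) auto
    qed (auto intro!: f(6) simp del: power_Suc)
    finally show ?case .
  qed
  have pow: "total_coord j * total_coord i ^ m \<in> total_filtration W q (Suc d)" if "m \<le> d" for i j m
  proof (cases "m = 0 \<or> i = j")
    case True
    then have eq: "total_coord j * total_coord i ^ m = total_coord j ^ Suc m" by auto
    show ?thesis unfolding eq using that by (intro f(6)) simp
  next
    case False
    then obtain k where k: "m = Suc k" by (cases m) auto
    have "total_coord j * total_coord i ^ m = (total_coord j * total_coord i) * total_coord i ^ k"
      by (simp add: k mult.assoc)
    also have "total_coord j * total_coord i = W + base_to_total (c j) + base_to_total (c i)
      - base_to_total (base_param j i) * (total_coord j - total_coord i)"
      using False by (intro product_formD[OF W]) auto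
    also have "\<dots> * total_coord i ^ k = (W * total_coord i ^ k - W * total_coord q ^ k) + W * total_coord q ^ k
      + base_to_total (c j) * total_coord i ^ k + base_to_total (c i) * total_coord i ^ k
      - base_to_total (base_param j i) * (total_coord j * total_coord i ^ k - total_coord i ^ m)"
      by (simp add: k algebra_simps)
    also have "\<dots> \<in> total_filtration W q (Suc d)"
    proof -
      have X: "W * total_coord i ^ k - W * total_coord q ^ k \<in> total_filtration W q (Suc d)"
        using that k by (intro f(5)[OF _ Wpow]) auto
      have V: "W * total_coord q ^ k \<in> total_filtration W q (Suc d)"
        using that k by (intro f(7)) auto
      have Z: "total_coord i ^ k \<in> total_filtration W q (Suc d)" using that k by (intro f(6)) auto
      have Y: "total_coord j * total_coord i ^ k - total_coord i ^ m \<in> total_filtration W q (Suc d)"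
        using that k by (intro f(3) f(5)[OF _ IH[of k]] f(6)) auto
      show ?thesis by (rule f(3)[OF f(2)[OF f(2)[OF f(2)[OF X V] f(4)[OF Z]] f(4)[OF Z]] f(4)[OF Y]])
    qed
    finally show ?thesis .
  qed
  have wpow: "total_coord j * (W * total_coord q ^ m) \<in> total_filtration W q (Suc d)" if "m + 2 \<le> d" for j m
  proof -
    obtain b where b: "W * total_coord j = W * total_coord q + base_to_total (c j) * total_coord j
      - base_to_total (c q) * total_coord q + base_to_total b" by (rule W_coord)
    have "total_coord j * (W * total_coord q ^ m) = (W * total_coord j) * total_coord q ^ m"
      by (simp add: mult_ac)
    also have "\<dots> = W * total_coord q ^ Suc m + base_to_total (c j) * (total_coord j * total_coord q ^ m)
      - base_to_total (c q) * total_coord q ^ Suc m + base_to_total b * total_coord q ^ m"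
      unfolding b by (simp add: algebra_simps)
    also have "\<dots> \<in> total_filtration W q (Suc d)"
    proof (intro f(2) f(3) f(4))
      show "total_coord j * total_coord q ^ m \<in> total_filtration W q (Suc d)"
        using that by (intro f(5)[OF _ IH[of m]] f(6)) auto
    qed (use that in \<open>auto intro!: f(6) f(7) simp del: power_Suc\<close>)
    finally show ?thesis .
  qed
  from less.prems show ?case unfolding total_filtration_def[of W q d]
  proof (induction rule: M.span_induct_alt)
    case base
    then show ?case by (simp add: f(1))
  next
    case (step b g x)
    then obtain i where i: "i \<in> basis_index q" "basis_degree i \<le> d" "g = total_basis W q i" by blast
    have "total_coord j * g \<in> total_filtration W q (Suc d)"
    proof (cases i)
      case (Inl im)
      then show ?thesis using i pow by (cases im) (simp add: total_basis_def)
    next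
      case (Inr m)
      then show ?thesis using i wpow by (simp add: total_basis_def)
    qed
    from f(2)[OF f(4)[OF this, of b] step(2)] show ?case by (simp add: algebra_simps)
  qed
qed

lemma total_basis_spans:
  obtains F y where "finite F" "F \<subseteq> basis_index q"
    "x = (\<Sum>i\<in>F. base_to_total (y i) * total_basis W q i)"
proof -
  note f = total_filtration_ops
  \<comment> \<open>The union of the filtration is stable under multiplication by every element, and
    it contains 1 in the guise of the zeroth power of z_q.\<close>
  have "\<forall>d. \<forall>y\<in>total_filtration W q d. \<exists>d'. x * y \<in> total_filtration W q d'"
  proof (induction x rule: total_ring_induct)
    case (base b)
    then show ?case using f(4) by blast
  next
    case (coord i)
    then show ?case using total_filtration_coord by blast
  next
    case (add x1 x2)
    show ?case
    proof (intro allI ballI)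
      fix d y assume "y \<in> total_filtration W q d"
      then obtain d1 d2 where "x1 * y \<in> total_filtration W q d1" "x2 * y \<in> total_filtration W q d2"
        using add by meson
      then have "x1 * y \<in> total_filtration W q (max d1 d2)" "x2 * y \<in> total_filtration W q (max d1 d2)"
        by (auto intro: f(5)[rotated])
      then show "\<exists>d'. (x1 + x2) * y \<in> total_filtration W q d'" unfolding distrib_right using f(2) by blast
    qed
  next
    case (mult x1 x2)
    then show ?case unfolding mult.assoc by meson
  qed
  moreover have "total_coord q ^ 0 \<in> total_filtration W q 0" by (rule f(6)) simp
  ultimately obtain d where "x * total_coord q ^ 0 \<in> total_filtration W q d" by blast
  then have "x \<in> total_filtration W q d" by simp
  then obtain F y where F: "finite F" "F \<subseteq> {i \<in> basis_index q. basis_degree i \<le> d}"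
    "x = (\<Sum>i\<in>F. base_to_total (y i) * total_basis W q i)"
    unfolding total_filtration_def by (rule module_span_finite_sum[OF module_base_to_total])
  then show ?thesis by (intro that[of F y]) auto
qed

lemma flat_base_to_total: "flat_hom (base_to_total :: ('k, 'n) base_ring \<Rightarrow> _)"
proof -
  obtain q :: 'n where True by simp
  show ?thesis
  proof (rule flat_hom_free[OF base_to_total_hom, where b = "total_basis W q" and B = "basis_index q"])
    show "\<exists>F y. finite F \<and> F \<subseteq> basis_index q \<and> x = (\<Sum>i\<in>F. base_to_total (y i) * total_basis W q i)" for x
      by (rule total_basis_spans[of q x]) blast
  qed (rule total_basis_independent[OF n split W])
qed

end

subsection \<open>Functions on the lines\<close>

lemma pCons_hom: "is_ring_hom (\<lambda>c :: 'a::comm_ring_1. [:c:])"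
  by (simp add: is_ring_hom_def one_pCons)

text \<open>Restriction of functions to the i-th axis, as polynomials in the parameter of the axis.
  The values on generators pin it down, and existence comes from
  \<open>lines_ring_hom_exists\<close>.\<close>

definition lines_axis :: "'n::finite \<Rightarrow> ('k::field, 'n) lines_ring \<Rightarrow> 'k poly" where
  "lines_axis i = (SOME h. is_ring_hom h \<and> (\<forall>c. h (lines_const c) = [:c:]) \<and>
     (\<forall>j. h (lines_coord j) = (if j = i then [:0, 1:] else 0)))"

definition lines_diag :: "('k::field, 'n::finite) lines_ring \<Rightarrow> 'k poly" where
  "lines_diag = (SOME h. is_ring_hom h \<and> (\<forall>c. h (lines_const c) = [:c:]) \<and>
     (\<forall>j. h (lines_coord j) = [:0, 1:]))"

lemma lines_axis: "is_ring_hom (lines_axis i :: ('k::field, 'n::finite) lines_ring \<Rightarrow> _)"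
    "lines_axis i (lines_const c :: ('k, 'n) lines_ring) = [:c:]"
    "lines_axis i (lines_coord j :: ('k, 'n) lines_ring) = (if j = i then [:0, 1:] else 0)"
proof -
  have "\<exists>h :: ('k, 'n) lines_ring \<Rightarrow> 'k poly. is_ring_hom h \<and> (\<forall>c. h (lines_const c) = [:c:]) \<and>
     (\<forall>j. h (lines_coord j) = (if j = i then [:0, 1:] else 0))" for i
    by (rule lines_ring_hom_exists[OF pCons_hom, of "\<lambda>j. if j = i then [:0, 1:] else 0"]) (auto split: if_splits)
  from someI_ex[OF this[of i], folded lines_axis_def]
  show "is_ring_hom (lines_axis i :: ('k, 'n) lines_ring \<Rightarrow> _)"
    "lines_axis i (lines_const c :: ('k, 'n) lines_ring) = [:c:]"
    "lines_axis i (lines_coord j :: ('k, 'n) lines_ring) = (if j = i then [:0, 1:] else 0)"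
    by blast+
qed

lemma lines_diag: "is_ring_hom (lines_diag :: ('k::field, 'n::finite) lines_ring \<Rightarrow> _)"
    "lines_diag (lines_const c :: ('k, 'n) lines_ring) = [:c:]"
    "lines_diag (lines_coord j :: ('k, 'n) lines_ring) = [:0, 1:]"
proof -
  have "\<exists>h :: ('k, 'n) lines_ring \<Rightarrow> 'k poly. is_ring_hom h \<and> (\<forall>c. h (lines_const c) = [:c:]) \<and>
     (\<forall>j. h (lines_coord j) = [:0, 1:])"
    by (rule lines_ring_hom_exists[OF pCons_hom, of "\<lambda>j. [:0, 1:]"]) auto
  from someI_ex[OF this] show "is_ring_hom (lines_diag :: ('k, 'n) lines_ring \<Rightarrow> _)"
    "lines_diag (lines_const c :: ('k, 'n) lines_ring) = [:c:]"
    "lines_diag (lines_coord j :: ('k, 'n) lines_ring) = [:0, 1:]"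
    unfolding lines_diag_def by blast+
qed

definition at_coord :: "'n::finite \<Rightarrow> 'k::field poly \<Rightarrow> ('k, 'n) lines_ring" where
  "at_coord i p = poly (map_poly lines_const p) (lines_coord i)"

lemma at_coord_simps [simp]: "at_coord i 0 = 0"
  "at_coord i (pCons a p) = lines_const a + lines_coord i * at_coord i p"
  by (simp_all add: at_coord_def map_poly_pCons ring_hom_simps[OF lines_const_hom])

lemma at_coord_add: "at_coord i (p + q) = at_coord i p + at_coord i q"
  by (induction p q rule: poly_induct2) (simp_all add: ring_hom_simps[OF lines_const_hom] algebra_simps)

lemma lines_axis_at_coord: "lines_axis j (at_coord i p) = (if j = i then p else [:coeff p 0:])"
  by (induction p) (simp_all add: ring_hom_simps[OF lines_axis(1)] lines_axis)

lemma lines_diag_at_coord: "lines_diag (at_coord i p :: ('k::field, 'n::finite) lines_ring) = p"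
  by (induction p) (simp_all add: ring_hom_simps[OF lines_diag(1)] lines_diag)

text \<open>The gluing conditions between the components: equal values at the origin, and one linear
  condition because the direction (1,...,1) is the sum of the directions of the axes.\<close>

lemma lines_restrictions:
  fixes f :: "('k::field, 'n::finite) lines_ring"
  shows "coeff (lines_axis i f) 0 = lines_origin f" "coeff (lines_diag f) 0 = lines_origin f"
    "coeff (lines_diag f) 1 = (\<Sum>i\<in>UNIV. coeff (lines_axis i f) 1)"
proof -
  note hs = ring_hom_simps[OF lines_axis(1)] ring_hom_simps[OF lines_diag(1)] ring_hom_simps[OF lines_origin(1)]
  have c0: "coeff (lines_axis i f) 0 = lines_origin f" for i and f :: "('k, 'n) lines_ring"
    by (induction f rule: lines_ring_induct) (simp_all add: hs lines_axis lines_origin coeff_mult)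
  have d0: "coeff (lines_diag f) 0 = lines_origin f" for f :: "('k, 'n) lines_ring"
    by (induction f rule: lines_ring_induct) (simp_all add: hs lines_diag lines_origin coeff_mult)
  show "coeff (lines_axis i f) 0 = lines_origin f" "coeff (lines_diag f) 0 = lines_origin f" by (rule c0 d0)+
  have c1: "coeff (p * q) 1 = coeff p 0 * coeff q 1 + coeff p 1 * coeff q 0" for p q :: "'k poly"
    by (simp add: coeff_mult)
  have if1: "coeff (if j = i then [:0, 1:] else 0) (Suc 0) = (if i = j then 1 else (0 :: 'k))" for i j :: 'n
    by auto
  show "coeff (lines_diag f) 1 = (\<Sum>i\<in>UNIV. coeff (lines_axis i f) 1)"
  proof (induction f rule: lines_ring_induct)
    case (mult x y)
    then show ?case
      by (simp only: hs c1 c0 d0 sum.distrib sum_distrib_left sum_distrib_right)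
  qed (simp_all add: hs lines_axis lines_diag sum.distrib if1)
qed

text \<open>Writing z_i z_j as z_m z_r with m, r different from k and l lets z_r z_k = z_r z_l
  replace k by l. Geometrically z_i z_j vanishes on all axes, and on the remaining line all
  coordinates agree.\<close>

lemma lines_coord_W:
  fixes i j k l :: "'n::finite"
  assumes n: "CARD('n) \<ge> 4" and ij: "i \<noteq> j"
  shows "lines_coord i * lines_coord j * at_coord k p = lines_coord i * lines_coord j * (at_coord l p :: ('k::field, 'n) lines_ring)"
proof -
  let ?w = "lines_coord i * lines_coord j :: ('k, 'n) lines_ring"
  have k: "?w * lines_coord k = ?w * lines_coord l" for k l
  proof -
    obtain m where m: "m \<notin> {k, k, l}" using n by (rule obtain_fourth)
    obtain r where r: "r \<notin> {k, l, m}" using n by (rule obtain_fourth)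
    have "?w * lines_coord k = lines_coord m * (lines_coord r * lines_coord k)"
    proof -
      have "m \<noteq> r" using r by auto
      from arg_cong[OF lines_coord_mult[OF ij this], of "\<lambda>x. x * lines_coord k"]
      show ?thesis by (simp only: mult.assoc)
    qed
    also have "lines_coord r * lines_coord k = (lines_coord r * lines_coord l :: ('k, 'n) lines_ring)"
      by (rule lines_coord_mult) (use r in auto)
    also have "lines_coord m * (lines_coord r * lines_coord l) = ?w * lines_coord l"
    proof -
      have "m \<noteq> r" using r by auto
      from arg_cong[OF lines_coord_mult[OF ij this, symmetric], of "\<lambda>x. x * lines_coord l"]
      show ?thesis by (simp only: mult.assoc)
    qed
    finally show ?thesis .
  qed
  show ?thesis
  proof (induction p)
    case (pCons a p)
    have "?w * at_coord k (pCons a p) = ?w * lines_const a + ?w * lines_coord k * at_coord k p"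
      by (simp add: algebra_simps)
    also have "\<dots> = ?w * lines_const a + lines_coord l * (?w * at_coord k p)"
      unfolding k[of k l] by (simp add: mult_ac)
    also have "\<dots> = ?w * at_coord l (pCons a p)" unfolding pCons.IH by (simp add: algebra_simps)
    finally show ?case .
  qed simp
qed

text \<open>A normal form, unique up to shifting constants between the P_i: the set of such sums
  contains 1 and is stable under multiplication by constants and coordinates.\<close>

lemma lines_representation:
  fixes f :: "('k::field, 'n::finite) lines_ring"
  assumes n: "CARD('n) \<ge> 4" and pq: "p \<noteq> q"
  obtains P Q where "f = (\<Sum>i\<in>UNIV. at_coord i (P i)) + lines_coord p * lines_coord q * at_coord q Q"
proof -
  let ?w = "lines_coord p * lines_coord q :: ('k, 'n) lines_ring"
  let ?R = "{(\<Sum>i\<in>UNIV. at_coord i (P i)) + ?w * at_coord q Q | P Q. True}"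
  have R: "(\<Sum>i\<in>UNIV. at_coord i (P i)) + ?w * at_coord q Q \<in> ?R" for P Q
    by (intro CollectI exI conjI) (rule refl, rule TrueI)
  have add: "x + y \<in> ?R" if xy: "x \<in> ?R" "y \<in> ?R" for x y
  proof -
    obtain P Q P' Q' where "x = (\<Sum>i\<in>UNIV. at_coord i (P i)) + ?w * at_coord q Q"
      "y = (\<Sum>i\<in>UNIV. at_coord i (P' i)) + ?w * at_coord q Q'" using xy by blast
    then have "x + y = (\<Sum>i\<in>UNIV. at_coord i (P i + P' i)) + ?w * at_coord q (Q + Q')"
      by (simp add: at_coord_add sum.distrib algebra_simps)
    then show ?thesis by (simp only: R)
  qed
  have single: "at_coord i r \<in> ?R" for i r
  proof -
    have "at_coord i r = (\<Sum>j\<in>UNIV. at_coord j (if j = i then r else 0)) + ?w * at_coord q 0"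
      by (simp add: if_distrib cong: if_cong)
    then show ?thesis by (simp only: R)
  qed
  have wsingle: "?w * at_coord i r \<in> ?R" for i r
  proof -
    have "?w * at_coord i r = (\<Sum>j\<in>UNIV. at_coord j 0) + ?w * at_coord q r"
      using lines_coord_W[OF n pq, of i r q] by simp
    then show ?thesis by (simp only: R)
  qed
  have sum: "(\<Sum>i\<in>I. g i) \<in> ?R" if "\<And>i. g i \<in> ?R" for g and I :: "'n set"
    by (induction I rule: infinite_finite_induct) (use single[of q 0] add that in auto)
  have coord: "lines_coord j * x \<in> ?R" if x: "x \<in> ?R" for j x
  proof -
    obtain P Q where "x = (\<Sum>i\<in>UNIV. at_coord i (P i)) + ?w * at_coord q Q" using x by blast
    then have "lines_coord j * x = (\<Sum>i\<in>UNIV. lines_coord j * at_coord i (P i)) + ?w * (lines_coord j * at_coord q Q)"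
      by (simp add: algebra_simps sum_distrib_left)
    moreover have "lines_coord j * at_coord i r \<in> ?R" for i r
    proof (cases "i = j")
      case True
      then have eq: "lines_coord j * at_coord i r = at_coord j (pCons 0 r)"
        by (simp add: ring_hom_simps[OF lines_const_hom])
      show ?thesis unfolding eq by (rule single)
    next
      case False
      obtain a r' where r: "r = pCons a r'" by (rule pCons_cases)
      have "lines_coord j * lines_coord i = ?w" by (rule lines_coord_mult) (use False pq in auto)
      moreover have "lines_coord j * at_coord i r = at_coord j [:0, a:] + lines_coord j * lines_coord i * at_coord i r'"
        by (simp add: r ring_hom_simps[OF lines_const_hom] algebra_simps)
      ultimately have eq: "lines_coord j * at_coord i r = at_coord j [:0, a:] + ?w * at_coord i r'" by simp
      show ?thesis unfolding eq by (rule add[OF single wsingle])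
    qed
    moreover have "?w * (lines_coord j * at_coord q Q) \<in> ?R"
    proof -
      have "?w * (lines_coord j * at_coord q Q) = lines_coord j * (?w * at_coord q Q)" by (simp add: mult_ac)
      also have "\<dots> = lines_coord j * (?w * at_coord j Q)" by (simp only: lines_coord_W[OF n pq, of q Q j])
      also have "\<dots> = ?w * at_coord j (pCons 0 Q)"
        by (simp add: ring_hom_simps[OF lines_const_hom] mult_ac)
      finally show ?thesis using wsingle[of j "pCons 0 Q"] by (simp only:)
    qed
    ultimately show ?thesis by (simp only: add sum)
  qed
  note addR = add and coordR = coord
  have "\<forall>x\<in>?R. f * x \<in> ?R"
  proof (induction f rule: lines_ring_induct)
    case (const a)
    show ?case
    proof
      fix x assume "x \<in> ?R"
      then obtain P Q where x: "x = (\<Sum>i\<in>UNIV. at_coord i (P i)) + ?w * at_coord q Q" by blast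
      have sm: "lines_const a * at_coord i r = at_coord i (smult a r)" for i r
      proof (induction r)
        case (pCons b r)
        then show ?case
          by (simp add: ring_hom_simps[OF lines_const_hom] distrib_left mult.left_commute[of "lines_const a"])
      qed simp
      have "lines_const a * x = (\<Sum>i\<in>UNIV. at_coord i (smult a (P i))) + ?w * at_coord q (smult a Q)"
        by (simp add: x algebra_simps sum_distrib_left flip: sm)
      then show "lines_const a * x \<in> ?R" by (simp only: R)
    qed
  next
    case (coord i)
    show ?case by (intro ballI coordR)
  next
    case (add x y)
    show ?case
    proof
      fix u assume u: "u \<in> ?R"
      have "x * u + y * u \<in> ?R" by (rule addR[OF add(1)[rule_format, OF u] add(2)[rule_format, OF u]])
      then show "(x + y) * u \<in> ?R" by (simp only: distrib_right)
    qed
  next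
    case (mult x y)
    then show ?case by (simp only: mult.assoc) blast
  qed
  moreover have "1 \<in> ?R" using single[of q "[:1:]"] by (simp add: ring_hom_simps[OF lines_const_hom])
  ultimately have "f * 1 \<in> ?R" by blast
  then show ?thesis using that by auto
qed

text \<open>The quadrics z_i z_j - z_k z_l generate the whole vanishing ideal of the lines:
  restricting the normal form to the axes makes every P_i constant, and the remaining line then
  forces Q = 0.\<close>

lemma lines_eqI:
  fixes f g :: "('k::field, 'n::finite) lines_ring"
  assumes n: "CARD('n) \<ge> 4" and ax: "\<And>i. lines_axis i f = lines_axis i g" and di: "lines_diag f = lines_diag g"
  shows "f = g"
proof -
  note hs = ring_hom_simps[OF lines_axis(1)] ring_hom_simps[OF lines_diag(1)] ring_hom_sum[OF lines_axis(1)]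
    ring_hom_sum[OF lines_diag(1)]
  obtain p :: 'n where True by simp
  obtain q where "q \<notin> {p, p, p}" using n by (rule obtain_fourth)
  then have pq: "p \<noteq> q" by auto
  obtain P Q where f: "f - g = (\<Sum>i\<in>UNIV. at_coord i (P i)) + lines_coord p * lines_coord q * at_coord q Q"
    by (rule lines_representation[OF n pq])
  let ?e = "\<lambda>i. coeff (P i) 0"
  \<comment> \<open>On axis k all other summands contribute only their constants, and the product of
    two coordinates vanishes.\<close>
  have A: "P k = [:?e k - (\<Sum>i\<in>UNIV. ?e i):]" for k
  proof -
    have "0 = lines_axis k (f - g)" using ax by (simp add: hs)
    also have "\<dots> = (\<Sum>i\<in>UNIV. if k = i then P i else [:?e i:])"
      unfolding f using pq by (simp add: hs lines_axis lines_axis_at_coord)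
    also have "\<dots> = (\<Sum>i\<in>UNIV. [:?e i:] + (if k = i then P i - [:?e i:] else 0))"
      by (rule sum.cong) auto
    also have "\<dots> = (\<Sum>i\<in>UNIV. [:?e i:]) + (P k - [:?e k:])" by (simp add: sum.distrib)
    also have "(\<Sum>i\<in>UNIV. [:?e i:]) = [:\<Sum>i\<in>UNIV. ?e i:]" by (simp add: ring_hom_sum[OF pCons_hom])
    finally have "0 = [:\<Sum>i\<in>UNIV. ?e i:] + (P k - [:?e k:])" .
    moreover have "r = e - s" if "0 = s + (r - e)" for r e s :: "'k poly"
      using that by (simp add: algebra_simps)
    ultimately have "P k = [:?e k:] - [:\<Sum>i\<in>UNIV. ?e i:]" by blast
    then show ?thesis by simp
  qed
  have e0: "(\<Sum>i\<in>UNIV. ?e i) = 0" using arg_cong[OF A[of p], of "\<lambda>r. coeff r 0"] by simp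
  then have Pc: "P k = [:?e k:]" for k using A[of k] by simp
  have S0: "(\<Sum>i\<in>UNIV. P i) = 0"
    using e0 ring_hom_sum[OF pCons_hom, of ?e UNIV] by (simp flip: Pc)
  have "0 = lines_diag (f - g)" using di by (simp add: hs)
  also have "\<dots> = (\<Sum>i\<in>UNIV. P i) + [:0, 1:] * [:0, 1:] * Q"
    unfolding f by (simp add: hs lines_diag lines_diag_at_coord)
  finally have "Q = 0" using S0 by simp
  moreover have "(\<Sum>i\<in>UNIV. at_coord i (P i)) = lines_const (\<Sum>i\<in>UNIV. ?e i)"
    unfolding ring_hom_sum[OF lines_const_hom]
    by (rule sum.cong) (metis Pc at_coord_simps add.right_neutral mult_zero_right)+
  ultimately show ?thesis using f e0 by (simp add: ring_hom_simps[OF lines_const_hom])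
qed

text \<open>The gluing conditions are also sufficient. A sum of polynomials in the z_i realises the
  axes; its error on the line (1,...,1) is divisible by t^2, and t^2 Q is the restriction of z_p z_q
  Q(z_q), which vanishes on the axes.\<close>

lemma lines_construct:
  fixes P :: "'n::finite \<Rightarrow> 'k::field poly"
  assumes n: "CARD('n) \<ge> 4" and c: "\<And>i. coeff (P i) 0 = c" "coeff P0 0 = c"
    and lin: "coeff P0 1 = (\<Sum>i\<in>UNIV. coeff (P i) 1)"
  obtains f where "\<And>i. lines_axis i f = P i" "lines_diag f = P0"
proof -
  note hs = ring_hom_simps[OF lines_axis(1)] ring_hom_simps[OF lines_diag(1)] ring_hom_sum[OF lines_axis(1)]
    ring_hom_sum[OF lines_diag(1)]
  obtain p :: 'n where True by simp
  obtain q where "q \<notin> {p, p, p}" using n by (rule obtain_fourth)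
  then have pq: "p \<noteq> q" by auto
  let ?D = "P0 - [:c:] - (\<Sum>i\<in>UNIV. P i - [:c:])"
  obtain a b Q where D: "?D = pCons a (pCons b Q)" by (metis pCons_cases)
  have "a = coeff ?D 0" unfolding D by simp
  also have "\<dots> = 0" by (simp add: coeff_sum c)
  finally have a: "a = 0" .
  have "b = coeff ?D 1" unfolding D by simp
  also have "\<dots> = 0" using lin by (simp add: coeff_sum)
  finally have b: "b = 0" .
  let ?f = "lines_const c + (\<Sum>i\<in>UNIV. at_coord i (P i - [:c:])) + lines_coord p * lines_coord q * at_coord q Q"
  show ?thesis
  proof (rule that)
    fix k
    have "lines_axis k ?f = [:c:] + (\<Sum>i\<in>UNIV. if k = i then P i - [:c:] else 0)"
      using pq c by (simp add: hs lines_axis lines_axis_at_coord cong: if_cong)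
    then show "lines_axis k ?f = P k" by simp
    have "lines_diag ?f = [:c:] + (\<Sum>i\<in>UNIV. P i - [:c:]) + [:0, 1:] * [:0, 1:] * Q"
      by (simp add: hs lines_diag lines_diag_at_coord)
    also have "[:0, 1:] * [:0, 1:] * Q = ?D" unfolding D a b by simp
    finally show "lines_diag ?f = P0" by simp
  qed
qed

subsection \<open>First order deformations of the lines\<close>

lemma symmetric_edge_constant:
  fixes f :: "'n::finite \<Rightarrow> 'n \<Rightarrow> 'a"
  assumes n: "CARD('n) \<ge> 4" and sym: "\<And>i j. f i j = f j i"
    and swap: "\<And>i j l. distinct [i, j, l] \<Longrightarrow> f i j = f i l"
  obtains x where "\<And>i j. i \<noteq> j \<Longrightarrow> f i j = x"
proof -
  have swap': "f i j = f i l" if "i \<noteq> j" "i \<noteq> l" for i j l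
    using swap[of i j l] that by (cases "j = l") auto
  have all: "f i j = f k l" if "i \<noteq> j" "k \<noteq> l" for i j k l
  proof -
    obtain m where "m \<notin> {i, i, k}" using n by (rule obtain_fourth)
    then have m: "m \<noteq> i" "m \<noteq> k" by auto
    have "f i j = f i m" using that m by (intro swap') auto
    also have "\<dots> = f m i" by (rule sym)
    also have "\<dots> = f m k" using m by (intro swap') auto
    also have "\<dots> = f k m" by (rule sym)
    also have "\<dots> = f k l" using that m by (intro swap') auto
    finally show ?thesis .
  qed
  obtain p :: 'n where True by simp
  obtain q where "q \<notin> {p, p, p}" using n by (rule obtain_fourth)
  then have "p \<noteq> q" by auto
  show ?thesis by (rule that[of "f p q"], rule all) (use \<open>p \<noteq> q\<close> in auto)
qed

text \<open>If f_ij = \<mu>_i + \<mu>_j, then f_ij + f_il - f_jl = 2 \<mu>_i. The hypothesis makes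
  this expression independent of j and l, and t = 1/2 recovers \<mu>_i.\<close>

lemma symmetric_edge_sum:
  fixes f :: "'n::finite \<Rightarrow> 'n \<Rightarrow> 'a::comm_ring_1" and t :: 'a
  assumes n: "CARD('n) \<ge> 4" and t: "2 * t = 1" and sym: "\<And>i j. f i j = f j i"
    and ex: "\<And>i j k l. distinct [i, j, k, l] \<Longrightarrow> f i j - f i l = f j k - f l k"
  obtains \<mu> where "\<And>i j. i \<noteq> j \<Longrightarrow> f i j = \<mu> i + \<mu> j"
proof -
  have "\<exists>x. \<forall>j l. distinct [i, j, l] \<longrightarrow> f i j + f i l - f j l = x" for i
  proof -
    have h: "f i j + f i l - f j l = f i j + f i m - f j m" if "distinct [i, j, l, m]" for j l m
    proof -
      have "distinct [i, l, j, m]" using that by auto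
      from ex[OF this] have "f i l - f i m = f j l - f j m" by (simp add: sym[of l j] sym[of m j])
      then show ?thesis by (simp add: algebra_simps)
    qed
    obtain x where "\<And>j l. distinct [i, j, l] \<Longrightarrow> f i j + f i l - f j l = x"
      by (rule symmetric_pair_constant[OF n, of "\<lambda>j l. f i j + f i l - f j l" i])
        (simp add: sym add.commute, rule h, assumption, blast)
    then show ?thesis by blast
  qed
  then obtain \<nu> where \<nu>: "\<And>i j l. distinct [i, j, l] \<Longrightarrow> f i j + f i l - f j l = \<nu> i" by metis
  show ?thesis
  proof (rule that[of "\<lambda>i. t * \<nu> i"])
    fix i j :: 'n assume "i \<noteq> j"
    moreover obtain l where "l \<notin> {i, j, j}" using n by (rule obtain_fourth)
    ultimately have "\<nu> i = f i j + f i l - f j l" "\<nu> j = f i j + f j l - f i l"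
      using \<nu>[of i j l] \<nu>[of j i l] sym[of j i] by auto
    then have "\<nu> i + \<nu> j = 2 * f i j" by simp
    then have "t * (\<nu> i + \<nu> j) = 2 * t * f i j" by simp
    then have "t * \<nu> i + t * \<nu> j = 2 * t * f i j" by (simp only: distrib_left)
    then show "f i j = t * \<nu> i + t * \<nu> j" by (simp add: t)
  qed
qed

text \<open>The equations are solved component by component. On an axis other than i and j the
  right-hand side is \<omega>, on axis i it is \<omega> + t (\<zeta>_j + s \<alpha>_ij), and on the
  line (1,...,1) it is \<omega> + t (\<zeta>_i + \<zeta>_j). The restrictions of \<omega> and
  \<zeta> found in this way must glue, which fixes \<alpha>.\<close>

lemma lines_solver_reduced:
  fixes f :: "'n::finite \<Rightarrow> 'n \<Rightarrow> ('k::field_char_0, 'n) lines_ring"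
  assumes n: "CARD('n) \<ge> 4" and s: "lines_origin s = 1" and sym: "\<And>i j. f i j = f j i"
    and ax: "\<And>i j k l. distinct [i, j, k, l] \<Longrightarrow> lines_axis k (f i j) = lines_axis k (f i l)"
    and di: "\<And>i j k l. distinct [i, j, k, l] \<Longrightarrow>
      lines_diag (f i j) - lines_diag (f i l) = lines_diag (f j k) - lines_diag (f l k)"
  obtains \<omega> \<zeta> \<alpha> where "\<And>i j. \<alpha> i j + \<alpha> j i = 0"
    "\<And>i j. i \<noteq> j \<Longrightarrow> f i j = \<omega> + \<zeta> i * lines_coord j + lines_coord i * \<zeta> j
       + s * (lines_const (\<alpha> i j) * (lines_coord i - lines_coord j))"
proof -
  note hs = ring_hom_simps[OF lines_axis(1)] ring_hom_simps[OF lines_diag(1)]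
  have "\<exists>\<Omega>. \<forall>j l. distinct [k, j, l] \<longrightarrow> lines_axis k (f j l) = \<Omega>" for k
  proof -
    obtain x where "\<And>j l. distinct [k, j, l] \<Longrightarrow> lines_axis k (f j l) = x"
    proof (rule symmetric_pair_constant[OF n, of "\<lambda>j l. lines_axis k (f j l)" k])
      show "lines_axis k (f j l) = lines_axis k (f l j)" for j l by (simp only: sym[of j l])
      show "lines_axis k (f j l) = lines_axis k (f j m)" if "distinct [k, j, l, m]" for j l m
        by (rule ax) (use that in auto)
    qed blast
    then show ?thesis by blast
  qed
  then obtain \<Omega> where \<Omega>: "\<And>k j l. distinct [k, j, l] \<Longrightarrow> lines_axis k (f j l) = \<Omega> k" by metis
  have or_sym: "lines_origin (f i j) = lines_origin (f j i)" for i j by (simp only: sym[of i j])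
  have or_swap: "lines_origin (f i j) = lines_origin (f i l)" if d: "distinct [i, j, l]" for i j l
  proof -
    obtain k where "k \<notin> {i, j, l}" using n by (rule obtain_fourth)
    then have "distinct [i, j, k, l]" using d by auto
    from arg_cong[OF ax[OF this], of "\<lambda>p. coeff p 0"] show ?thesis by (simp add: lines_restrictions)
  qed
  obtain \<theta> where \<theta>: "\<And>i j. i \<noteq> j \<Longrightarrow> lines_origin (f i j) = \<theta>"
    using symmetric_edge_constant[OF n, of "\<lambda>i j. lines_origin (f i j)", OF or_sym or_swap] by blast
  have \<Omega>0: "coeff (\<Omega> k) 0 = \<theta>" for k
  proof -
    obtain j where j: "j \<notin> {k, k, k}" using n by (rule obtain_fourth)
    obtain l where l: "l \<notin> {k, j, j}" using n by (rule obtain_fourth)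
    have "distinct [k, j, l]" "j \<noteq> l" using j l by auto
    then show ?thesis using \<Omega>[of k j l] \<theta>[of j l] lines_restrictions(1)[of k "f j l"] by simp
  qed
  have half: "2 * [:1 / 2:] = (1 :: 'k poly)" by (simp add: numeral_poly one_pCons)
  have di_sym: "lines_diag (f i j) = lines_diag (f j i)" for i j by (simp only: sym[of i j])
  obtain \<mu> where \<mu>: "\<And>i j. i \<noteq> j \<Longrightarrow> lines_diag (f i j) = \<mu> i + \<mu> j"
    using symmetric_edge_sum[OF n half, of "\<lambda>i j. lines_diag (f i j)", OF di_sym di] by blast
  \<comment> \<open>Value and slope of \<omega> on the line (1,...,1) are dictated by gluing; the
    higher coefficients are free and set to 0.\<close>
  define \<omega>0 where "\<omega>0 = [:\<theta>, \<Sum>k\<in>UNIV. coeff (\<Omega> k) 1:]"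
  \<comment> \<open>Splitting \<open>\<omega>0\<close> evenly between the two summands of \<mu>_i +
    \<mu>_j leaves parts that vanish at the origin and are thus divisible by t.\<close>
  define M where "M i = \<mu> i - [:1 / 2:] * \<omega>0" for i
  have diag: "lines_diag (f i j) = \<omega>0 + M i + M j" if "i \<noteq> j" for i j
  proof -
    have "[:1 / 2:] * \<omega>0 + [:1 / 2:] * \<omega>0 = 2 * [:1 / 2:] * \<omega>0" by simp
    then have "[:1 / 2:] * \<omega>0 + [:1 / 2:] * \<omega>0 = \<omega>0" by (simp only: half mult_1)
    then have "\<omega>0 + M i + M j = \<mu> i + \<mu> j"
      unfolding M_def by (metis (no_types, lifting) add_diff_add add_diff_cancel_left' add_diff_eq diff_add_eq)
    then show ?thesis using \<mu>[OF that] by simp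
  qed
  have m0: "coeff (M i) 0 = 0" for i
  proof -
    let ?m = "\<lambda>i. coeff (M i) 0"
    have p: "?m i + ?m j = 0" if "i \<noteq> j" for i j
      using arg_cong[OF diag[OF that], of "\<lambda>p. coeff p 0"] \<theta>[OF that]
      by (simp add: lines_restrictions \<omega>0_def algebra_simps)
    obtain j where j: "j \<notin> {i, i, i}" using n by (rule obtain_fourth)
    obtain l where l: "l \<notin> {i, j, j}" using n by (rule obtain_fourth)
    have "2 * ?m i = (?m i + ?m j) + (?m i + ?m l) - (?m j + ?m l)" by simp
    moreover have "?m i + ?m j = 0" "?m i + ?m l = 0" "?m j + ?m l = 0"
      by (rule p; use j l in auto)+
    ultimately have "2 * ?m i = 0" by (simp only: add_0_left diff_self)
    then show ?thesis by (simp only: mult_eq_0_iff zero_neq_numeral[symmetric] simp_thms)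
  qed
  have "\<exists>\<nu>. M i = [:0, 1:] * \<nu>" for i
  proof -
    obtain a q where "M i = pCons a q" by (rule pCons_cases)
    with m0[of i] show ?thesis by auto
  qed
  then obtain \<nu> where \<nu>: "\<And>i. M i = [:0, 1:] * \<nu> i" by metis
  have diag: "lines_diag (f i j) = \<omega>0 + [:0, 1:] * \<nu> i + [:0, 1:] * \<nu> j" if "i \<noteq> j" for i j
    using diag[OF that] unfolding \<nu> .
  have "\<exists>r. i \<noteq> j \<longrightarrow> lines_axis i (f i j) = \<Omega> i + [:0, 1:] * r" for i j
  proof -
    obtain a q where aq: "lines_axis i (f i j) - \<Omega> i = pCons a q" by (rule pCons_cases)
    then have "a = coeff (lines_axis i (f i j) - \<Omega> i) 0" by simp
    also have "i \<noteq> j \<longrightarrow> \<dots> = 0" by (simp add: lines_restrictions \<Omega>0 \<theta>)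
    finally have "i \<noteq> j \<longrightarrow> lines_axis i (f i j) - \<Omega> i = [:0, 1:] * q" using aq by simp
    then show ?thesis by (intro exI[of _ q]) (simp add: algebra_simps)
  qed
  then obtain r where r: "\<And>i j. i \<noteq> j \<Longrightarrow> lines_axis i (f i j) = \<Omega> i + [:0, 1:] * r i j" by metis
  \<comment> \<open>The linear gluing condition for f_ij; it is exactly the antisymmetry of \<alpha>
    below.\<close>
  have lin: "coeff (r i j) 0 + coeff (r j i) 0 = coeff (\<nu> i) 0 + coeff (\<nu> j) 0" if ij: "i \<noteq> j" for i j
  proof -
    have A: "coeff (lines_axis k (f i j)) 1 = coeff (\<Omega> k) 1
      + ((if k = i then coeff (r i j) 0 else 0) + (if k = j then coeff (r j i) 0 else 0))" for k
    proof -
      consider "k = i" | "k = j" | "distinct [k, i, j]" using ij by auto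
      then show ?thesis
      proof cases
        case 1
        then show ?thesis using r[OF ij] ij by simp
      next
        case 2
        then show ?thesis using r[of j i] ij by (simp add: sym[of i j])
      next
        case 3
        then show ?thesis using \<Omega>[OF 3] by auto
      qed
    qed
    have "coeff (lines_diag (f i j)) 1 = (\<Sum>k\<in>UNIV. coeff (\<Omega> k) 1) + (coeff (r i j) 0 + coeff (r j i) 0)"
      unfolding lines_restrictions(3) A sum.distrib by simp
    moreover have "coeff (lines_diag (f i j)) 1 = (\<Sum>k\<in>UNIV. coeff (\<Omega> k) 1) + (coeff (\<nu> i) 0 + coeff (\<nu> j) 0)"
      unfolding diag[OF ij] by (simp add: \<omega>0_def)
    ultimately show ?thesis by simp
  qed
  \<comment> \<open>Since s is 1 at the origin, this choice gives \<zeta>_j the same value at the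
    origin on axis i as on the line (1,...,1).\<close>
  define \<alpha> where "\<alpha> i j = (if i = j then 0 else coeff (r i j) 0 - coeff (\<nu> j) 0)" for i j
  have anti: "\<alpha> i j + \<alpha> j i = 0" for i j
    using lin[of i j] by (auto simp: \<alpha>_def algebra_simps)
  obtain \<omega> where \<omega>: "\<And>k. lines_axis k \<omega> = \<Omega> k" "lines_diag \<omega> = \<omega>0"
    using lines_construct[OF n, of \<Omega> \<theta> \<omega>0] \<Omega>0 by (auto simp: \<omega>0_def)
  define R where "R j i = r i j - [:\<alpha> i j:] * lines_axis i s" for j i
  have R0: "coeff (R j i) 0 = coeff (\<nu> j) 0" if "i \<noteq> j" for i j
    using that by (simp add: R_def lines_restrictions s \<alpha>_def)
  have "\<exists>z. (\<forall>i. i \<noteq> j \<longrightarrow> lines_axis i z = R j i) \<and> lines_diag z = \<nu> j" for j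
  proof -
    \<comment> \<open>The restriction of \<zeta>_j to axis j enters no equation, because its factor
      z_i vanishes there. Its slope is therefore available to satisfy the linear gluing
      condition.\<close>
    let ?P = "\<lambda>i. if i = j then [:coeff (\<nu> j) 0, coeff (\<nu> j) 1 - (\<Sum>i\<in>UNIV - {j}. coeff (R j i) 1):] else R j i"
    have "(\<Sum>i\<in>UNIV. coeff (?P i) 1) = coeff (?P j) 1 + (\<Sum>i\<in>UNIV - {j}. coeff (?P i) 1)"
      by (rule sum.remove) auto
    also have "(\<Sum>i\<in>UNIV - {j}. coeff (?P i) 1) = (\<Sum>i\<in>UNIV - {j}. coeff (R j i) 1)"
      by (rule sum.cong) auto
    finally have l: "coeff (\<nu> j) 1 = (\<Sum>i\<in>UNIV. coeff (?P i) 1)" by simp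
    have c: "coeff (?P i) 0 = coeff (\<nu> j) 0" for i using R0[of i j] by simp
    obtain z where "\<And>i. lines_axis i z = ?P i" "lines_diag z = \<nu> j"
      using lines_construct[OF n c refl l] by blast
    then show ?thesis by (intro exI[of _ z]) simp
  qed
  then obtain \<zeta> where \<zeta>: "\<And>i j. i \<noteq> j \<Longrightarrow> lines_axis i (\<zeta> j) = R j i" "\<And>j. lines_diag (\<zeta> j) = \<nu> j" by metis
  show ?thesis
  proof (rule that[OF anti])
    fix i j :: 'n assume ij: "i \<noteq> j"
    let ?g = "\<omega> + \<zeta> i * lines_coord j + lines_coord i * \<zeta> j
       + s * (lines_const (\<alpha> i j) * (lines_coord i - lines_coord j))"
    show "f i j = ?g"
    proof (rule lines_eqI[OF n])
      show "lines_diag (f i j) = lines_diag ?g"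
        unfolding diag[OF ij] by (simp add: hs lines_diag \<omega> \<zeta>)
      fix k
      consider "k = i" | "k = j" | "distinct [k, i, j]" using ij by auto
      then show "lines_axis k (f i j) = lines_axis k ?g"
      proof cases
        case 1
        have "lines_axis i ?g = \<Omega> i + [:0, 1:] * R j i + lines_axis i s * ([:\<alpha> i j:] * [:0, 1:])"
          using ij by (simp add: hs lines_axis \<omega> \<zeta>)
        also have "\<dots> = \<Omega> i + [:0, 1:] * r i j" unfolding R_def by (simp only: algebra_simps)
        finally show ?thesis using r[OF ij] 1 by simp
      next
        case 2
        have a: "[:\<alpha> i j:] = - [:\<alpha> j i:]" using anti[of i j] by (simp add: eq_neg_iff_add_eq_0)
        have "lines_axis j ?g = \<Omega> j + [:0, 1:] * R i j - lines_axis j s * ([:\<alpha> i j:] * [:0, 1:])"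
          using ij by (simp add: hs lines_axis \<omega> \<zeta>)
        also have "x + y * (z - u * v) - v * (- u * y) = x + y * z" for x y z u v :: "'k poly"
          by (simp add: algebra_simps)
        then have "\<Omega> j + [:0, 1:] * R i j - lines_axis j s * ([:\<alpha> i j:] * [:0, 1:]) = \<Omega> j + [:0, 1:] * r j i"
          unfolding R_def a .
        finally show ?thesis using r[of j i] ij 2 by (simp add: sym[of i j])
      next
        case 3
        then have "i \<noteq> k" "j \<noteq> k" by auto
        then show ?thesis using \<Omega>[OF 3] by (simp add: hs lines_axis \<omega>)
      qed
    qed
  qed
qed

text \<open>Restricting the constraint to axis k, where z_i vanishes, and to the line (1,...,1),
  where the coordinates agree, gives the two conditions of \<open>lines_solver_reduced\<close> up to
  the scalars \<sigma>. These turn out to be additive, and the constants \<gamma>_i + \<gamma>_j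
  absorb them. The restrictions lie in polynomial rings over a field, where s' can be
  cancelled.\<close>

lemma lines_solver:
  fixes f :: "'n::finite \<Rightarrow> 'n \<Rightarrow> ('k::field_char_0, 'n) lines_ring"
  assumes n: "CARD('n) \<ge> 4" and s: "lines_origin s = 1" and sym: "\<And>i j. f i j = f j i"
    and \<sigma>: "\<And>i j k. \<sigma> i j k = \<sigma> j i k" "\<And>i j k. \<sigma> i j k = \<sigma> i k j"
    and eq: "\<And>i j k l. distinct [i, j, k, l] \<Longrightarrow> \<exists>s'. lines_origin s' \<noteq> 0 \<and>
      s' * (lines_coord k * (f i j - f i l - s * lines_const (\<sigma> i j k - \<sigma> i l k))
        - lines_coord i * (f j k - f l k - s * lines_const (\<sigma> i j k - \<sigma> i l k))) = 0"
  obtains \<omega> \<zeta> \<alpha> \<gamma> where "\<And>i j. \<alpha> i j + \<alpha> j i = 0"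
    "\<And>i j k. distinct [i, j, k] \<Longrightarrow> \<sigma> i j k = \<gamma> i + \<gamma> j + \<gamma> k"
    "\<And>i j. i \<noteq> j \<Longrightarrow> f i j = \<omega> + \<zeta> i * lines_coord j + lines_coord i * \<zeta> j
       + s * (lines_const (\<alpha> i j) * (lines_coord i - lines_coord j) + lines_const (\<gamma> i + \<gamma> j))"
proof -
  note hs = ring_hom_simps[OF lines_axis(1)] ring_hom_simps[OF lines_diag(1)]
    ring_hom_simps[OF lines_const_hom]
  have nz: "lines_axis k s' \<noteq> 0" "lines_diag s' \<noteq> 0" if "lines_origin s' \<noteq> 0" for k s'
    using that lines_restrictions(1)[of k s'] lines_restrictions(2)[of s'] by auto
  have ax: "lines_axis k (f i j) - lines_axis k (f i l) = lines_axis k s * [:\<sigma> i j k - \<sigma> i l k:]"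
    if d: "distinct [i, j, k, l]" for i j k l
  proof -
    obtain s' where s': "lines_origin s' \<noteq> 0"
      "s' * (lines_coord k * (f i j - f i l - s * lines_const (\<sigma> i j k - \<sigma> i l k))
        - lines_coord i * (f j k - f l k - s * lines_const (\<sigma> i j k - \<sigma> i l k))) = 0"
      using eq[OF d] by blast
    have "i \<noteq> k" using d by auto
    with arg_cong[OF s'(2), of "lines_axis k"]
    have "lines_axis k s' * ([:0, 1:] * (lines_axis k (f i j) - lines_axis k (f i l)
      - lines_axis k s * [:\<sigma> i j k - \<sigma> i l k:])) = 0"
      by (simp only: hs lines_axis if_True if_False refl mult_zero_left diff_0_right
          ring_hom_simps(6)[OF pCons_hom])
    then show ?thesis using nz(1)[OF s'(1)] by simp
  qed
  have di: "lines_diag (f i j) - lines_diag (f i l) = lines_diag (f j k) - lines_diag (f l k)"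
    if d: "distinct [i, j, k, l]" for i j k l
  proof -
    obtain s' where s': "lines_origin s' \<noteq> 0"
      "s' * (lines_coord k * (f i j - f i l - s * lines_const (\<sigma> i j k - \<sigma> i l k))
        - lines_coord i * (f j k - f l k - s * lines_const (\<sigma> i j k - \<sigma> i l k))) = 0"
      using eq[OF d] by blast
    have "lines_diag s' * ([:0, 1:] * ((lines_diag (f i j) - lines_diag (f i l))
      - (lines_diag (f j k) - lines_diag (f l k)))) = 0"
      using arg_cong[OF s'(2), of lines_diag]
      by (simp add: hs lines_diag algebra_simps)
    then show ?thesis using nz(2)[OF s'(1)] by simp
  qed
  \<comment> \<open>At the origin the axis condition expresses this difference without the index k,
    which is the exchange property required for additivity.\<close>
  have "\<sigma> i j k - \<sigma> i l k = lines_origin (f i j) - lines_origin (f i l)" if "distinct [i, j, k, l]" for i j k l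
    using arg_cong[OF ax[OF that], of "\<lambda>p. coeff p 0"] by (simp add: lines_restrictions s)
  then have ex: "\<sigma> i j k - \<sigma> i l k = \<sigma> i j m - \<sigma> i l m" if "distinct [i, j, k, l, m]" for i j k l m
    using that by auto
  obtain \<gamma> where \<gamma>: "\<And>i j k. distinct [i, j, k] \<Longrightarrow> \<sigma> i j k = \<gamma> i + \<gamma> j + \<gamma> k"
  proof (rule symmetric_exchange_sum[OF n, of "1 / 3" \<sigma>])
    show "\<sigma> i j k - \<sigma> i l k = \<sigma> i j m - \<sigma> i l m" if "distinct [i, j, k, l, m]" for i j k l m
      using that by (rule ex)
    show "3 * (1 / 3) = (1 :: 'k)" by simp
  qed (rule \<sigma>(1), rule \<sigma>(2), (assumption | (rule that; assumption))+)
  define g where "g i j = f i j - s * lines_const (\<gamma> i + \<gamma> j)" for i j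
  have \<sigma>\<gamma>: "\<sigma> i j k - \<sigma> i l k = \<gamma> j - \<gamma> l" if "distinct [i, j, k, l]" for i j k l
    using \<gamma>[of i j k] \<gamma>[of i l k] that by auto
  have gsym: "g i j = g j i" for i j by (simp add: g_def sym[of i j] add.commute)
  have gax: "lines_axis k (g i j) = lines_axis k (g i l)" if "distinct [i, j, k, l]" for i j k l
  proof -
    have "lines_axis k (g i j) - lines_axis k (g i l)
      = (lines_axis k (f i j) - lines_axis k (f i l)) - lines_axis k s * ([:\<gamma> i + \<gamma> j:] - [:\<gamma> i + \<gamma> l:])"
      by (simp only: g_def hs lines_axis ring_hom_simps(3)[OF pCons_hom] algebra_simps)
    also have "\<dots> = 0" unfolding ax[OF that] \<sigma>\<gamma>[OF that] by simp
    finally show ?thesis by simp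
  qed
  have gdi: "lines_diag (g i j) - lines_diag (g i l) = lines_diag (g j k) - lines_diag (g l k)"
    if "distinct [i, j, k, l]" for i j k l
  proof -
    have "lines_diag (g i j) - lines_diag (g i l) - (lines_diag (g j k) - lines_diag (g l k))
      = (lines_diag (f i j) - lines_diag (f i l)) - (lines_diag (f j k) - lines_diag (f l k))
        - lines_diag s * ([:\<gamma> i + \<gamma> j:] - [:\<gamma> i + \<gamma> l:] - ([:\<gamma> j + \<gamma> k:] - [:\<gamma> l + \<gamma> k:]))"
      by (simp only: g_def hs lines_diag ring_hom_simps(3)[OF pCons_hom] algebra_simps)
    also have "\<dots> = 0" unfolding di[OF that] by simp
    finally show ?thesis by simp
  qed
  obtain \<omega> \<zeta> \<alpha> where 1: "\<And>i j. \<alpha> i j + \<alpha> j i = 0"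
    and 2: "\<And>i j. i \<noteq> j \<Longrightarrow> g i j = \<omega> + \<zeta> i * lines_coord j + lines_coord i * \<zeta> j
       + s * (lines_const (\<alpha> i j) * (lines_coord i - lines_coord j))"
    by (rule lines_solver_reduced[of s g, OF n s gsym gax gdi]) (assumption | (rule that; assumption))+
  show ?thesis
  proof (rule that[OF 1 \<gamma>])
    fix i j :: 'n assume "i \<noteq> j"
    from 2[OF this] show "f i j = \<omega> + \<zeta> i * lines_coord j + lines_coord i * \<zeta> j
       + s * (lines_const (\<alpha> i j) * (lines_coord i - lines_coord j) + lines_const (\<gamma> i + \<gamma> j))"
      by (simp add: g_def distrib_left diff_eq_eq add.assoc)
  qed auto
qed

section \<open>The linear problem in the local ring of the lines\<close>

lemma lines_localization_denominator:
  fixes \<iota> :: "('k::field, 'n::finite) lines_ring \<Rightarrow> 'x::comm_ring_1"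
  assumes loc: "is_localization \<iota> {f. lines_origin f \<noteq> 0}" and Y: "finite Y"
  obtains s where "lines_origin s = 1" "\<And>y. y \<in> Y \<Longrightarrow> \<exists>f. y * \<iota> s = \<iota> f"
proof -
  have \<iota>: "is_ring_hom \<iota>" using loc by (simp add: is_localization_def)
  note hs = ring_hom_simps[OF \<iota>] ring_hom_simps[OF lines_origin(1)]
  have frac: "\<exists>x s. lines_origin s \<noteq> 0 \<and> y * \<iota> s = \<iota> x" for y
    using loc unfolding is_localization_def by blast
  have "\<exists>s. lines_origin s = 1 \<and> (\<forall>y\<in>Y. \<exists>f. y * \<iota> s = \<iota> f)"
    using Y
  proof (induction Y rule: finite_induct)
    case empty
    show ?case by (rule exI[of _ 1]) (simp add: hs)
  next
    case (insert y Y)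
    obtain s where s: "lines_origin s = 1" "\<forall>y\<in>Y. \<exists>f. y * \<iota> s = \<iota> f" using insert by blast
    obtain x t where t: "lines_origin t \<noteq> 0" "y * \<iota> t = \<iota> x" using frac by blast
    let ?t = "lines_const (1 / lines_origin t) * t"
    show ?case
    proof (rule exI[of _ "s * ?t"], intro conjI ballI)
      show "lines_origin (s * ?t) = 1" using s t by (simp add: hs lines_origin)
      fix z assume "z \<in> insert y Y"
      then consider "z = y" | f where "z * \<iota> s = \<iota> f" using s(2) by blast
      then show "\<exists>f. z * \<iota> (s * ?t) = \<iota> f"
      proof cases
        case 1
        have "z * \<iota> (s * ?t) = \<iota> s * \<iota> (lines_const (1 / lines_origin t)) * (y * \<iota> t)"
          by (simp add: 1 hs mult_ac)
        also have "\<dots> = \<iota> (s * lines_const (1 / lines_origin t) * x)" by (simp add: t hs)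
        finally show ?thesis by blast
      next
        case 2
        have "z * \<iota> (s * ?t) = (z * \<iota> s) * \<iota> ?t" by (simp add: hs mult_ac)
        also have "\<dots> = \<iota> (f * ?t)" by (simp add: 2 hs)
        finally show ?thesis by blast
      qed
    qed
  qed
  then show ?thesis using that by blast
qed

text \<open>One common denominator \<open>s\<close> clears all the x_ij, and a relation that holds
  after localization holds in the coordinate ring up to a factor s'. This accounts for both factors
  in \<open>lines_solver\<close>.\<close>

lemma localized_solver:
  fixes \<iota> :: "('k::field_char_0, 'n::finite) lines_ring \<Rightarrow> 'x::comm_ring_1"
  assumes n: "CARD('n) \<ge> 4" and loc: "is_localization \<iota> {f. lines_origin f \<noteq> 0}"
    and sym: "\<And>i j. x i j = x j i"
    and \<sigma>: "\<And>i j k. \<sigma> i j k = \<sigma> j i k" "\<And>i j k. \<sigma> i j k = \<sigma> i k j"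
    and eq: "\<And>i j k l. distinct [i, j, k, l] \<Longrightarrow>
      \<iota> (lines_coord k) * (x i j - x i l - \<iota> (lines_const (\<sigma> i j k - \<sigma> i l k)))
        = \<iota> (lines_coord i) * (x j k - x l k - \<iota> (lines_const (\<sigma> i j k - \<sigma> i l k)))"
  obtains \<omega> \<zeta> \<alpha> \<gamma> where "\<And>i j. \<alpha> i j + \<alpha> j i = 0"
    "\<And>i j k. distinct [i, j, k] \<Longrightarrow> \<sigma> i j k = \<gamma> i + \<gamma> j + \<gamma> k"
    "\<And>i j. i \<noteq> j \<Longrightarrow> x i j = \<omega> + \<zeta> i * \<iota> (lines_coord j) + \<iota> (lines_coord i) * \<zeta> j
       + \<iota> (lines_const (\<alpha> i j)) * (\<iota> (lines_coord i) - \<iota> (lines_coord j)) + \<iota> (lines_const (\<gamma> i + \<gamma> j))"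
proof -
  have \<iota>: "is_ring_hom \<iota>" using loc by (simp add: is_localization_def)
  note hs = ring_hom_simps[OF \<iota>]
  let ?Y = "range (\<lambda>(i, j). x i j)"
  obtain s where s: "lines_origin s = 1" and "\<And>y. y \<in> ?Y \<Longrightarrow> \<exists>f. y * \<iota> s = \<iota> f"
    by (rule lines_localization_denominator[OF loc, of ?Y]) auto
  then have "\<forall>y\<in>?Y. \<exists>f. y * \<iota> s = \<iota> f" by blast
  then obtain F where F: "\<And>y. y \<in> ?Y \<Longrightarrow> y * \<iota> s = \<iota> (F y)" by metis
  have F: "\<iota> (F (x i j)) = x i j * \<iota> s" for i j
    using F[OF range_eqI[of _ _ "(i, j)"], of "x i j"] by simp
  have "\<iota> s dvd 1" using loc s by (simp add: is_localization_def)
  then obtain v where v: "\<iota> s * v = 1" by (metis dvdE)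
  have zero: "\<exists>s'. lines_origin s' \<noteq> 0 \<and> s' * y = 0" if "\<iota> y = 0" for y
    using loc that unfolding is_localization_def by blast
  have Fsym: "F (x i j) = F (x j i)" for i j by (simp only: sym[of i j])
  have Feq: "\<exists>s'. lines_origin s' \<noteq> 0 \<and>
      s' * (lines_coord k * (F (x i j) - F (x i l) - s * lines_const (\<sigma> i j k - \<sigma> i l k))
        - lines_coord i * (F (x j k) - F (x l k) - s * lines_const (\<sigma> i j k - \<sigma> i l k))) = 0"
    if d: "distinct [i, j, k, l]" for i j k l
  proof (rule zero)
    have "\<iota> (lines_coord k * (F (x i j) - F (x i l) - s * lines_const (\<sigma> i j k - \<sigma> i l k))
        - lines_coord i * (F (x j k) - F (x l k) - s * lines_const (\<sigma> i j k - \<sigma> i l k)))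
      = \<iota> s * (\<iota> (lines_coord k) * (x i j - x i l - \<iota> (lines_const (\<sigma> i j k - \<sigma> i l k)))
        - \<iota> (lines_coord i) * (x j k - x l k - \<iota> (lines_const (\<sigma> i j k - \<sigma> i l k))))"
      by (simp only: hs F algebra_simps)
    then show "\<iota> (lines_coord k * (F (x i j) - F (x i l) - s * lines_const (\<sigma> i j k - \<sigma> i l k))
        - lines_coord i * (F (x j k) - F (x l k) - s * lines_const (\<sigma> i j k - \<sigma> i l k))) = 0"
      unfolding eq[OF d] by simp
  qed
  obtain \<omega> \<zeta> \<alpha> \<gamma> where 1: "\<And>i j. \<alpha> i j + \<alpha> j i = 0"
    "\<And>i j k. distinct [i, j, k] \<Longrightarrow> \<sigma> i j k = \<gamma> i + \<gamma> j + \<gamma> k"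
    and 2: "\<And>i j. i \<noteq> j \<Longrightarrow> F (x i j) = \<omega> + \<zeta> i * lines_coord j + lines_coord i * \<zeta> j
       + s * (lines_const (\<alpha> i j) * (lines_coord i - lines_coord j) + lines_const (\<gamma> i + \<gamma> j))"
    by (rule lines_solver[of s "\<lambda>i j. F (x i j)", OF n s Fsym \<sigma> Feq])
      (assumption | (rule that; assumption))+
  show ?thesis
  proof (rule that[of \<alpha> \<gamma> "\<iota> \<omega> * v" "\<lambda>i. \<iota> (\<zeta> i) * v", OF 1])
    fix i j :: 'n assume ij: "i \<noteq> j"
    have "x i j = x i j * \<iota> s * v" using v by (simp add: mult.assoc)
    also have "\<dots> = \<iota> (F (x i j)) * v" by (simp only: F)
    also have "\<dots> = \<iota> \<omega> * v + \<iota> (\<zeta> i) * v * \<iota> (lines_coord j) + \<iota> (lines_coord i) * (\<iota> (\<zeta> j) * v)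
       + \<iota> s * v * (\<iota> (lines_const (\<alpha> i j)) * (\<iota> (lines_coord i) - \<iota> (lines_coord j))
         + \<iota> (lines_const (\<gamma> i + \<gamma> j)))"
      unfolding 2[OF ij] by (simp add: hs algebra_simps)
    finally show "x i j = \<iota> \<omega> * v + \<iota> (\<zeta> i) * v * \<iota> (lines_coord j) + \<iota> (lines_coord i) * (\<iota> (\<zeta> j) * v)
       + \<iota> (lines_const (\<alpha> i j)) * (\<iota> (lines_coord i) - \<iota> (lines_coord j)) + \<iota> (lines_const (\<gamma> i + \<gamma> j))"
      by (simp add: v add.assoc)
  qed
qed

subsection \<open>Lifting solutions over small extensions\<close>

text \<open>The quadratic equations of \<open>split_params\<close> and \<open>product_form\<close>
  are imposed modulo J, whereas antisymmetry of \<open>a\<close> and the behaviour on the special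
  fibre hold exactly at every stage.\<close>

definition approx_solution ::
    "(('k::field, 'n::finite) lines_ring \<Rightarrow> 'x::comm_ring_1) \<Rightarrow> ('a::comm_ring_1 \<Rightarrow> 'k) \<Rightarrow>
     ('a \<Rightarrow> 'r::comm_ring_1) \<Rightarrow> ('r \<Rightarrow> 'x) \<Rightarrow> 'a set \<Rightarrow> ('n \<Rightarrow> 'r) \<Rightarrow> ('n \<Rightarrow> 'n \<Rightarrow> 'a) \<Rightarrow> ('n \<Rightarrow> 'a) \<Rightarrow> 'r \<Rightarrow> bool" where
  "approx_solution \<iota> \<rho> \<phi> \<pi> J z a c W \<longleftrightarrow>
     (\<forall>i j. a i j + a j i = 0) \<and> (\<forall>i j. \<rho> (a i j) = 0) \<and> (\<forall>i. \<pi> (z i) = \<iota> (lines_coord i)) \<and>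
     (\<forall>i j k. distinct [i, j, k] \<longrightarrow> a i j * a i k + a j i * a j k + a k i * a k j - c i - c j - c k \<in> J) \<and>
     (\<forall>i j. i \<noteq> j \<longrightarrow> z i * z j + \<phi> (a i j) * (z i - z j) - \<phi> (c i) - \<phi> (c j) - W \<in> ideal_gen (\<phi> ` J))"

lemma approx_solutionD:
  assumes "approx_solution \<iota> \<rho> \<phi> \<pi> J z a c W"
  shows "a j i = - a i j" "\<rho> (a i j) = 0" "\<pi> (z i) = \<iota> (lines_coord i)"
    "distinct [i, j, k] \<Longrightarrow> a i j * a i k + a j i * a j k + a k i * a k j - c i - c j - c k \<in> J"
    "i \<noteq> j \<Longrightarrow> z i * z j + \<phi> (a i j) * (z i - z j) - \<phi> (c i) - \<phi> (c j) - W \<in> ideal_gen (\<phi> ` J)"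
proof -
  have "a j i + a i j = 0" using assms by (simp add: approx_solution_def)
  then show "a j i = - a i j" by (simp add: eq_neg_iff_add_eq_0)
qed (use assms in \<open>simp_all add: approx_solution_def\<close>)

text \<open>The computation of \<open>edge_identity\<close> with the errors of the triple relations
  kept. Every error is multiplied by some a_ij from the maximal ideal, which improves J to
  J'.\<close>

lemma edge_defect:
  fixes a12 a13 a14 a23 a24 a34 c1 c2 c3 c4 :: "'a::comm_ring_1"
  defines "t123 \<equiv> a12 * a13 - a12 * a23 + a13 * a23 - c1 - c2 - c3"
    and "t124 \<equiv> a12 * a14 - a12 * a24 + a14 * a24 - c1 - c2 - c4"
    and "t134 \<equiv> a13 * a14 - a13 * a34 + a14 * a34 - c1 - c3 - c4"
    and "t234 \<equiv> a23 * a24 - a23 * a34 + a24 * a34 - c2 - c3 - c4"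
  shows "a12 * (c1 - c2) + a34 * (c3 - c4) - a13 * (c1 - c3) - a24 * (c2 - c4)
    = - a12 * (t134 - t234) - a34 * (t123 - t124) + a13 * (t124 - t234) + a24 * (t123 - t134)"
  unfolding assms by (simp add: algebra_simps)

lemma ideal_gen_image_mult:
  assumes \<phi>: "is_ring_hom \<phi>" and c: "colength_one \<eta> \<rho> J' J e"
    and a: "\<rho> a = 0" and x: "x \<in> ideal_gen (\<phi> ` J)"
  shows "\<phi> a * x \<in> ideal_gen (\<phi> ` J')"
  using x
proof (induction rule: ideal_gen_induct)
  case (scale b g)
  then obtain j where j: "j \<in> J" "g = \<phi> j" by blast
  have "b * \<phi> (a * j) \<in> ideal_gen (\<phi> ` J')"
    using colength_oneD(7)[OF c a j(1)] by (intro ideal_gen_mult ideal_gen_base imageI)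
  then show ?case by (simp add: ring_hom_simps[OF \<phi>] j mult_ac)
qed (simp_all add: ideal_gen_0 ideal_gen_add distrib_left)

context
  fixes \<iota> :: "('k::field_char_0, 'n::finite) lines_ring \<Rightarrow> 'x::comm_ring_1"
    and \<eta> :: "'k \<Rightarrow> 'a::comm_ring_1" and \<rho> and \<phi> :: "'a \<Rightarrow> 'r::comm_ring_1" and \<pi>
  assumes n: "CARD('n) \<ge> 4" and loc: "is_localization \<iota> {f. lines_origin f \<noteq> 0}"
    and A: "local_artinian \<eta> \<rho>" and d: "deformation (\<iota> \<circ> lines_const) \<eta> \<rho> \<phi> \<pi>"
begin

lemma approx_solution_edge:
  assumes c: "colength_one \<eta> \<rho> J' J e"
    and s: "approx_solution \<iota> \<rho> \<phi> \<pi> J z a c W" and dist: "distinct [i, j, k, l]"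
  shows "a i j * (c i - c j) - a j k * (c j - c k) - a i l * (c i - c l) + a l k * (c l - c k) \<in> J'"
proof -
  note S = approx_solutionD[OF s] and C = colength_oneD[OF c]
  note I = is_ideal_ops[OF C(1)] and IJ = is_ideal_ops[OF C(2)]
  let ?t = "\<lambda>i j k. a i j * a i k - a i j * a j k + a i k * a j k - c i - c j - c k"
  have t: "?t i j k \<in> J" if "distinct [i, j, k]" for i j k
    using S(4)[OF that] by (simp add: S(1)[of j i] S(1)[of k i] S(1)[of k j])
  have dd: "distinct [i, j, l]" "distinct [i, j, k]" "distinct [i, l, k]" "distinct [j, l, k]" using dist by auto
  note T = dd[THEN t]
  have "- a i j * (?t i l k - ?t j l k) - a l k * (?t i j l - ?t i j k) + a i l * (?t i j k - ?t j l k)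
      + a j k * (?t i j l - ?t i l k) \<in> J'"
    unfolding mult_minus_left by (intro I(2) I(3) I(4) C(7) S(2) IJ(3) T)
  then have "a i j * (c i - c j) + a l k * (c l - c k) - a i l * (c i - c l) - a j k * (c j - c k) \<in> J'"
    by (subst edge_defect[where ?a14.0 = "a i k" and ?a23.0 = "a j l"])
  then show ?thesis by (simp add: algebra_simps)
qed

text \<open>The obstruction to correcting the errors. Both expansions of a triple product are
  compared for (i, j, k) and for (i, l, k); in the difference W cancels and the edge terms fall into
  J'. The remaining relation is a multiple of \<open>e\<close>, and flatness moves it to the special
  fibre.\<close>

lemma approx_solution_constraint:
  assumes c: "colength_one \<eta> \<rho> J' J e" and s: "approx_solution \<iota> \<rho> \<phi> \<pi> J z a c W"
    and E: "\<And>i j. i \<noteq> j \<Longrightarrow>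
      z i * z j + \<phi> (a i j) * (z i - z j) - \<phi> (c i) - \<phi> (c j) - W - \<phi> e * E i j \<in> ideal_gen (\<phi> ` J')"
    and t: "\<And>i j k. distinct [i, j, k] \<Longrightarrow>
      a i j * a i k + a j i * a j k + a k i * a k j - c i - c j - c k - \<eta> (\<sigma> i j k) * e \<in> J'"
    and dist: "distinct [i, j, k, l]"
  shows "\<iota> (lines_coord k) * (\<pi> (E i j) - \<pi> (E i l) - \<iota> (lines_const (\<sigma> i j k - \<sigma> i l k)))
        = \<iota> (lines_coord i) * (\<pi> (E j k) - \<pi> (E l k) - \<iota> (lines_const (\<sigma> i j k - \<sigma> i l k)))"
proof -
  note S = approx_solutionD[OF s] and C = colength_oneD[OF c] and D = deformationD[OF d]
  note hs = ring_hom_simps[OF D(1)] ring_hom_simps[OF D(4)] ring_hom_simps[OF D(5)]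
  let ?I = "ideal_gen (\<phi> ` J')"
  define \<epsilon> where "\<epsilon> i j = z i * z j + \<phi> (a i j) * (z i - z j) - \<phi> (c i) - \<phi> (c j) - W" for i j
  define \<tau> where "\<tau> i j k = a i j * a i k + a j i * a j k + a k i * a k j - c i - c j - c k" for i j k
  have zz: "z i * z j = W + \<phi> (c i) + \<phi> (c j) - \<phi> (a i j) * (z i - z j) + \<epsilon> i j" for i j
    by (simp add: \<epsilon>_def)
  have \<epsilon>J: "\<phi> b * (\<epsilon> i j - \<epsilon> k l) \<in> ?I" if "\<rho> b = 0" "i \<noteq> j" "k \<noteq> l" for b i j k l
    by (rule ideal_gen_image_mult[OF D(4) c that(1)])
      (intro ideal_gen_diff; use S(5)[OF that(2)] S(5)[OF that(3)] in \<open>simp add: \<epsilon>_def\<close>)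
  have assoc: "z k * (W - \<phi> (c k) - \<phi> (\<tau> i j k) + \<epsilon> i j) - \<phi> (a i j * (c i - c j))
     - (z i * (W - \<phi> (c i) - \<phi> (\<tau> i j k) + \<epsilon> j k) - \<phi> (a j k * (c j - c k))) \<in> ?I"
    if "distinct [i, j, k]" for i j k
  proof -
    have "\<phi> (a i j) * (\<epsilon> i k - \<epsilon> j k) + \<phi> (a j k) * (\<epsilon> i k - \<epsilon> i j) \<in> ?I"
      by (intro ideal_gen_add \<epsilon>J S(2)) (use that in auto)
    moreover have "\<phi> (a i j) * \<phi> (a i k) - \<phi> (a i j) * \<phi> (a j k) + \<phi> (a i k) * \<phi> (a j k)
        - \<phi> (c i) - \<phi> (c j) - \<phi> (c k) = \<phi> (\<tau> i j k)"
      by (simp add: \<tau>_def S(1)[of j i] S(1)[of k i] S(1)[of k j] hs)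
    ultimately show ?thesis
      using associativity_defect[OF zz[of i j] zz[of j k] zz[of i k]] by (simp add: hs)
  qed
  have "distinct [i, j, k]" "distinct [i, l, k]" using dist by auto
  note as = this[THEN assoc]
  have q: "\<phi> (a i j * (c i - c j) - a j k * (c j - c k) - a i l * (c i - c l) + a l k * (c l - c k)) \<in> ?I"
    using approx_solution_edge[OF c s dist] by (intro ideal_gen_base imageI)
  have "z k * (\<epsilon> i j - \<epsilon> i l - \<phi> (\<tau> i j k - \<tau> i l k)) - z i * (\<epsilon> j k - \<epsilon> l k - \<phi> (\<tau> i j k - \<tau> i l k)) \<in> ?I"
    using ideal_gen_add[OF ideal_gen_diff[OF as] q] by (simp add: hs algebra_simps)
  moreover have e: "\<epsilon> i j - \<phi> e * E i j \<in> ?I" if "i \<noteq> j" for i j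
    using E[OF that] by (simp add: \<epsilon>_def)
  have tt: "\<phi> (\<tau> i j k - \<eta> (\<sigma> i j k) * e) \<in> ?I" if "distinct [i, j, k]" for i j k
    using t[OF that] by (intro ideal_gen_base imageI) (simp add: \<tau>_def)
  \<comment> \<open>\<open>Y\<close> and \<open>Z\<close> collect the errors of replacing \<epsilon>
    by e E and \<tau> by \<sigma> e; they vanish modulo J' R.\<close>
  define Y where "Y = (\<epsilon> i j - \<phi> e * E i j) - (\<epsilon> i l - \<phi> e * E i l)
    - (\<phi> (\<tau> i j k - \<eta> (\<sigma> i j k) * e) - \<phi> (\<tau> i l k - \<eta> (\<sigma> i l k) * e))"
  define Z where "Z = (\<epsilon> j k - \<phi> e * E j k) - (\<epsilon> l k - \<phi> e * E l k)
    - (\<phi> (\<tau> i j k - \<eta> (\<sigma> i j k) * e) - \<phi> (\<tau> i l k - \<eta> (\<sigma> i l k) * e))"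
  have "z k * Y - z i * Z \<in> ?I"
    unfolding Y_def Z_def by (intro ideal_gen_diff ideal_gen_mult e tt) (use dist in auto)
  ultimately have "(z k * (\<epsilon> i j - \<epsilon> i l - \<phi> (\<tau> i j k - \<tau> i l k))
      - z i * (\<epsilon> j k - \<epsilon> l k - \<phi> (\<tau> i j k - \<tau> i l k))) - (z k * Y - z i * Z) \<in> ?I"
    by (rule ideal_gen_diff)
  moreover have "(z k * (\<epsilon> i j - \<epsilon> i l - \<phi> (\<tau> i j k - \<tau> i l k))
      - z i * (\<epsilon> j k - \<epsilon> l k - \<phi> (\<tau> i j k - \<tau> i l k))) - (z k * Y - z i * Z)
    = \<phi> e * (z k * (E i j - E i l - \<phi> (\<eta> (\<sigma> i j k - \<sigma> i l k)))
        - z i * (E j k - E l k - \<phi> (\<eta> (\<sigma> i j k - \<sigma> i l k))))"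
    unfolding Y_def Z_def by (simp add: hs algebra_simps)
  ultimately have "\<phi> e * (z k * (E i j - E i l - \<phi> (\<eta> (\<sigma> i j k - \<sigma> i l k)))
        - z i * (E j k - E l k - \<phi> (\<eta> (\<sigma> i j k - \<sigma> i l k)))) \<in> ?I" by simp
  from flat_colength_one[OF d c this] show ?thesis
    by (simp only: hs S(3) D(7) D(3) o_apply right_minus_eq ring_hom_simps(6)[OF D(6), unfolded o_apply])
qed

text \<open>Moving (a, c, z, W) by multiples of \<open>e\<close> changes the errors, modulo J', by
  the linear expression of \<open>localized_solver\<close>, since e^2 and a_ij e lie in J'. The
  constraint just established is its solvability condition.\<close>

lemma approx_solution_step:
  assumes c: "colength_one \<eta> \<rho> J' J e" and J: "J \<subseteq> {x. \<rho> x = 0}"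
    and s: "approx_solution \<iota> \<rho> \<phi> \<pi> J z a c W"
  obtains z' a' c' W' where "approx_solution \<iota> \<rho> \<phi> \<pi> J' z' a' c' W'"
    "\<And>i j. a' i j - a i j \<in> J" "\<And>i. z' i - z i \<in> ideal_gen (\<phi> ` J)"
proof -
  note S = approx_solutionD[OF s] and C = colength_oneD[OF c] and D = deformationD[OF d]
  note hs = ring_hom_simps[OF D(1)] ring_hom_simps[OF D(2)] ring_hom_simps[OF D(4)] ring_hom_simps[OF D(5)]
  note I = is_ideal_ops[OF C(1)] and IJ = is_ideal_ops[OF C(2)]
  let ?I = "ideal_gen (\<phi> ` J')"
  define \<epsilon> where "\<epsilon> i j = z i * z j + \<phi> (a i j) * (z i - z j) - \<phi> (c i) - \<phi> (c j) - W" for i j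
  define \<tau> where "\<tau> i j k = a i j * a i k + a j i * a j k + a k i * a k j - c i - c j - c k" for i j k
  have \<rho>e: "\<rho> e = 0" using C(4) J by blast
  \<comment> \<open>Choosing the quotients as functions of the symmetric values keeps them symmetric.\<close>
  have "\<forall>v\<in>ideal_gen (\<phi> ` J). \<exists>r. v - \<phi> e * r \<in> ?I"
    by (rule ballI, rule colength_one_decomp[OF D(4) c], assumption) blast
  then have "\<exists>G. \<forall>v\<in>ideal_gen (\<phi> ` J). v - \<phi> e * G v \<in> ?I" by (rule bchoice)
  then obtain G where G: "\<And>v. v \<in> ideal_gen (\<phi> ` J) \<Longrightarrow> v - \<phi> e * G v \<in> ?I" by blast
  have "\<exists>H. \<forall>v\<in>J. v - \<eta> (H v) * e \<in> J'" by (rule bchoice, rule ballI, rule C(6))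
  then obtain H where H: "\<And>v. v \<in> J \<Longrightarrow> v - \<eta> (H v) * e \<in> J'" by blast
  define E where "E i j = G (\<epsilon> i j)" for i j
  define \<sigma> where "\<sigma> i j k = H (\<tau> i j k)" for i j k
  have E: "\<epsilon> i j - \<phi> e * E i j \<in> ?I" if "i \<noteq> j" for i j
    unfolding E_def by (rule G) (use S(5)[OF that] in \<open>simp add: \<epsilon>_def\<close>)
  have \<sigma>: "\<tau> i j k - \<eta> (\<sigma> i j k) * e \<in> J'" if "distinct [i, j, k]" for i j k
    unfolding \<sigma>_def by (rule H) (use S(4)[OF that] in \<open>simp add: \<tau>_def\<close>)
  have "\<epsilon> i j = \<epsilon> j i" for i j by (simp add: \<epsilon>_def S(1)[of j i] hs algebra_simps)
  then have sym: "\<pi> (E i j) = \<pi> (E j i)" for i j by (simp add: E_def)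
  have "\<tau> i j k = \<tau> j i k" "\<tau> i j k = \<tau> i k j" for i j k by (simp_all add: \<tau>_def algebra_simps)
  then have \<sigma>sym: "\<sigma> i j k = \<sigma> j i k" "\<sigma> i j k = \<sigma> i k j" for i j k by (simp_all add: \<sigma>_def)
  have con: "\<iota> (lines_coord k) * (\<pi> (E i j) - \<pi> (E i l) - \<iota> (lines_const (\<sigma> i j k - \<sigma> i l k)))
        = \<iota> (lines_coord i) * (\<pi> (E j k) - \<pi> (E l k) - \<iota> (lines_const (\<sigma> i j k - \<sigma> i l k)))"
    if "distinct [i, j, k, l]" for i j k l
    by (rule approx_solution_constraint[OF c s E[unfolded \<epsilon>_def] \<sigma>[unfolded \<tau>_def] that])
  obtain \<omega> \<zeta> \<alpha> \<gamma> where \<alpha>: "\<And>i j. \<alpha> i j + \<alpha> j i = 0"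
    and \<gamma>: "\<And>i j k. distinct [i, j, k] \<Longrightarrow> \<sigma> i j k = \<gamma> i + \<gamma> j + \<gamma> k"
    and sol: "\<And>i j. i \<noteq> j \<Longrightarrow> \<pi> (E i j) = \<omega> + \<zeta> i * \<iota> (lines_coord j) + \<iota> (lines_coord i) * \<zeta> j
       + \<iota> (lines_const (\<alpha> i j)) * (\<iota> (lines_coord i) - \<iota> (lines_coord j)) + \<iota> (lines_const (\<gamma> i + \<gamma> j))"
    by (rule localized_solver[where x = "\<lambda>i j. \<pi> (E i j)", OF n loc sym \<sigma>sym con])
      (assumption | (rule that; assumption))+
  obtain w where w: "\<pi> w = \<omega>" using D(9) by blast
  have "\<exists>y. \<forall>i. \<pi> (y i) = \<zeta> i" by (rule choice, rule allI, rule D(9))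
  then obtain y where y: "\<And>i. \<pi> (y i) = \<zeta> i" by blast
  define a' where "a' i j = a i j - \<eta> (\<alpha> i j) * e" for i j
  define c' where "c' i = c i + \<eta> (\<gamma> i) * e" for i
  define z' where "z' i = z i - \<phi> e * y i" for i
  define W' where "W' = W + \<phi> e * w"
  have aJ: "a' i j - a i j \<in> J" for i j by (simp add: a'_def IJ C(4))
  have zJ: "z' i - z i \<in> ideal_gen (\<phi> ` J)" for i
    by (simp add: z'_def ideal_gen_uminus ideal_gen_mult2 ideal_gen_base C(4))
  have anti': "a' i j + a' j i = 0" for i j
  proof -
    have "a' i j + a' j i = - (\<eta> (\<alpha> i j + \<alpha> j i) * e)"
      by (simp add: a'_def S(1)[of j i] hs algebra_simps)
    then show ?thesis by (simp add: \<alpha> hs)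
  qed
  have \<tau>': "a' i j * a' i k + a' j i * a' j k + a' k i * a' k j - c' i - c' j - c' k \<in> J'"
    if ijk: "distinct [i, j, k]" for i j k
  proof -
    have prod: "a' p q * a' r s - a p q * a r s \<in> J'" for p q r s
    proof -
      have "\<rho> (a' p q) = 0" "\<rho> (a r s) = 0" by (simp_all add: a'_def hs S(2) \<rho>e)
      then have "a' p q * (a' r s - a r s) + a r s * (a' p q - a p q) \<in> J'"
        by (intro I(2) C(7) aJ)
      then show ?thesis by (simp add: algebra_simps)
    qed
    have "(a' i j * a' i k - a i j * a i k) + (a' j i * a' j k - a j i * a j k)
      + (a' k i * a' k j - a k i * a k j) + (\<tau> i j k - \<eta> (\<sigma> i j k) * e) \<in> J'"
      by (intro I(2) prod \<sigma> ijk)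
    then show ?thesis by (simp add: \<tau>_def \<gamma>[OF ijk] c'_def hs algebra_simps)
  qed
  have \<epsilon>': "z' i * z' j + \<phi> (a' i j) * (z' i - z' j) - \<phi> (c' i) - \<phi> (c' j) - W' \<in> ?I"
    if ij: "i \<noteq> j" for i j
  proof -
    \<comment> \<open>The part of the new error that is linear in \<open>e\<close>; it vanishes on
      the special fibre by the choice of \<omega>, \<zeta>, \<alpha>, \<gamma>.\<close>
    let ?B = "E i j - (w + y i * z j + z i * y j + \<phi> (\<eta> (\<alpha> i j)) * (z i - z j) + \<phi> (\<eta> (\<gamma> i + \<gamma> j)))"
    have "\<pi> ?B = 0"
      by (simp only: hs sol[OF ij] w y S(3) D(7) D(3) o_apply ring_hom_simps(3)[OF D(6), unfolded o_apply]) simp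
    then have "?B \<in> ideal_gen (\<phi> ` {x. \<rho> x = 0})" by (rule D(10))
    then have B: "\<phi> e * ?B \<in> ?I" by (rule colength_one_mult[OF D(4) c C(4)])
    have ee: "\<phi> (e * e) * x \<in> ?I" "\<phi> (a i j * e) * x \<in> ?I" for x
      by (intro ideal_gen_mult2 ideal_gen_base imageI C(7) \<rho>e S(2) C(4))+
    have "(\<epsilon> i j - \<phi> e * E i j) + \<phi> e * ?B + \<phi> (e * e) * (y i * y j + \<phi> (\<eta> (\<alpha> i j)) * (y i - y j))
      - \<phi> (a i j * e) * (y i - y j) \<in> ?I"
      by (intro ideal_gen_diff[OF ideal_gen_add[OF ideal_gen_add]] E ij B ee)
    moreover have "(\<epsilon> i j - \<phi> e * E i j) + \<phi> e * ?B + \<phi> (e * e) * (y i * y j + \<phi> (\<eta> (\<alpha> i j)) * (y i - y j))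
      - \<phi> (a i j * e) * (y i - y j)
      = z' i * z' j + \<phi> (a' i j) * (z' i - z' j) - \<phi> (c' i) - \<phi> (c' j) - W'"
      by (simp add: \<epsilon>_def z'_def a'_def c'_def W'_def hs algebra_simps)
    ultimately show ?thesis by simp
  qed
  have "approx_solution \<iota> \<rho> \<phi> \<pi> J' z' a' c' W'"
    unfolding approx_solution_def
  proof (intro conjI allI impI)
    show "\<rho> (a' i j) = 0" for i j by (simp add: a'_def hs S(2) \<rho>e)
    show "\<pi> (z' i) = \<iota> (lines_coord i)" for i
    proof -
      have "\<pi> (\<phi> e) = 0" using D(7)[of e] unfolding \<rho>e ring_hom_simps(1)[OF D(6)] .
      then show ?thesis by (simp add: z'_def hs S(3))
    qed
  qed (use anti' \<tau>' \<epsilon>' in auto)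
  then show ?thesis using aJ zJ by (rule that)
qed

text \<open>Iterates the correction from K down to 0. The congruences modulo K are what makes the
  lifted parameters induce a lift of a given homomorphism in \<open>pullback_smooth\<close>.\<close>

lemma solution_lift:
  assumes K: "is_ideal K" "K \<subseteq> {x. \<rho> x = 0}" and s: "approx_solution \<iota> \<rho> \<phi> \<pi> K z0 a0 c0 W0"
  obtains z a c W where "split_params a c" "product_form (\<lambda>i j. \<phi> (a i j)) (\<lambda>i. \<phi> (c i)) z W"
    "\<And>i j. \<rho> (a i j) = 0" "\<And>i. \<pi> (z i) = \<iota> (lines_coord i)"
    "\<And>i j. a i j - a0 i j \<in> K" "\<And>i. z i - z0 i \<in> ideal_gen (\<phi> ` K)"
proof -
  note D = deformationD[OF d]
  note IK = is_ideal_ops[OF K(1)]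
  from A K(1) have "\<exists>z a c W. approx_solution \<iota> \<rho> \<phi> \<pi> {0} z a c W \<and> (\<forall>i j. a i j - a0 i j \<in> K) \<and>
    (\<forall>i. z i - z0 i \<in> ideal_gen (\<phi> ` K))"
  proof (induction rule: artinian_ideal_induct)
    case start
    show ?case
      by (intro exI[of _ z0] exI[of _ a0] exI[of _ c0] exI[of _ W0]) (simp add: s IK ideal_gen_0)
  next
    case (step J J' e)
    then obtain z a c W where z: "approx_solution \<iota> \<rho> \<phi> \<pi> J z a c W"
      and a: "\<And>i j. a i j - a0 i j \<in> K" and zK: "\<And>i. z i - z0 i \<in> ideal_gen (\<phi> ` K)" by blast
    have J: "J \<subseteq> {x. \<rho> x = 0}" using step(1) K(2) by blast
    obtain z' a' c' W' where z': "approx_solution \<iota> \<rho> \<phi> \<pi> J' z' a' c' W'"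
      "\<And>i j. a' i j - a i j \<in> J" "\<And>i. z' i - z i \<in> ideal_gen (\<phi> ` J)"
      using approx_solution_step[OF step(2) J z] by blast
    have "(a' i j - a i j) + (a i j - a0 i j) \<in> K" for i j
      using z'(2) a step(1) by (intro IK(2)) blast+
    then have 1: "a' i j - a0 i j \<in> K" for i j by simp
    have "ideal_gen (\<phi> ` J) \<subseteq> ideal_gen (\<phi> ` K)" using step(1) by (intro ideal_gen_mono image_mono)
    then have "(z' i - z i) + (z i - z0 i) \<in> ideal_gen (\<phi> ` K)" for i
      using z'(3) zK by (intro ideal_gen_add) blast+
    then have 2: "z' i - z0 i \<in> ideal_gen (\<phi> ` K)" for i by simp
    show ?case using z'(1) 1 2 by blast
  qed
  then obtain z a c W where z: "approx_solution \<iota> \<rho> \<phi> \<pi> {0} z a c W"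
    and aK: "\<And>i j. a i j - a0 i j \<in> K" and zK: "\<And>i. z i - z0 i \<in> ideal_gen (\<phi> ` K)" by blast
  note S = approx_solutionD[OF z]
  have "split_params a c"
    unfolding split_params_def
  proof (intro conjI allI impI)
    show "a i j + a j i = 0" for i j by (simp add: S(1)[of j i])
    show "a i j * a i k + a j i * a j k + a k i * a k j = c i + c j + c k" if "distinct [i, j, k]" for i j k
      using S(4)[OF that] by (simp add: algebra_simps)
  qed
  moreover have "product_form (\<lambda>i j. \<phi> (a i j)) (\<lambda>i. \<phi> (c i)) z W"
    unfolding product_form_def
  proof (intro allI impI)
    fix i j :: 'n assume "i \<noteq> j"
    from S(5)[OF this] show "z i * z j = W + \<phi> (c i) + \<phi> (c j) - \<phi> (a i j) * (z i - z j)"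
      by (simp add: ring_hom_simps[OF D(4)] ideal_gen_singleton_0 algebra_simps)
  qed
  ultimately show ?thesis using S(2,3) aK zK by (rule that)
qed

end

subsection \<open>The special fibre and localization at the origin\<close>

lemma cancel_unit: "u dvd 1 \<Longrightarrow> u * x = 0 \<Longrightarrow> x = (0 :: 'a::comm_ring_1)"
  by (metis dvdE mult.assoc mult.commute mult_1 mult_zero_left)

text \<open>The universal property, derived from the elementwise description of localizations by
  choosing a fraction for each element.\<close>

lemma localization_hom_exists:
  fixes \<iota> :: "'a::comm_ring_1 \<Rightarrow> 'b::comm_ring_1" and g :: "'a \<Rightarrow> 'c::comm_ring_1"
  assumes loc: "is_localization \<iota> M" and M: "1 \<in> M" "\<And>x y. x \<in> M \<Longrightarrow> y \<in> M \<Longrightarrow> x * y \<in> M"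
    and g: "is_ring_hom g" "\<And>s. s \<in> M \<Longrightarrow> g s dvd 1"
  obtains h where "is_ring_hom h" "\<And>x. h (\<iota> x) = g x"
proof -
  have \<iota>: "is_ring_hom \<iota>" using loc by (simp add: is_localization_def)
  note hs = ring_hom_simps[OF \<iota>] ring_hom_simps[OF g(1)]
  \<comment> \<open>\<open>Q y z x s\<close> says that y is the fraction x / s and that z is the
    corresponding value g(x) / g(s).\<close>
  define Q where "Q y z x s \<longleftrightarrow> s \<in> M \<and> y * \<iota> s = \<iota> x \<and> z * g s = g x" for y z x s
  have uniq: "z = z'" if "Q y z x s" "Q y z' x' s'" for y z x s z' x' s'
  proof -
    have "\<iota> (x * s' - x' * s) = (y * \<iota> s) * \<iota> s' - (y * \<iota> s') * \<iota> s"
      using that by (simp add: Q_def hs)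
    then have "\<iota> (x * s' - x' * s) = 0" by (simp add: mult_ac)
    then obtain t where t: "t \<in> M" "t * (x * s' - x' * s) = 0"
      using loc unfolding is_localization_def by blast
    have "g t * (g x * g s' - g x' * g s) = 0" using arg_cong[OF t(2), of g] by (simp add: hs)
    then have "g x * g s' - g x' * g s = 0" by (rule cancel_unit[OF g(2)[OF t(1)]])
    moreover have "g x * g s' - g x' * g s = (g s * g s') * (z - z')"
      using that by (simp add: Q_def algebra_simps flip: mult.assoc)
    ultimately have "g s * (g s' * (z - z')) = 0" by (simp add: mult.assoc)
    then have "z - z' = 0" using that g(2) cancel_unit by (metis Q_def)
    then show ?thesis by simp
  qed
  have ex: "\<exists>z x s. Q y z x s" for y
  proof -
    obtain x s where s: "s \<in> M" "y * \<iota> s = \<iota> x" using loc unfolding is_localization_def by blast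
    obtain v where "1 = g s * v" using g(2)[OF s(1)] by (rule dvdE)
    then have "(g x * v) * g s = g x" by (metis mult.assoc mult.commute mult.right_neutral)
    then show ?thesis using s unfolding Q_def by blast
  qed
  define h where "h y = (SOME z. \<exists>x s. Q y z x s)" for y
  have h1: "\<exists>x s. Q y (h y) x s" for y unfolding h_def using ex[of y] by (rule someI_ex)
  have h2: "h y = z" if "Q y z x s" for y z x s
    using h1[of y] uniq that by blast
  have "Q (\<iota> x) (g x) x 1" for x by (simp add: Q_def M hs)
  then have hi: "h (\<iota> x) = g x" for x by (rule h2)
  have "is_ring_hom h"
    unfolding is_ring_hom_def
  proof (intro conjI allI)
    show "h 1 = 1" using hi[of 1] by (simp add: hs)
    fix y y'
    obtain x s x' s' where q: "Q y (h y) x s" "Q y' (h y') x' s'" using h1 by meson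
    have e: "y * \<iota> s = \<iota> x" "h y * g s = g x" "y' * \<iota> s' = \<iota> x'" "h y' * g s' = g x'"
      and ss: "s * s' \<in> M" using q M(2) by (simp_all add: Q_def)
    have "(y + y') * (\<iota> s * \<iota> s') = (y * \<iota> s) * \<iota> s' + (y' * \<iota> s') * \<iota> s"
      "(h y + h y') * (g s * g s') = (h y * g s) * g s' + (h y' * g s') * g s" by (simp_all add: algebra_simps)
    then have "Q (y + y') (h y + h y') (x * s' + x' * s) (s * s')"
      unfolding e using ss by (simp add: Q_def hs)
    then show "h (y + y') = h y + h y'" by (rule h2)
    have "(y * y') * (\<iota> s * \<iota> s') = (y * \<iota> s) * (y' * \<iota> s')"
      "(h y * h y') * (g s * g s') = (h y * g s) * (h y' * g s')" by (simp_all add: mult_ac)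
    then have "Q (y * y') (h y * h y') (x * x') (s * s')"
      unfolding e using ss by (simp add: Q_def hs)
    then show "h (y * y') = h y * h y'" by (rule h2)
  qed
  then show ?thesis using hi by (rule that)
qed

lemma total_to_lines_surj: "\<exists>x. total_to_lines x = f"
proof (induction f rule: lines_ring_induct)
  case (const c)
  have "total_to_lines (base_to_total (base_const c)) = lines_const c" by (simp add: total_to_lines)
  then show ?case by blast
next
  case (coord i)
  show ?case using total_to_lines(3) by blast
next
  case (add x y)
  then show ?case using ring_hom_simps(3)[OF total_to_lines(1)] by metis
next
  case (mult x y)
  then show ?case using ring_hom_simps(4)[OF total_to_lines(1)] by metis
qed

lemma coeff_X_power: "coeff ([:0, 1:] ^ m) k = (if k = m then 1 else (0 :: 'a::comm_ring_1))"
  by (metis coeff_monom monom_altdef smult_1_left)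

context
  fixes c :: "'n::finite \<Rightarrow> ('k::field, 'n) base_ring" and W :: "('k, 'n) total_ring"
  assumes n: "CARD('n) \<ge> 4" and split: "split_params base_param c" and c0: "\<And>i. base_origin (c i) = 0"
    and W: "product_form (\<lambda>i j. base_to_total (base_param i j)) (\<lambda>i. base_to_total (c i)) total_coord W"
begin

lemma total_to_lines_W:
  assumes "i \<noteq> j"
  shows "total_to_lines W = lines_coord i * lines_coord j"
  using arg_cong[OF product_formD[OF W assms], of total_to_lines]
  by (simp add: ring_hom_simps[OF total_to_lines(1)] total_to_lines c0 base_origin_param
      ring_hom_simps[OF lines_const_hom])

text \<open>The basis of the total space restricts to linearly independent functions on the lines. A
  function in the kernel therefore has all its coefficients in the maximal ideal of the origin of
  the base.\<close>

lemma total_to_lines_kernel: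
  fixes x :: "('k, 'n) total_ring"
  assumes x: "total_to_lines x = 0"
  shows "x \<in> ideal_gen (base_to_total ` {b. base_origin b = 0})"
proof -
  note hs = ring_hom_simps[OF lines_axis(1)] ring_hom_simps[OF lines_diag(1)] ring_hom_power[OF lines_axis(1)]
    ring_hom_power[OF lines_diag(1)] ring_hom_power[OF total_to_lines(1)] ring_hom_simps[OF total_to_lines(1)]
  obtain q :: 'n where True by simp
  obtain F y where F: "finite F" "F \<subseteq> basis_index q"
    and x_eq: "x = (\<Sum>i\<in>F. base_to_total (y i) * total_basis W q i)"
    by (rule total_basis_spans[OF n split W])
  define b where "b i = total_to_lines (total_basis W q i)" for i
  have sum0: "(\<Sum>i\<in>F. lines_const (base_origin (y i)) * b i) = 0"
    using x unfolding x_eq by (simp add: ring_hom_sum[OF total_to_lines(1)] hs total_to_lines b_def)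
  obtain r where "r \<notin> {q, q, q}" using n by (rule obtain_fourth)
  then have qr: "q \<noteq> r" by auto
  have bW: "b (Inr m) = lines_coord q * lines_coord r * lines_coord q ^ m" for m
    by (simp add: b_def hs total_to_lines total_to_lines_W[OF qr])
  have bz: "b (Inl (i, m)) = lines_coord i ^ m" for i m by (simp add: b_def hs total_to_lines)
  have delta: "base_origin (y k) = 0"
    if "k \<in> F" and "\<And>i. i \<in> F \<Longrightarrow> base_origin (y i) * t i = (if i = k then base_origin (y k) else 0)"
      and "(\<Sum>i\<in>F. base_origin (y i) * t i) = 0" for k t
  proof -
    have "(\<Sum>i\<in>F. base_origin (y i) * t i) = (\<Sum>i\<in>F. if i = k then base_origin (y k) else 0)"
      by (rule sum.cong[OF refl that(2)])
    then show ?thesis using that(1,3) F(1) by simp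
  qed
  have axsum: "(\<Sum>i\<in>F. base_origin (y i) * coeff (lines_axis p (b i)) m) = 0" for p m
    using arg_cong[OF sum0, of "\<lambda>f. coeff (lines_axis p f) m"]
    by (simp add: ring_hom_sum[OF lines_axis(1)] hs lines_axis coeff_sum)
  have disum: "(\<Sum>i\<in>F. base_origin (y i) * coeff (lines_diag (b i)) m) = 0" for m
    using arg_cong[OF sum0, of "\<lambda>f. coeff (lines_diag f) m"]
    by (simp add: ring_hom_sum[OF lines_diag(1)] hs lines_diag coeff_sum)
  \<comment> \<open>On axis p the monomial t^m with m > 0 occurs only in the restriction of
    z_p^m.\<close>
  have zpos: "base_origin (y (Inl (p, m))) = 0" if "Inl (p, m) \<in> F" "m > 0" for p m
  proof (rule delta[OF that(1) _ axsum[of p m]])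
    fix i assume "i \<in> F"
    have "coeff (lines_axis p (b i)) m = (if i = Inl (p, m) then 1 else 0)"
    proof (cases i)
      case (Inl jm)
      obtain j m' where jm: "jm = (j, m')" by fastforce
      show ?thesis using Inl jm that(2) by (cases m') (auto simp: bz hs lines_axis coeff_X_power simp del: power_Suc)
    next
      case (Inr m')
      then show ?thesis using qr by (cases "q = p") (simp_all add: bW hs lines_axis)
    qed
    then show "base_origin (y i) * coeff (lines_axis p (b i)) m
      = (if i = Inl (p, m) then base_origin (y (Inl (p, m))) else 0)" by auto
  qed
  have XX: "lines_diag (b (Inr m)) = [:0, 1:] ^ (m + 2)" for m
    by (simp add: bW hs lines_diag power_add power2_eq_square mult_ac)
  have zl: "base_origin (y i) * coeff (lines_diag (b i)) m'
      = (if i = Inl (q, 0) then base_origin (y i) * (if m' = 0 then 1 else 0) else 0)"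
    if "i \<in> F" "i = Inl jm" for i jm m'
  proof -
    obtain j m where jm: "jm = (j, m)" by fastforce
    show ?thesis
    proof (cases "m = 0")
      case True
      then have "j = q" using F(2) that jm by (auto simp: basis_index_def)
      then show ?thesis using True that(2) jm by (simp add: bz hs)
    next
      case False
      then have "base_origin (y i) = 0" using zpos that jm by auto
      then show ?thesis by auto
    qed
  qed
  \<comment> \<open>On the line (1,...,1) the element W z_q^m becomes t^(m+2); powers of coordinates
    would interfere there, but their coefficients already vanish.\<close>
  have w: "base_origin (y (Inr m)) = 0" if "Inr m \<in> F" for m
  proof (rule delta[OF that _ disum[of "m + 2"]])
    fix i assume i: "i \<in> F"
    show "base_origin (y i) * coeff (lines_diag (b i)) (m + 2)
      = (if i = Inr m then base_origin (y (Inr m)) else 0)"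
    proof (cases i)
      case (Inl jm)
      then show ?thesis using zl[OF i Inl, of "m + 2"] by simp
    next
      case (Inr m')
      then show ?thesis by (auto simp: XX coeff_X_power simp del: power_Suc)
    qed
  qed
  have one: "base_origin (y (Inl (q, 0))) = 0" if "Inl (q, 0) \<in> F"
  proof (rule delta[OF that _ disum[of 0]])
    fix i assume i: "i \<in> F"
    show "base_origin (y i) * coeff (lines_diag (b i)) 0
      = (if i = Inl (q, 0) then base_origin (y (Inl (q, 0))) else 0)"
    proof (cases i)
      case (Inl jm)
      then show ?thesis using zl[OF i Inl, of 0] by auto
    next
      case (Inr m')
      then show ?thesis using w[of m'] i by simp
    qed
  qed
  have "base_origin (y i) = 0" if "i \<in> F" for i
  proof (cases i)
    case (Inl jm)
    obtain j m where jm: "jm = (j, m)" by fastforce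
    show ?thesis
    proof (cases "m = 0")
      case True
      then have "j = q" using F(2) that Inl jm by (auto simp: basis_index_def)
      then show ?thesis using True one that Inl jm by simp
    next
      case False
      then show ?thesis using zpos that Inl jm by simp
    qed
  next
    case (Inr m)
    then show ?thesis using w that by simp
  qed
  then have "base_to_total (y i) * total_basis W q i \<in> ideal_gen (base_to_total ` {b. base_origin b = 0})"
    if "i \<in> F" for i using that by (intro ideal_gen_mult2 ideal_gen_base imageI) simp
  then show ?thesis unfolding x_eq
    by (intro module.span_sum[OF module_mult]) auto
qed

end

lemma surj_base_origin: "surj base_origin"
  by (rule surjI[of _ base_const]) simp

section \<open>The family as a deformation of the lines, globally and at the origin\<close>

lemma deformation_total:
  assumes n: "CARD('n::finite) \<ge> 4"
  shows "deformation (lines_const :: 'k::field_char_0 \<Rightarrow> ('k, 'n) lines_ring)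
       base_const base_origin base_to_total total_to_lines"
proof -
  obtain c :: "'n \<Rightarrow> ('k, 'n) base_ring" where c: "split_params base_param c" "\<And>i. base_origin (c i) = 0"
    using n by (rule base_ring_split) blast
  obtain W where W: "product_form (\<lambda>i j. base_to_total (base_param i j)) (\<lambda>i. base_to_total (c i)) total_coord W"
    by (rule product_form_exists[OF n split_params_hom[OF base_to_total_hom c(1)] family_poly_total])
  have surj: "surj (total_to_lines :: ('k, 'n) total_ring \<Rightarrow> _)"
    unfolding surj_def by (rule allI) (metis total_to_lines_surj)
  have ker: "{x :: ('k, 'n) total_ring. total_to_lines x = 0} \<subseteq> ideal_gen (base_to_total ` {b. base_origin b = 0})"
    by (intro subsetI total_to_lines_kernel[OF n c W]) simp
  have "cocartesian (base_to_total :: ('k, 'n) base_ring \<Rightarrow> _) base_origin total_to_lines lines_const"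
    unfolding cocartesian_surj_iff[OF surj_base_origin]
    by (intro conjI base_to_total_hom base_origin_hom total_to_lines(1) lines_const_hom surj ker)
      (simp add: fun_eq_iff total_to_lines)
  then show ?thesis
    using flat_base_to_total[OF n c(1) W]
    by (simp add: deformation_def pointed_algebra_def base_const_hom base_origin_hom)
qed

lemma deformation_localized:
  fixes loc_L :: "('k::field_char_0, 'n::finite) lines_ring \<Rightarrow> 'x::comm_ring_1"
    and loc_T :: "('k, 'n) total_ring \<Rightarrow> 't::comm_ring_1"
  assumes n: "CARD('n) \<ge> 4"
    and L: "is_localization loc_L {f. lines_origin f \<noteq> 0}"
    and T: "is_localization loc_T {f. total_origin f \<noteq> 0}"
  obtains \<Pi> where "\<Pi> \<circ> loc_T = loc_L \<circ> total_to_lines"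
    "deformation (loc_L \<circ> lines_const) base_const base_origin (loc_T \<circ> base_to_total) \<Pi>"
proof -
  have lL: "is_ring_hom loc_L" and lT: "is_ring_hom loc_T" using L T by (simp_all add: is_localization_def)
  note hs = ring_hom_simps[OF lL] ring_hom_simps[OF lT] ring_hom_simps[OF total_origin_hom]
    ring_hom_simps[OF total_to_lines(1)]
  let ?M = "{f :: ('k, 'n) total_ring. total_origin f \<noteq> 0}"
  have M: "1 \<in> ?M" "\<And>x y. x \<in> ?M \<Longrightarrow> y \<in> ?M \<Longrightarrow> x * y \<in> ?M" by (simp_all add: hs)
  have unit: "(loc_L \<circ> total_to_lines) s dvd 1" if "s \<in> ?M" for s
    using L that by (simp add: is_localization_def total_origin_def)
  obtain \<Pi> where \<Pi>: "is_ring_hom \<Pi>" "\<And>x. \<Pi> (loc_T x) = (loc_L \<circ> total_to_lines) x"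
    by (rule localization_hom_exists[OF T M ring_hom_comp[OF total_to_lines(1) lL] unit])
      (assumption | (rule that; assumption))+
  have fracT: "\<exists>x s. s \<in> ?M \<and> y * loc_T s = loc_T x" for y
    using T unfolding is_localization_def by blast
  have unitT: "\<exists>v. loc_T s * v = 1" if "s \<in> ?M" for s
  proof -
    have "loc_T s dvd 1" using T that by (simp add: is_localization_def)
    then show ?thesis by (metis dvdE)
  qed
  have flat: "flat_hom (loc_T \<circ> base_to_total)"
    using deformation_total[OF n, where 'k = 'k]
    by (intro flat_hom_localization[OF base_to_total_hom _ T M]) (simp_all add: deformation_def)
  have "\<exists>t. \<Pi> t = y" for y
  proof -
    obtain f s where f: "lines_origin s \<noteq> 0" "y * loc_L s = loc_L f"
      using L unfolding is_localization_def by blast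
    obtain f' s' where f': "total_to_lines f' = f" "total_to_lines s' = s" using total_to_lines_surj by meson
    then have "s' \<in> ?M" using f by (simp add: total_origin_def)
    then obtain v where v: "loc_T s' * v = 1" using unitT by blast
    have "loc_L s * \<Pi> v = 1" using arg_cong[OF v, of \<Pi>] by (simp add: ring_hom_simps[OF \<Pi>(1)] \<Pi>(2) f')
    then have "y = y * loc_L s * \<Pi> v" by (simp add: mult.assoc)
    also have "\<dots> = \<Pi> (loc_T f' * v)" by (simp add: f ring_hom_simps[OF \<Pi>(1)] \<Pi>(2) f')
    finally show ?thesis by metis
  qed
  then have surj: "surj \<Pi>" by (metis surjI)
  \<comment> \<open>Clearing denominators on both sides reduces to the kernel computed before
    localization; the cleared factors are units in the local ring.\<close>
  have ker: "y \<in> ideal_gen ((loc_T \<circ> base_to_total) ` {b. base_origin b = 0})" if y: "\<Pi> y = 0" for y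
  proof -
    obtain x s where s: "s \<in> ?M" "y * loc_T s = loc_T x" using fracT by blast
    have "loc_L (total_to_lines x) = 0"
      using arg_cong[OF s(2), of \<Pi>] y by (simp add: ring_hom_simps[OF \<Pi>(1)] \<Pi>(2))
    then obtain r where r: "lines_origin r \<noteq> 0" "r * total_to_lines x = 0"
      using L unfolding is_localization_def by blast
    obtain r' where r': "total_to_lines r' = r" using total_to_lines_surj by blast
    have "total_to_lines (r' * x) = 0" using r r' by (simp add: hs)
    then have "r' * x \<in> ideal_gen (base_to_total ` {b. base_origin b = 0})"
      by (rule deformationD(10)[OF deformation_total[OF n]])
    then have I: "loc_T (r' * x) \<in> ideal_gen ((loc_T \<circ> base_to_total) ` {b. base_origin b = 0})"
      by (rule ring_hom_ideal_gen[OF lT, rotated]) (auto intro!: ideal_gen_base)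
    have "s * r' \<in> ?M" using s(1) r(1) r' by (intro M) (simp_all add: total_origin_def)
    then obtain v where v: "loc_T (s * r') * v = 1" using unitT by blast
    have "y = y * (loc_T (s * r') * v)" by (simp add: v)
    also have "\<dots> = (y * loc_T s) * loc_T r' * v" by (simp add: hs mult_ac)
    also have "\<dots> = v * loc_T (r' * x)" by (simp add: s hs mult_ac)
    finally show ?thesis using ideal_gen_mult[OF I, of v] by simp
  qed
  have "cocartesian (loc_T \<circ> base_to_total) base_origin \<Pi> (loc_L \<circ> lines_const)"
    unfolding cocartesian_surj_iff[OF surj_base_origin]
  proof (intro conjI)
    show "{x. \<Pi> x = 0} \<subseteq> ideal_gen ((loc_T \<circ> base_to_total) ` {b. base_origin b = 0})"
      by (intro subsetI ker) simp
    show "\<Pi> \<circ> (loc_T \<circ> base_to_total) = loc_L \<circ> lines_const \<circ> base_origin"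
      by (simp add: fun_eq_iff \<Pi>(2) total_to_lines)
  qed (intro ring_hom_comp base_to_total_hom base_origin_hom lines_const_hom lL lT \<Pi>(1) surj)+
  then have "deformation (loc_L \<circ> lines_const) base_const base_origin (loc_T \<circ> base_to_total) \<Pi>"
    using flat by (simp add: deformation_def pointed_algebra_def base_const_hom base_origin_hom)
  then show ?thesis using \<Pi>(2) by (intro that[of \<Pi>]) (auto simp: fun_eq_iff)
qed

subsection \<open>Weights\<close>

lemma map_poly_hom:
  assumes f: "is_ring_hom f"
  shows "is_ring_hom (map_poly f)"
proof -
  note hs = ring_hom_simps[OF f]
  have c: "coeff (map_poly f p) d = f (coeff p d)" for p d by (simp add: coeff_map_poly hs)
  show ?thesis
    unfolding is_ring_hom_def
    by (intro conjI allI poly_eqI) (simp_all add: c hs coeff_mult ring_hom_sum[OF f] one_pCons coeff_pCons split: nat.splits)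
qed

lemma map_poly_monom: "is_ring_hom f \<Longrightarrow> map_poly f (monom a d) = monom (f a) d"
  by (rule poly_eqI) (simp add: coeff_map_poly ring_hom_simps)

lemma map_poly_const: "is_ring_hom f \<Longrightarrow> map_poly f [:a:] = [:f a:]"
  using map_poly_monom[of f a 0] by (simp add: monom_0)

text \<open>The elementwise conditions of \<open>good_Gm_action\<close>, isolated because they pass
  to sums and products and can thus be checked on generators.\<close>

definition weight_ok :: "('k::field \<Rightarrow> 's::comm_ring_1) \<Rightarrow> ('s \<Rightarrow> 's poly) \<Rightarrow> 's \<Rightarrow> bool" where
  "weight_ok \<eta> \<gamma> s \<longleftrightarrow> poly (\<gamma> s) 1 = s \<and> (\<forall>d. \<gamma> (coeff (\<gamma> s) d) = monom (coeff (\<gamma> s) d) d) \<and>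
     coeff (\<gamma> s) 0 \<in> range \<eta>"

lemma weight_ok_add:
  assumes \<eta>: "is_ring_hom \<eta>" and \<gamma>: "is_ring_hom \<gamma>" and "weight_ok \<eta> \<gamma> s" "weight_ok \<eta> \<gamma> t"
  shows "weight_ok \<eta> \<gamma> (s + t)"
proof -
  obtain a b where "coeff (\<gamma> s) 0 = \<eta> a" "coeff (\<gamma> t) 0 = \<eta> b" using assms by (auto simp: weight_ok_def)
  then have "coeff (\<gamma> (s + t)) 0 = \<eta> (a + b)" by (simp add: ring_hom_simps[OF \<gamma>] ring_hom_simps[OF \<eta>])
  then show ?thesis using assms by (simp add: weight_ok_def ring_hom_simps[OF \<gamma>] add_monom)
qed

lemma weight_ok_mult:
  assumes \<eta>: "is_ring_hom \<eta>" and \<gamma>: "is_ring_hom \<gamma>" and s: "weight_ok \<eta> \<gamma> s" and t: "weight_ok \<eta> \<gamma> t"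
  shows "weight_ok \<eta> \<gamma> (s * t)"
proof -
  obtain a b where "coeff (\<gamma> s) 0 = \<eta> a" "coeff (\<gamma> t) 0 = \<eta> b" using s t by (auto simp: weight_ok_def)
  then have r: "coeff (\<gamma> (s * t)) 0 = \<eta> (a * b)"
    by (simp add: ring_hom_simps[OF \<gamma>] ring_hom_simps[OF \<eta>] coeff_mult)
  have "\<gamma> (coeff (\<gamma> (s * t)) d) = monom (coeff (\<gamma> (s * t)) d) d" for d
  proof -
    have "\<gamma> (coeff (\<gamma> s) i * coeff (\<gamma> t) (d - i)) = monom (coeff (\<gamma> s) i * coeff (\<gamma> t) (d - i)) d"
      if "i \<le> d" for i
      using s t that by (simp add: weight_ok_def ring_hom_simps[OF \<gamma>] mult_monom)
    then have "\<gamma> (coeff (\<gamma> (s * t)) d) = (\<Sum>i\<le>d. monom (coeff (\<gamma> s) i * coeff (\<gamma> t) (d - i)) d)"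
      by (simp add: ring_hom_simps[OF \<gamma>] coeff_mult ring_hom_sum[OF \<gamma>])
    also have "\<dots> = monom (coeff (\<gamma> (s * t)) d) d"
      by (rule poly_eqI) (simp add: ring_hom_simps[OF \<gamma>] coeff_mult coeff_sum)
    finally show ?thesis .
  qed
  then show ?thesis using s t r by (simp add: weight_ok_def ring_hom_simps[OF \<gamma>])
qed

lemma weight_ok_const:
  assumes "\<And>c. \<gamma> (\<eta> c) = [:\<eta> c:]" "is_ring_hom \<gamma>"
  shows "weight_ok \<eta> \<gamma> (\<eta> c)"
  using assms by (auto simp: weight_ok_def coeff_pCons monom_0 ring_hom_simps split: nat.splits)

lemma weight_ok_monom:
  assumes \<gamma>: "is_ring_hom \<gamma>" and \<eta>: "is_ring_hom \<eta>" and "\<gamma> s = monom s 1"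
  shows "weight_ok \<eta> \<gamma> s"
proof -
  have "0 \<in> range \<eta>" using ring_hom_simps(1)[OF \<eta>] by (metis rangeI)
  then show ?thesis using assms by (simp add: weight_ok_def poly_monom ring_hom_simps)
qed

lemma good_Gm_actionI:
  "is_ring_hom \<gamma> \<Longrightarrow> (\<And>c. \<gamma> (\<eta> c) = [:\<eta> c:]) \<Longrightarrow> (\<And>s. weight_ok \<eta> \<gamma> s) \<Longrightarrow> good_Gm_action \<eta> \<gamma>"
  by (simp add: good_Gm_action_def weight_ok_def)

text \<open>All a_ij and all z_i receive weight 1. The coactions are well defined because every
  defining relation is homogeneous.\<close>

lemma Gm_actions:
  obtains \<gamma>\<^sub>B \<gamma>\<^sub>T \<gamma>\<^sub>L where
    "good_Gm_action (base_const :: 'k::field \<Rightarrow> ('k, 'n::finite) base_ring) \<gamma>\<^sub>B"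
    "good_Gm_action (base_to_total \<circ> base_const :: 'k \<Rightarrow> ('k, 'n) total_ring) \<gamma>\<^sub>T"
    "good_Gm_action (lines_const :: 'k \<Rightarrow> ('k, 'n) lines_ring) \<gamma>\<^sub>L"
    "\<And>i. \<gamma>\<^sub>L (lines_coord i) = monom (lines_coord i) 1"
    "Gm_equivariant \<gamma>\<^sub>B \<gamma>\<^sub>T base_to_total" "Gm_equivariant \<gamma>\<^sub>T \<gamma>\<^sub>L total_to_lines"
proof -
  let ?p = "base_param :: 'n \<Rightarrow> 'n \<Rightarrow> ('k, 'n) base_ring"
  let ?z = "total_coord :: 'n \<Rightarrow> ('k, 'n) total_ring"
  let ?l = "lines_coord :: 'n \<Rightarrow> ('k, 'n) lines_ring"
  have homB: "is_ring_hom (\<lambda>c :: 'k. [:base_const c :: ('k, 'n) base_ring:])"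
    using ring_hom_comp[OF base_const_hom pCons_hom] by (simp add: o_def)
  have anti: "monom (?p i j) 1 + monom (?p j i) 1 = 0" for i j
    by (simp add: add_monom base_param_antisym)
  obtain \<gamma>\<^sub>B :: "('k, 'n) base_ring \<Rightarrow> ('k, 'n) base_ring poly" where B: "is_ring_hom \<gamma>\<^sub>B"
    "\<And>c. \<gamma>\<^sub>B (base_const c) = [:base_const c:]" "\<And>i j. \<gamma>\<^sub>B (?p i j) = monom (?p i j) 1"
  proof (rule base_ring_hom_exists[OF homB anti])
    fix i j k l m :: 'n assume "distinct [i, j, k, l, m]"
    from base_param_Phi[OF this, where 'k = 'k]
    show "(monom (?p i k) 1 - monom (?p i j) 1) * (monom (?p j k) 1 - monom (?p j i) 1)
      - (monom (?p i k) 1 - monom (?p i l) 1) * (monom (?p l k) 1 - monom (?p l i) 1)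
      - (monom (?p i m) 1 - monom (?p i j) 1) * (monom (?p j m) 1 - monom (?p j i) 1)
      + (monom (?p i m) 1 - monom (?p i l) 1) * (monom (?p l m) 1 - monom (?p l i) 1) = 0"
      by (simp only: diff_monom mult_monom add_monom monom_eq_0_iff)
  qed (assumption | (rule that; assumption))+
  have homT: "is_ring_hom (map_poly base_to_total \<circ> \<gamma>\<^sub>B)"
    by (rule ring_hom_comp[OF B(1) map_poly_hom[OF base_to_total_hom]])
  obtain \<gamma>\<^sub>T where T: "is_ring_hom \<gamma>\<^sub>T" "\<And>b. \<gamma>\<^sub>T (base_to_total b) = (map_poly base_to_total \<circ> \<gamma>\<^sub>B) b"
    "\<And>i. \<gamma>\<^sub>T (?z i) = monom (?z i) 1"
  proof (rule total_ring_hom_exists[OF homT, of "\<lambda>i j. monom (base_to_total (?p i j)) 1" "\<lambda>i. monom (?z i) 1"])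
    show "monom (base_to_total (?p i j)) 1 = (map_poly base_to_total \<circ> \<gamma>\<^sub>B) (?p i j)" for i j
      by (simp add: B map_poly_monom[OF base_to_total_hom])
    fix i j k l :: 'n assume "distinct [i, j, k, l]"
    from family_poly_total[OF this, where 'k = 'k]
    show "monom (?z i) 1 * monom (?z j) 1 - monom (?z i) 1 * monom (?z l) 1
      + (monom (base_to_total (?p i j)) 1 - monom (base_to_total (?p i l)) 1) * monom (?z i) 1
      + monom (base_to_total (?p j i)) 1 * monom (?z j) 1 - monom (base_to_total (?p l i)) 1 * monom (?z l) 1
      - monom (base_to_total (?p i j)) 1 * monom (base_to_total (?p i k)) 1
      - monom (base_to_total (?p j i)) 1 * monom (base_to_total (?p j k)) 1
      - monom (base_to_total (?p k i)) 1 * monom (base_to_total (?p k j)) 1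
      + monom (base_to_total (?p i l)) 1 * monom (base_to_total (?p i k)) 1
      + monom (base_to_total (?p l i)) 1 * monom (base_to_total (?p l k)) 1
      + monom (base_to_total (?p k i)) 1 * monom (base_to_total (?p k l)) 1 = 0"
      by (simp only: diff_monom mult_monom add_monom monom_eq_0_iff)
  qed (assumption | (rule that; assumption))+
  have homL: "is_ring_hom (\<lambda>c :: 'k. [:lines_const c :: ('k, 'n) lines_ring:])"
    using ring_hom_comp[OF lines_const_hom pCons_hom] by (simp add: o_def)
  obtain \<gamma>\<^sub>L where L: "is_ring_hom \<gamma>\<^sub>L" "\<And>c. \<gamma>\<^sub>L (lines_const c) = [:lines_const c:]"
    "\<And>i. \<gamma>\<^sub>L (?l i) = monom (?l i) 1"
  proof (rule lines_ring_hom_exists[OF homL, of "\<lambda>i. monom (?l i) 1"])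
    show "monom (?l i) 1 * monom (?l j) 1 = monom (?l k) 1 * monom (?l l) 1" if "i \<noteq> j" "k \<noteq> l" for i j k l
      using lines_coord_mult[OF that, where 'k = 'k] by (simp add: mult_monom)
  qed (assumption | (rule that; assumption))+
  have wB: "weight_ok base_const \<gamma>\<^sub>B s" for s
  proof (induction s rule: base_ring_induct)
    case (const c)
    show ?case by (rule weight_ok_const[OF B(2,1)])
  next
    case (param i j)
    show ?case by (rule weight_ok_monom[OF B(1) base_const_hom B(3)])
  next
    case (add x y)
    then show ?case by (rule weight_ok_add[OF base_const_hom B(1)])
  next
    case (mult x y)
    then show ?case by (rule weight_ok_mult[OF base_const_hom B(1)])
  qed
  note btt = base_to_total_hom
  have TB: "is_ring_hom (base_to_total \<circ> base_const :: 'k \<Rightarrow> ('k, 'n) total_ring)"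
    by (rule ring_hom_comp[OF base_const_hom btt])
  have Tc: "\<gamma>\<^sub>T ((base_to_total \<circ> base_const) c) = [:(base_to_total \<circ> base_const) c:]" for c
    by (simp add: T B map_poly_const[OF btt])
  have cm: "coeff (map_poly base_to_total p) d = base_to_total (coeff p d)" for p :: "('k, 'n) base_ring poly" and d
    by (simp add: coeff_map_poly ring_hom_simps[OF btt])
  have pm: "poly (map_poly base_to_total p) 1 = base_to_total (poly p 1)" for p :: "('k, 'n) base_ring poly"
    by (induction p) (simp_all add: map_poly_pCons ring_hom_simps[OF btt])
  have wT: "weight_ok (base_to_total \<circ> base_const) \<gamma>\<^sub>T s" for s
  proof (induction s rule: total_ring_induct)
    case (base b)
    obtain e where "coeff (\<gamma>\<^sub>B b) 0 = base_const e" using wB[of b] by (auto simp: weight_ok_def)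
    then show ?case using wB[of b] by (simp add: weight_ok_def T cm pm map_poly_monom[OF btt])
  next
    case (coord i)
    show ?case by (rule weight_ok_monom[OF T(1) TB T(3)])
  next
    case (add x y)
    then show ?case by (rule weight_ok_add[OF TB T(1)])
  next
    case (mult x y)
    then show ?case by (rule weight_ok_mult[OF TB T(1)])
  qed
  have wL: "weight_ok lines_const \<gamma>\<^sub>L s" for s
  proof (induction s rule: lines_ring_induct)
    case (const c)
    show ?case by (rule weight_ok_const[OF L(2,1)])
  next
    case (coord i)
    show ?case by (rule weight_ok_monom[OF L(1) lines_const_hom L(3)])
  next
    case (add x y)
    then show ?case by (rule weight_ok_add[OF lines_const_hom L(1)])
  next
    case (mult x y)
    then show ?case by (rule weight_ok_mult[OF lines_const_hom L(1)])
  qed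
  have eqB: "Gm_equivariant \<gamma>\<^sub>B \<gamma>\<^sub>T base_to_total" by (simp add: Gm_equivariant_def T)
  note tl = total_to_lines(1) and mtl = ring_hom_simps[OF map_poly_hom[OF total_to_lines(1)]]
    and mbt = ring_hom_simps[OF map_poly_hom[OF base_to_total_hom]]
  have origin: "\<gamma>\<^sub>L (lines_const (base_origin b)) = map_poly total_to_lines (map_poly base_to_total (\<gamma>\<^sub>B b))" for b
  proof (induction b rule: base_ring_induct)
    case (const c)
    then show ?case by (simp add: L B map_poly_const[OF btt] map_poly_const[OF tl] total_to_lines)
  next
    case (param i j)
    then show ?case
      by (simp add: L B map_poly_monom[OF btt] map_poly_monom[OF tl] total_to_lines base_origin_param
          ring_hom_simps[OF lines_const_hom] ring_hom_simps[OF L(1)])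
  next
    case (add x y)
    then show ?case
      by (simp only: ring_hom_simps[OF base_origin_hom] ring_hom_simps[OF lines_const_hom] ring_hom_simps[OF L(1)]
          ring_hom_simps[OF B(1)] mtl mbt)
  next
    case (mult x y)
    then show ?case
      by (simp only: ring_hom_simps[OF base_origin_hom] ring_hom_simps[OF lines_const_hom] ring_hom_simps[OF L(1)]
          ring_hom_simps[OF B(1)] mtl mbt)
  qed
  have "\<gamma>\<^sub>L (total_to_lines s) = map_poly total_to_lines (\<gamma>\<^sub>T s)" for s
  proof (induction s rule: total_ring_induct)
    case (base b)
    show ?case using origin[of b] by (simp add: total_to_lines T)
  next
    case (coord i)
    show ?case by (simp add: total_to_lines T L map_poly_monom[OF tl])
  next
    case (add x y)
    then show ?case by (simp only: ring_hom_simps[OF tl] ring_hom_simps[OF L(1)] ring_hom_simps[OF T(1)] mtl)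
  next
    case (mult x y)
    then show ?case by (simp only: ring_hom_simps[OF tl] ring_hom_simps[OF L(1)] ring_hom_simps[OF T(1)] mtl)
  qed
  then have eqT: "Gm_equivariant \<gamma>\<^sub>T \<gamma>\<^sub>L total_to_lines" by (simp add: Gm_equivariant_def)
  show ?thesis
    by (rule that[OF good_Gm_actionI[OF B(1,2) wB] good_Gm_actionI[OF T(1) Tc wT] good_Gm_actionI[OF L(1,2) wL]
          L(3) eqB eqT])
qed

subsection \<open>Miniversality\<close>

text \<open>Uniqueness for the linear problem: dividing the equation on axis i by t and evaluating
  at the origin gives \<zeta>_j(0) + \<alpha>_ij = 0. Antisymmetry of \<alpha> turns this into
  \<zeta>_i(0) + \<zeta>_j(0) = 0 for all i different from j, so with three indices everything
  vanishes.\<close>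

lemma localized_unique:
  fixes \<iota> :: "('k::field_char_0, 'n::finite) lines_ring \<Rightarrow> 'x::comm_ring_1"
  assumes n: "CARD('n) \<ge> 4" and loc: "is_localization \<iota> {f. lines_origin f \<noteq> 0}"
    and anti: "\<And>i j. \<alpha> i j + \<alpha> j i = 0"
    and eq: "\<And>i j. i \<noteq> j \<Longrightarrow> \<zeta> i * \<iota> (lines_coord j) + \<iota> (lines_coord i) * \<zeta> j
       + \<iota> (lines_const (\<alpha> i j)) * (\<iota> (lines_coord i) - \<iota> (lines_coord j)) = \<omega>"
  shows "\<alpha> i j = 0"
proof -
  have \<iota>: "is_ring_hom \<iota>" using loc by (simp add: is_localization_def)
  note hs = ring_hom_simps[OF \<iota>] and ha = ring_hom_simps[OF lines_axis(1)]
  obtain s where s: "lines_origin s = 1" and "\<And>y. y \<in> insert \<omega> (range \<zeta>) \<Longrightarrow> \<exists>f. y * \<iota> s = \<iota> f"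
    by (rule lines_localization_denominator[OF loc, of "insert \<omega> (range \<zeta>)"]) auto
  then have "\<forall>y\<in>insert \<omega> (range \<zeta>). \<exists>f. \<iota> f = y * \<iota> s" by metis
  then have "\<exists>F. \<forall>y\<in>insert \<omega> (range \<zeta>). \<iota> (F y) = y * \<iota> s" by (rule bchoice)
  then obtain F where "\<forall>y\<in>insert \<omega> (range \<zeta>). \<iota> (F y) = y * \<iota> s" by blast
  then have F: "\<iota> (F \<omega>) = \<omega> * \<iota> s" "\<iota> (F (\<zeta> i)) = \<zeta> i * \<iota> s" for i by simp_all
  have *: "\<exists>s'. lines_origin s' \<noteq> 0 \<and> s' * (F (\<zeta> i) * lines_coord j + lines_coord i * F (\<zeta> j)
      + s * (lines_const (\<alpha> i j) * (lines_coord i - lines_coord j)) - F \<omega>) = 0" if "i \<noteq> j" for i j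
  proof -
    have "\<iota> (F (\<zeta> i) * lines_coord j + lines_coord i * F (\<zeta> j)
      + s * (lines_const (\<alpha> i j) * (lines_coord i - lines_coord j)) - F \<omega>)
      = \<iota> s * (\<zeta> i * \<iota> (lines_coord j) + \<iota> (lines_coord i) * \<zeta> j
       + \<iota> (lines_const (\<alpha> i j)) * (\<iota> (lines_coord i) - \<iota> (lines_coord j)) - \<omega>)"
      by (simp only: hs F algebra_simps)
    also have "\<dots> = 0" unfolding eq[OF that] by simp
    finally show ?thesis using loc unfolding is_localization_def by blast
  qed
  have axis: "lines_axis k (F (\<zeta> i) * lines_coord j + lines_coord i * F (\<zeta> j)
      + s * (lines_const (\<alpha> i j) * (lines_coord i - lines_coord j)) - F \<omega>) = 0" if ij: "i \<noteq> j" for i j k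
  proof -
    obtain s' where s': "lines_origin s' \<noteq> 0" "s' * (F (\<zeta> i) * lines_coord j + lines_coord i * F (\<zeta> j)
      + s * (lines_const (\<alpha> i j) * (lines_coord i - lines_coord j)) - F \<omega>) = 0" using *[OF ij] by blast
    have "lines_axis k s' \<noteq> 0" using s'(1) lines_restrictions(1)[of k s'] by auto
    moreover have "lines_axis k s' * lines_axis k (F (\<zeta> i) * lines_coord j + lines_coord i * F (\<zeta> j)
      + s * (lines_const (\<alpha> i j) * (lines_coord i - lines_coord j)) - F \<omega>) = 0"
      using arg_cong[OF s'(2), of "lines_axis k"] by (simp only: ha)
    ultimately show ?thesis by simp
  qed
  \<comment> \<open>On an axis other than i and j every term except \<omega> vanishes.\<close>
  have F\<omega>: "lines_axis k (F \<omega>) = 0" for k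
  proof -
    obtain i where i: "i \<notin> {k, k, k}" using n by (rule obtain_fourth)
    obtain j where j: "j \<notin> {k, i, i}" using n by (rule obtain_fourth)
    show ?thesis using axis[of i j k] i j by (auto simp: ha lines_axis)
  qed
  have \<alpha>: "lines_origin (F (\<zeta> j)) + \<alpha> i j = 0" if ij: "i \<noteq> j" for i j
  proof -
    have "[:0, 1:] * (lines_axis i (F (\<zeta> j)) + lines_axis i s * [:\<alpha> i j:]) = 0"
      using axis[OF ij, of i] ij by (simp add: ha lines_axis F\<omega> algebra_simps)
    then have "lines_axis i (F (\<zeta> j)) + lines_axis i s * [:\<alpha> i j:] = 0" by simp
    from arg_cong[OF this, of "\<lambda>p. coeff p 0"] show ?thesis by (simp add: lines_restrictions s)
  qed
  have o: "lines_origin (F (\<zeta> i)) + lines_origin (F (\<zeta> j)) = 0" if "i \<noteq> j" for i j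
    using \<alpha>[OF that] \<alpha>[of j i] anti[of i j] that by (simp add: eq_neg_iff_add_eq_0[symmetric])
  show ?thesis
  proof (cases "i = j")
    case True
    then have "2 * \<alpha> i j = 0" using anti[of i i] by simp
    then show ?thesis by simp
  next
    case False
    obtain l where l: "l \<notin> {i, j, j}" using n by (rule obtain_fourth)
    let ?o = "\<lambda>i. lines_origin (F (\<zeta> i))"
    have "2 * ?o j = (?o i + ?o j) + (?o j + ?o l) - (?o i + ?o l)" by simp
    also have "\<dots> = 0"
    proof -
      have "i \<noteq> l" "j \<noteq> l" using l by auto
      then show ?thesis by (simp only: o False not_False_eq_True add_0_right diff_self)
    qed
    finally show ?thesis using \<alpha>[OF False] by simp
  qed
qed

section \<open>The dual numbers\<close>

lemma dual_const_hom: "is_ring_hom (dual_const :: 'k::field \<Rightarrow> _)"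
  by (simp add: is_ring_hom_def dual_const_def one_dual_def plus_dual_def times_dual_def)

lemma dual_re_hom: "is_ring_hom (dual_re :: 'k::field dual \<Rightarrow> _)"
  by (simp add: is_ring_hom_def one_dual_def plus_dual_def times_dual_def)

lemma dual_mult_nilpotent: "dual_re x = 0 \<Longrightarrow> dual_re y = 0 \<Longrightarrow> x * y = 0"
  by (simp add: times_dual_def zero_dual_def)

lemma dual_colength_one:
  "colength_one dual_const dual_re {0} {x. dual_re x = 0} (Dual 0 (1 :: 'k::field))"
  unfolding colength_one_def
proof (intro conjI ballI allI impI)
  show "is_ideal {0 :: 'k dual}" using is_ideal_ideal_gen[of "{0 :: 'k dual}"] by (simp add: ideal_gen_singleton_0)
  show "is_ideal {x :: 'k dual. dual_re x = 0}" by (rule is_ideal_kernel[OF dual_re_hom])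
  show "\<exists>c. j - dual_const c * Dual 0 1 \<in> {0}" if "j \<in> {x. dual_re x = 0}" for j :: "'k dual"
    using that by (intro exI[of _ "dual_eps j"])
      (simp add: dual_const_def times_dual_def minus_dual_def zero_dual_def)
qed (simp_all add: zero_dual_def dual_mult_nilpotent ring_hom_simps(1)[OF dual_re_hom])

lemma local_artinian_dual: "local_artinian dual_const (dual_re :: 'k::field dual \<Rightarrow> 'k)"
  unfolding local_artinian_def
proof (intro conjI allI impI notI)
  show "pointed_algebra dual_const (dual_re :: 'k dual \<Rightarrow> 'k)"
    by (simp add: pointed_algebra_def dual_const_hom dual_re_hom dual_const_def)
  show unit: "x dvd 1" if "dual_re x \<noteq> 0" for x :: "'k dual"
  proof (rule dvdI)
    show "1 = x * Dual (1 / dual_re x) (- dual_eps x / (dual_re x * dual_re x))"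
      using that by (simp add: times_dual_def one_dual_def)
  qed
  assume "\<exists>I :: nat \<Rightarrow> 'k dual set. \<forall>n. is_ideal (I n) \<and> I (Suc n) \<subset> I n"
  then obtain I :: "nat \<Rightarrow> 'k dual set" where I: "\<And>n. is_ideal (I n)" "\<And>n. I (Suc n) \<subset> I n" by blast
  \<comment> \<open>The only proper nonzero ideal is the maximal one, so the second and third
    members of a strictly descending chain would coincide.\<close>
  have mid: "J = {x. dual_re x = 0}" if J: "is_ideal J" "J \<noteq> UNIV" "x \<in> J" "x \<noteq> 0" for J and x :: "'k dual"
  proof -
    have sub: "dual_re y = 0" if y: "y \<in> J" for y
    proof (rule ccontr)
      assume "dual_re y \<noteq> 0"
      then obtain v where "1 = y * v" using unit by (meson dvdE)
      then have "1 \<in> J" using is_ideal_ops(6)[OF J(1) y] by metis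
      then have "z \<in> J" for z using is_ideal_ops(5)[OF J(1), of 1 z] by simp
      then show False using J(2) by blast
    qed
    have "y \<in> J" if y: "dual_re y = 0" for y
    proof -
      have "dual_eps x \<noteq> 0" using sub[OF J(3)] J(4) by (cases x) (simp add: zero_dual_def)
      then have "y = Dual (dual_eps y / dual_eps x) 0 * x"
        using y sub[OF J(3)] by (cases y) (simp add: times_dual_def)
      then show ?thesis using is_ideal_ops(5)[OF J(1,3)] by metis
    qed
    then show ?thesis using sub by blast
  qed
  have ne: "I (Suc m) \<noteq> UNIV" for m using I(2)[of m] by blast
  have nz: "\<exists>x\<in>I m. x \<noteq> 0" for m
    using I(2)[of m] is_ideal_ops(1)[OF I(1)[of "Suc m"]] by auto
  have "I (Suc m) = {x. dual_re x = 0}" for m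
    using mid[OF I(1) ne] nz[of "Suc m"] by blast
  then have "I (Suc 0) = I (Suc (Suc 0))" by simp
  then show False using I(2)[of "Suc 0"] by blast
qed

section \<open>Smoothness and bijectivity on tangent spaces\<close>

context
  fixes loc_L :: "('k::field_char_0, 'n::finite) lines_ring \<Rightarrow> 'x::comm_ring_1"
    and loc_T :: "('k, 'n) total_ring \<Rightarrow> 't::comm_ring_1" and \<Pi> :: "'t \<Rightarrow> 'x"
  assumes n: "CARD('n) \<ge> 4"
    and L: "is_localization loc_L {f. lines_origin f \<noteq> 0}"
    and T: "is_localization loc_T {f. total_origin f \<noteq> 0}"
    and \<Pi>: "\<Pi> \<circ> loc_T = loc_L \<circ> total_to_lines"
    and univ: "deformation (loc_L \<circ> lines_const) base_const base_origin (loc_T \<circ> base_to_total) \<Pi>"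
begin

text \<open>A solution over A is a map from the universal family: \<open>a\<close> defines u on the
  base, \<open>z\<close> defines h0 on the total space, and h0 extends to the local ring because
  units lift from the special fibre. Flatness makes the resulting square a pull-back by
  \<open>cocartesian_over_artinian\<close>.\<close>

lemma pullback_from_solution:
  fixes \<phi> :: "'a::comm_ring_1 \<Rightarrow> 'r::comm_ring_1"
  assumes A: "local_artinian \<eta> \<rho>" and d: "deformation (loc_L \<circ> lines_const) \<eta> \<rho> \<phi> \<pi>"
    and s: "split_params a c" and p: "product_form (\<lambda>i j. \<phi> (a i j)) (\<lambda>i. \<phi> (c i)) z W"
    and a: "\<And>i j. \<rho> (a i j) = 0" and z: "\<And>i. \<pi> (z i) = loc_L (lines_coord i)"
  obtains u where "pointed_hom base_const base_origin \<eta> \<rho> u" "\<And>i j. u (base_param i j) = a i j"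
    "is_pullback u (loc_T \<circ> base_to_total) \<Pi> \<phi> \<pi>"
proof -
  note D = deformationD[OF d]
  have lL: "is_ring_hom loc_L" and lT: "is_ring_hom loc_T" using L T by (simp_all add: is_localization_def)
  have \<Pi>T: "\<Pi> (loc_T x) = loc_L (total_to_lines x)" for x using \<Pi> by (simp add: fun_eq_iff)
  have \<Pi>hom: "is_ring_hom \<Pi>" by (rule deformationD(5)[OF univ])
  have anti: "a i j + a j i = 0" for i j using s by (simp add: split_params_def)
  obtain u :: "('k, 'n) base_ring \<Rightarrow> 'a" where u: "is_ring_hom u" "\<And>c. u (base_const c) = \<eta> c"
    "\<And>i j. u (base_param i j) = a i j"
    by (rule base_ring_hom_exists[OF D(1) anti split_params_Phi[OF s]]) (assumption | (rule that; assumption))+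
  have \<rho>u: "\<rho> (u b) = base_origin b" for b
    by (induction b rule: base_ring_induct)
      (simp_all add: u D(3) a base_origin_param ring_hom_simps[OF u(1)] ring_hom_simps[OF D(2)]
        ring_hom_simps[OF base_origin_hom])
  have \<phi>u: "is_ring_hom (\<phi> \<circ> u)" by (rule ring_hom_comp[OF u(1) D(4)])
  have au: "\<phi> (a i j) = (\<phi> \<circ> u) (base_param i j)" for i j by (simp add: u)
  obtain h0 where h0: "is_ring_hom h0" "\<And>b. h0 (base_to_total b) = (\<phi> \<circ> u) b" "\<And>i. h0 (total_coord i) = z i"
    by (rule total_ring_hom_exists[OF \<phi>u au product_form_family[OF split_params_hom[OF D(4) s] p]])
      (assumption | (rule that; assumption))+
  have \<pi>h0: "\<pi> (h0 x) = loc_L (total_to_lines x)" for x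
    by (induction x rule: total_ring_induct)
      (simp_all add: h0 D(7) \<rho>u z total_to_lines ring_hom_simps[OF h0(1)] ring_hom_simps[OF D(5)]
        ring_hom_simps[OF total_to_lines(1)] ring_hom_simps[OF lL])
  have lu: "loc_L (total_to_lines x) dvd 1" if "total_origin x \<noteq> 0" for x
    using L that by (simp add: is_localization_def total_origin_def)
  have unit: "h0 x dvd 1" if "x \<in> {f. total_origin f \<noteq> 0}" for x
    by (rule deformation_unit_lift[OF A d]) (use lu that in \<open>simp add: \<pi>h0\<close>)
  have M: "1 \<in> {f :: ('k, 'n) total_ring. total_origin f \<noteq> 0}"
    "\<And>x y :: ('k, 'n) total_ring. x \<in> {f. total_origin f \<noteq> 0} \<Longrightarrow> y \<in> {f. total_origin f \<noteq> 0}
      \<Longrightarrow> x * y \<in> {f. total_origin f \<noteq> 0}"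
    by (simp_all add: ring_hom_simps[OF total_origin_hom])
  obtain h where h: "is_ring_hom h" "\<And>x. h (loc_T x) = h0 x"
    by (rule localization_hom_exists[OF T M h0(1) unit]) (assumption | (rule that; assumption))+
  have \<pi>h: "\<pi> (h t) = \<Pi> t" for t
  proof -
    obtain x s where x: "total_origin s \<noteq> 0" "t * loc_T s = loc_T x"
      using T unfolding is_localization_def by blast
    have "loc_L (total_to_lines s) * (\<pi> (h t) - \<Pi> t) = \<pi> (h (t * loc_T s)) - \<Pi> (t * loc_T s)"
      by (simp add: ring_hom_simps[OF h(1)] ring_hom_simps[OF D(5)] ring_hom_simps[OF \<Pi>hom] h(2) \<pi>h0 \<Pi>T algebra_simps)
    also have "\<dots> = 0" unfolding x by (simp add: h(2) \<pi>h0 \<Pi>T)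
    finally have "\<pi> (h t) - \<Pi> t = 0" by (rule cancel_unit[OF lu[OF x(1)]])
    then show ?thesis by simp
  qed
  have "cocartesian (loc_T \<circ> base_to_total) u h \<phi>"
    by (rule cocartesian_over_artinian[OF A d univ u(1) \<rho>u h(1) _ \<pi>h]) (simp add: h(2) h0(2))
  then have "is_pullback u (loc_T \<circ> base_to_total) \<Pi> \<phi> \<pi>"
    unfolding is_pullback_def is_pullback_via_def using \<pi>h by (auto simp: fun_eq_iff)
  moreover have "pointed_hom base_const base_origin \<eta> \<rho> u"
    by (simp add: pointed_hom_def u fun_eq_iff \<rho>u)
  ultimately show ?thesis using u(3) by (intro that)
qed

text \<open>The homomorphism u provides a solution over A. Arbitrary lifts of it along f form a
  solution modulo K = ker f, which \<open>solution_lift\<close> improves to an exact one without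
  changing its reduction.\<close>

lemma pullback_smooth:
  fixes \<phi> :: "'a::comm_ring_1 \<Rightarrow> 'r::comm_ring_1" and \<phi>' :: "'b::comm_ring_1 \<Rightarrow> 'q::comm_ring_1"
  assumes A': "local_artinian \<eta>' \<rho>'" and f: "pointed_hom \<eta>' \<rho>' \<eta> \<rho> f" "surj f"
    and u: "pointed_hom base_const base_origin \<eta> \<rho> u"
    and d: "deformation (loc_L \<circ> lines_const) \<eta> \<rho> \<phi> \<pi>"
    and d': "deformation (loc_L \<circ> lines_const) \<eta>' \<rho>' \<phi>' \<pi>'"
    and pf: "is_pullback f \<phi>' \<pi>' \<phi> \<pi>" and pu: "is_pullback u (loc_T \<circ> base_to_total) \<Pi> \<phi> \<pi>"
  shows "\<exists>u'. pointed_hom base_const base_origin \<eta>' \<rho>' u' \<and> f \<circ> u' = u \<and>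
    is_pullback u' (loc_T \<circ> base_to_total) \<Pi> \<phi>' \<pi>'"
proof -
  note D = deformationD[OF d] and D' = deformationD[OF d']
  have lT: "is_ring_hom loc_T" using T by (simp add: is_localization_def)
  have \<Pi>T: "\<Pi> (loc_T x) = loc_L (total_to_lines x)" for x using \<Pi> by (simp add: fun_eq_iff)
  have fh: "is_ring_hom f" "\<And>c. f (\<eta>' c) = \<eta> c" "\<And>x. \<rho> (f x) = \<rho>' x"
    and uh: "is_ring_hom u" "\<And>c. u (base_const c) = \<eta> c" "\<And>b. \<rho> (u b) = base_origin b"
    using f u by (auto simp: pointed_hom_def fun_eq_iff)
  obtain g where g: "cocartesian \<phi>' f g \<phi>" "\<And>x. \<pi> (g x) = \<pi>' x"
    using pf by (auto simp: is_pullback_def is_pullback_via_def fun_eq_iff)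
  obtain h where h: "cocartesian (loc_T \<circ> base_to_total) u h \<phi>" "\<And>x. \<pi> (h x) = \<Pi> x"
    using pu by (auto simp: is_pullback_def is_pullback_via_def fun_eq_iff)
  note gh = cocartesian_hom_commute[OF g(1)] and hh = cocartesian_hom_commute[OF h(1)]
  define K where "K = {x. f x = 0}"
  have surj_g: "surj g" and ker_g: "{x. g x = 0} \<subseteq> ideal_gen (\<phi>' ` K)"
    using g(1) unfolding cocartesian_surj_iff[OF f(2)] K_def by auto
  have K: "is_ideal K" "K \<subseteq> {x. \<rho>' x = 0}"
  proof -
    show "is_ideal K" unfolding K_def by (rule is_ideal_kernel[OF fh(1)])
    show "K \<subseteq> {x. \<rho>' x = 0}"
      using fh(3) by (auto simp: K_def ring_hom_simps[OF D(2)] simp flip: fh(3))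
  qed
  note hs = ring_hom_simps[OF fh(1)] ring_hom_simps[OF uh(1)] ring_hom_simps[OF gh(3)] ring_hom_simps[OF hh(3)]
    ring_hom_simps[OF lT] ring_hom_simps[OF base_to_total_hom] ring_hom_simps[OF D'(4)] ring_hom_simps[OF D(4)]
  obtain c :: "'n \<Rightarrow> ('k, 'n) base_ring" where c: "split_params base_param c" "\<And>i. base_origin (c i) = 0"
    by (rule base_ring_split[OF n, where 'k = 'k]) blast
  obtain W where W: "product_form (\<lambda>i j. base_to_total (base_param i j)) (\<lambda>i. base_to_total (c i)) total_coord W"
    by (rule product_form_exists[OF n split_params_hom[OF base_to_total_hom c(1)] family_poly_total])
  have "\<forall>i j. \<exists>x. f x = u (base_param i j)" using f(2) by (metis surjD)
  then obtain b where b: "\<And>i j. f (b i j) = u (base_param i j)" by metis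
  have "\<forall>i. \<exists>x. f x = u (c i)" using f(2) by (metis surjD)
  then obtain c0 where c0: "\<And>i. f (c0 i) = u (c i)" by metis
  have "\<forall>i. \<exists>x. g x = h (loc_T (total_coord i))" using surj_g by (metis surjD)
  then obtain z0 where z0: "\<And>i. g (z0 i) = h (loc_T (total_coord i))" by metis
  obtain W0 where W0: "g W0 = h (loc_T W)" using surj_g by (metis surjD)
  \<comment> \<open>Antisymmetry has to hold exactly, so the arbitrary lifts \<open>b\<close> are
    antisymmetrised.\<close>
  define a0 where "a0 i j = \<eta>' (1 / 2) * (b i j - b j i)" for i j
  have a0: "f (a0 i j) = u (base_param i j)" for i j
  proof -
    have "f (a0 i j) = u (base_const (1 / 2) * (base_param i j - base_param j i))"
      by (simp add: a0_def hs fh(2) b uh(2))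
    also have "base_param i j - base_param j i = base_const 2 * (base_param i j :: ('k, 'n) base_ring)"
      using split_params_antisym[OF c(1), of j i] by (simp add: ring_hom_numeral[OF base_const_hom])
    also have "base_const (1 / 2) * (base_const 2 * base_param i j)
      = base_const (1 / 2 * 2) * (base_param i j :: ('k, 'n) base_ring)"
      by (simp only: ring_hom_simps[OF base_const_hom] mult.assoc)
    finally show ?thesis by (simp add: ring_hom_simps[OF base_const_hom])
  qed
  have "approx_solution loc_L \<rho>' \<phi>' \<pi>' K z0 a0 c0 W0"
    unfolding approx_solution_def
  proof (intro conjI allI impI)
    show "a0 i j + a0 j i = 0" for i j by (simp add: a0_def algebra_simps)
    show "\<rho>' (a0 i j) = 0" for i j by (simp add: a0 uh base_origin_param flip: fh(3))
    show "\<pi>' (z0 i) = loc_L (lines_coord i)" for i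
      by (simp add: z0 h \<Pi>T total_to_lines flip: g(2))
    show "a0 i j * a0 i k + a0 j i * a0 j k + a0 k i * a0 k j - c0 i - c0 j - c0 k \<in> K"
      if "distinct [i, j, k]" for i j k
      using arg_cong[OF split_params_sum[OF c(1) that], of u] by (simp add: K_def hs a0 c0)
    show "z0 i * z0 j + \<phi>' (a0 i j) * (z0 i - z0 j) - \<phi>' (c0 i) - \<phi>' (c0 j) - W0 \<in> ideal_gen (\<phi>' ` K)"
      if ij: "i \<noteq> j" for i j
    proof -
      have "g (\<phi>' x) = h (loc_T (base_to_total y))" if "f x = u y" for x y
        using gh(5)[of x] hh(5)[of y] that by simp
      note ga = this[OF a0] and gc = this[OF c0]
      have "g (z0 i * z0 j + \<phi>' (a0 i j) * (z0 i - z0 j) - \<phi>' (c0 i) - \<phi>' (c0 j) - W0)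
        = h (loc_T (total_coord i * total_coord j + base_to_total (base_param i j) * (total_coord i - total_coord j)
          - base_to_total (c i) - base_to_total (c j) - W))"
        by (simp only: hs z0 ga gc W0)
      also have "\<dots> = 0" unfolding product_formD[OF W ij] by (simp add: hs)
      finally show ?thesis using ker_g by blast
    qed
  qed
  then obtain z a c' W' where z: "split_params a c'" "product_form (\<lambda>i j. \<phi>' (a i j)) (\<lambda>i. \<phi>' (c' i)) z W'"
    "\<And>i j. \<rho>' (a i j) = 0" "\<And>i. \<pi>' (z i) = loc_L (lines_coord i)" "\<And>i j. a i j - a0 i j \<in> K"
    by (rule solution_lift[OF n L A' d' K]) (assumption | (rule that; assumption))+
  obtain u' where u': "pointed_hom base_const base_origin \<eta>' \<rho>' u'" "\<And>i j. u' (base_param i j) = a i j"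
    "is_pullback u' (loc_T \<circ> base_to_total) \<Pi> \<phi>' \<pi>'"
    by (rule pullback_from_solution[OF A' d' z(1-4)]) (assumption | (rule that; assumption))+
  have u'h: "is_ring_hom u'" "\<And>c. u' (base_const c) = \<eta>' c" using u'(1) by (auto simp: pointed_hom_def fun_eq_iff)
  have "f (a i j) = u (base_param i j)" for i j using z(5)[of i j] by (simp add: K_def hs a0)
  then have "f (u' x) = u x" for x
    by (induction x rule: base_ring_induct) (simp_all add: u' u'h fh uh hs ring_hom_simps[OF u'h(1)])
  then show ?thesis using u' by (auto simp: fun_eq_iff)
qed

text \<open>Modulo the maximal ideal the zero parameters, with W a product of two coordinates, form
  a solution, since the special fibre is the union of lines.\<close>

lemma dual_pullback_exists:
  fixes \<phi> :: "'k dual \<Rightarrow> 'r::comm_ring_1"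
  assumes d: "deformation (loc_L \<circ> lines_const) dual_const dual_re \<phi> \<pi>"
  shows "\<exists>u. pointed_hom base_const base_origin dual_const dual_re u \<and>
    is_pullback u (loc_T \<circ> base_to_total) \<Pi> \<phi> \<pi>"
proof -
  note D = deformationD[OF d]
  have lL: "is_ring_hom loc_L" using L by (simp add: is_localization_def)
  let ?K = "{x :: 'k dual. dual_re x = 0}"
  have "\<forall>i. \<exists>r. \<pi> r = loc_L (lines_coord i)" using D(9) by blast
  then have "\<exists>z. \<forall>i. \<pi> (z i) = loc_L (lines_coord i)" by (rule choice)
  then obtain z0 where z0: "\<And>i. \<pi> (z0 i) = loc_L (lines_coord i)" by blast
  obtain p :: 'n where True by simp
  obtain q where "q \<notin> {p, p, p}" using n by (rule obtain_fourth)
  then have pq: "p \<noteq> q" by auto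
  have "approx_solution loc_L dual_re \<phi> \<pi> ?K z0 (\<lambda>i j. 0) (\<lambda>i. 0) (z0 p * z0 q)"
    unfolding approx_solution_def
  proof (intro conjI allI impI)
    show "z0 i * z0 j + \<phi> 0 * (z0 i - z0 j) - \<phi> 0 - \<phi> 0 - z0 p * z0 q \<in> ideal_gen (\<phi> ` ?K)"
      if "i \<noteq> j" for i j
      using lines_coord_mult[OF that pq, where 'k = 'k]
      by (intro D(10)) (simp add: ring_hom_simps[OF D(4)] ring_hom_simps[OF D(5)] z0 flip: ring_hom_simps(4)[OF lL])
  qed (simp_all add: z0 ring_hom_simps[OF dual_re_hom])
  then obtain z a c' W' where z: "split_params a c'" "product_form (\<lambda>i j. \<phi> (a i j)) (\<lambda>i. \<phi> (c' i)) z W'"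
    "\<And>i j. dual_re (a i j) = 0" "\<And>i. \<pi> (z i) = loc_L (lines_coord i)"
    by (rule solution_lift[OF n L local_artinian_dual d is_ideal_kernel[OF dual_re_hom] subset_refl])
      (assumption | (rule that; assumption))+
  show ?thesis
    by (rule pullback_from_solution[OF local_artinian_dual d z]) blast
qed

text \<open>Two pull-backs give two solutions that agree on the special fibre. Their difference is
  \<epsilon> times a solution of the homogeneous linear problem, in which \<alpha> must
  vanish.\<close>

lemma dual_pullback_unique:
  fixes \<phi> :: "'k dual \<Rightarrow> 'r::comm_ring_1"
  assumes d: "deformation (loc_L \<circ> lines_const) dual_const dual_re \<phi> \<pi>"
    and u1: "pointed_hom base_const base_origin dual_const dual_re u1" "is_pullback u1 (loc_T \<circ> base_to_total) \<Pi> \<phi> \<pi>"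
    and u2: "pointed_hom base_const base_origin dual_const dual_re u2" "is_pullback u2 (loc_T \<circ> base_to_total) \<Pi> \<phi> \<pi>"
  shows "u1 = u2"
proof -
  note D = deformationD[OF d]
  let ?e = "Dual 0 1 :: 'k dual"
  have lT: "is_ring_hom loc_T" using T by (simp add: is_localization_def)
  have \<Pi>T: "\<Pi> (loc_T x) = loc_L (total_to_lines x)" for x using \<Pi> by (simp add: fun_eq_iff)
  obtain c :: "'n \<Rightarrow> ('k, 'n) base_ring" where c: "split_params base_param c" "\<And>i. base_origin (c i) = 0"
    by (rule base_ring_split[OF n, where 'k = 'k]) blast
  obtain W where W: "product_form (\<lambda>i j. base_to_total (base_param i j)) (\<lambda>i. base_to_total (c i)) total_coord W"
    by (rule product_form_exists[OF n split_params_hom[OF base_to_total_hom c(1)] family_poly_total])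
  have sol: "is_ring_hom u \<and> (\<forall>c. u (base_const c) = dual_const c) \<and> (\<forall>i j. dual_re (u (base_param i j)) = 0) \<and>
    (\<exists>z w. (\<forall>i. \<pi> (z i) = loc_L (lines_coord i)) \<and> \<pi> w = loc_L (total_to_lines W) \<and>
      (\<forall>i j. i \<noteq> j \<longrightarrow> z i * z j + \<phi> (u (base_param i j)) * (z i - z j) = w))"
    if u: "pointed_hom base_const base_origin dual_const dual_re u"
      "is_pullback u (loc_T \<circ> base_to_total) \<Pi> \<phi> \<pi>" for u
  proof -
    have uh: "is_ring_hom u" "\<And>c. u (base_const c) = dual_const c" "\<And>b. dual_re (u b) = base_origin b"
      using u by (auto simp: pointed_hom_def fun_eq_iff)
    obtain h where h: "cocartesian (loc_T \<circ> base_to_total) u h \<phi>" "\<And>x. \<pi> (h x) = \<Pi> x"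
      using u(2) by (auto simp: is_pullback_def is_pullback_via_def fun_eq_iff)
    note hh = cocartesian_hom_commute[OF h(1)]
    have re: "dual_re (u (base_param i j)) = 0" "dual_re (u (c i)) = 0" for i j
      by (simp_all add: uh base_origin_param c)
    \<comment> \<open>The parameters have square zero products over the dual numbers, so all triple
      sums of c vanish.\<close>
    have uc: "u (c i) = 0" for i
    proof -
      have "split_params (\<lambda>i j. 0) (\<lambda>i. dual_eps (u (c i)))"
        unfolding split_params_def
      proof (intro conjI allI impI)
        fix i j k :: 'n assume "distinct [i, j, k]"
        from arg_cong[OF split_params_sum[OF c(1) this], of "\<lambda>x. dual_eps (u x)"]
        show "0 * 0 + 0 * 0 + 0 * 0 = dual_eps (u (c i)) + dual_eps (u (c j)) + dual_eps (u (c k))"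
          by (simp add: ring_hom_simps[OF uh(1)] dual_mult_nilpotent re plus_dual_def zero_dual_def)
      qed simp
      then have "dual_eps (u (c i)) = 0" by (rule split_params_zero[OF n])
      then show ?thesis using re(2)[of i] by (cases "u (c i)") (simp add: zero_dual_def)
    qed
    let ?z = "\<lambda>i. h (loc_T (total_coord i))" and ?w = "h (loc_T W)"
    have "?z i * ?z j + \<phi> (u (base_param i j)) * (?z i - ?z j) = ?w" if "i \<noteq> j" for i j
    proof -
      have b: "h (loc_T (base_to_total x)) = \<phi> (u x)" for x using hh(5)[of x] by simp
      show ?thesis
        using arg_cong[OF product_formD[OF W that], of "\<lambda>x. h (loc_T x)"]
        by (simp add: ring_hom_simps[OF hh(3)] ring_hom_simps[OF lT] b uc ring_hom_simps[OF D(4)])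
    qed
    moreover have "\<pi> (?z i) = loc_L (lines_coord i)" "\<pi> ?w = loc_L (total_to_lines W)" for i
      by (simp_all add: h \<Pi>T total_to_lines)
    ultimately show ?thesis using uh(1,2) re(1) by (intro conjI allI exI[of _ ?z] exI[of _ ?w] impI) simp_all
  qed
  obtain z1 w1 where 1: "is_ring_hom u1" "\<And>c. u1 (base_const c) = dual_const c" "\<And>i j. dual_re (u1 (base_param i j)) = 0"
    "\<And>i. \<pi> (z1 i) = loc_L (lines_coord i)" "\<pi> w1 = loc_L (total_to_lines W)"
    "\<And>i j. i \<noteq> j \<Longrightarrow> z1 i * z1 j + \<phi> (u1 (base_param i j)) * (z1 i - z1 j) = w1"
    using sol[OF u1] by blast
  obtain z2 w2 where 2: "is_ring_hom u2" "\<And>c. u2 (base_const c) = dual_const c" "\<And>i j. dual_re (u2 (base_param i j)) = 0"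
    "\<And>i. \<pi> (z2 i) = loc_L (lines_coord i)" "\<pi> w2 = loc_L (total_to_lines W)"
    "\<And>i j. i \<noteq> j \<Longrightarrow> z2 i * z2 j + \<phi> (u2 (base_param i j)) * (z2 i - z2 j) = w2"
    using sol[OF u2] by blast
  note hs = ring_hom_simps[OF D(4)] ring_hom_simps[OF D(5)]
  have div: "\<exists>y. x1 = x2 + \<phi> ?e * y" if "\<pi> x1 = \<pi> x2" for x1 x2
  proof -
    have "x1 - x2 \<in> ideal_gen (\<phi> ` {x. dual_re x = 0})" by (rule D(10)) (simp add: hs that)
    then obtain y where "x1 - x2 - \<phi> ?e * y \<in> ideal_gen (\<phi> ` {0})"
      by (rule colength_one_decomp[OF D(4) dual_colength_one])
    then have "x1 = x2 + \<phi> ?e * y" by (simp add: hs ideal_gen_singleton_0 algebra_simps)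
    then show ?thesis by blast
  qed
  have "\<forall>i. \<exists>y. z1 i = z2 i + \<phi> ?e * y" using div 1(4) 2(4) by metis
  then have "\<exists>y. \<forall>i. z1 i = z2 i + \<phi> ?e * y i" by (rule choice)
  then obtain y where y: "\<And>i. z1 i = z2 i + \<phi> ?e * y i" by blast
  obtain x where x: "w1 = w2 + \<phi> ?e * x" using div[of w1 w2] 1(5) 2(5) by auto
  define \<alpha> where "\<alpha> i j = dual_eps (u1 (base_param i j)) - dual_eps (u2 (base_param i j))" for i j
  have \<alpha>: "u1 (base_param i j) = u2 (base_param i j) + dual_const (\<alpha> i j) * ?e" for i j
    using 1(3)[of i j] 2(3)[of i j]
    by (cases "u1 (base_param i j)"; cases "u2 (base_param i j)")
      (simp add: \<alpha>_def dual_const_def times_dual_def plus_dual_def)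
  have "\<alpha> i j = 0" for i j
  proof (rule localized_unique[OF n L, of \<alpha> "\<lambda>i. \<pi> (y i)" "\<pi> x"])
    show "\<alpha> i j + \<alpha> j i = 0" for i j
    proof -
      have "dual_eps (u (base_param i j)) + dual_eps (u (base_param j i)) = 0" if "is_ring_hom u"
        for u :: "('k, 'n) base_ring \<Rightarrow> 'k dual"
        using arg_cong[OF base_param_antisym[of i j], of "\<lambda>x. dual_eps (u x)"]
        by (simp add: ring_hom_simps[OF that] plus_dual_def zero_dual_def)
      from this[OF 1(1)] this[OF 2(1)] show ?thesis
        by (simp add: \<alpha>_def) (metis (no_types, lifting) add_diff_add diff_self)
    qed
    fix i j :: 'n assume ij: "i \<noteq> j"
    let ?a = "\<phi> (u2 (base_param i j))" and ?\<alpha> = "\<phi> (dual_const (\<alpha> i j))"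
    \<comment> \<open>The coefficient of \<epsilon> in the difference of the two product
      relations.\<close>
    let ?B = "y i * z2 j + z2 i * y j + ?\<alpha> * (z2 i - z2 j) - x"
    have ee: "\<phi> ?e * (\<phi> ?e * t) = 0" "?a * (\<phi> ?e * t) = 0" for t
    proof -
      have "\<phi> (?e * ?e) = 0" "\<phi> (u2 (base_param i j) * ?e) = 0"
        by (simp_all add: dual_mult_nilpotent 2(3) hs)
      then show "\<phi> ?e * (\<phi> ?e * t) = 0" "?a * (\<phi> ?e * t) = 0" by (simp_all add: hs flip: mult.assoc)
    qed
    have "(z1 i * z1 j + \<phi> (u1 (base_param i j)) * (z1 i - z1 j) - w1)
      - (z2 i * z2 j + ?a * (z2 i - z2 j) - w2)
      = \<phi> ?e * ?B + \<phi> ?e * (\<phi> ?e * (y i * y j + ?\<alpha> * (y i - y j))) + ?a * (\<phi> ?e * (y i - y j))"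
      unfolding y x \<alpha> by (simp add: hs algebra_simps)
    then have "\<phi> ?e * ?B = 0" unfolding 1(6)[OF ij] 2(6)[OF ij] ee by simp
    then have "\<phi> ?e * ?B \<in> ideal_gen (\<phi> ` {0})" by (simp add: ideal_gen_0)
    from flat_colength_one[OF d dual_colength_one this]
    show "\<pi> (y i) * loc_L (lines_coord j) + loc_L (lines_coord i) * \<pi> (y j)
       + loc_L (lines_const (\<alpha> i j)) * (loc_L (lines_coord i) - loc_L (lines_coord j)) = \<pi> x"
      by (simp add: hs 2(4) D(7) D(3))
  qed
  then have eq: "u1 (base_param i j) = u2 (base_param i j)" for i j
    using \<alpha>[of i j] by (simp add: ring_hom_simps(1)[OF dual_const_hom])
  have "u1 b = u2 b" for b
    by (induction b rule: base_ring_induct)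
      (simp_all add: 1(2) 2(2) eq ring_hom_simps[OF 1(1)] ring_hom_simps[OF 2(1)])
  then show ?thesis by (rule ext)
qed

lemma miniversal_localized:
  "miniversal
    TYPE('a::comm_ring_1 \<times> 'b::comm_ring_1 \<times> 'r::comm_ring_1 \<times> 'q::comm_ring_1)
    (loc_L \<circ> lines_const) base_const base_origin (loc_T \<circ> base_to_total) \<Pi>"
  unfolding miniversal_def
proof (intro conjI allI impI univ; (elim conjE)?)
  fix \<phi> :: "'k dual \<Rightarrow> 'r" and \<pi>
  assume d: "deformation (loc_L \<circ> lines_const) dual_const dual_re \<phi> \<pi>"
  show "\<exists>!u. pointed_hom base_const base_origin dual_const dual_re u \<and>
      is_pullback u (loc_T \<circ> base_to_total) \<Pi> \<phi> \<pi>"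
    using dual_pullback_exists[OF d] dual_pullback_unique[OF d] by blast
qed (rule pullback_smooth; assumption)

end

theorem theorem3p2:
  fixes loc_L :: "('k::{alg_closed_field, field_char_0}, 'n::finite) lines_ring \<Rightarrow> 'x::comm_ring_1"
    and loc_T :: "('k, 'n) total_ring \<Rightarrow> 't::comm_ring_1"
  assumes "CARD('n) \<ge> 4"
    and "is_localization loc_L {f. lines_origin f \<noteq> 0}"
    and "is_localization loc_T {f. total_origin f \<noteq> 0}"
  shows
    "(\<forall>i j k l :: 'n. distinct [i, j, k, l] \<longrightarrow>
        (family_poly i j l k :: ('n, ('k, 'n) base_ring) mpol) = family_poly_factored i j l k) \<and>
     deformation (lines_const :: 'k \<Rightarrow> ('k, 'n) lines_ring)
       base_const base_origin base_to_total total_to_lines \<and>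
     (\<exists>\<gamma>\<^sub>B \<gamma>\<^sub>T \<gamma>\<^sub>L.
        good_Gm_action (base_const :: 'k \<Rightarrow> ('k, 'n) base_ring) \<gamma>\<^sub>B \<and>
        good_Gm_action (base_to_total \<circ> base_const :: 'k \<Rightarrow> ('k, 'n) total_ring) \<gamma>\<^sub>T \<and>
        good_Gm_action (lines_const :: 'k \<Rightarrow> ('k, 'n) lines_ring) \<gamma>\<^sub>L \<and>
        (\<forall>i. \<gamma>\<^sub>L (lines_coord i) = monom (lines_coord i) 1) \<and>
        Gm_equivariant \<gamma>\<^sub>B \<gamma>\<^sub>T base_to_total \<and> Gm_equivariant \<gamma>\<^sub>T \<gamma>\<^sub>L total_to_lines) \<and>
     (\<exists>\<Pi>. \<Pi> \<circ> loc_T = loc_L \<circ> total_to_lines \<and>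
        miniversal
          TYPE('a::comm_ring_1 \<times> 'b::comm_ring_1 \<times> 'r::comm_ring_1 \<times> 'q::comm_ring_1)
          (loc_L \<circ> lines_const) (base_const :: 'k \<Rightarrow> ('k, 'n) base_ring) base_origin
          (loc_T \<circ> base_to_total) \<Pi>)"
proof (intro conjI)
  show "\<forall>i j k l :: 'n. distinct [i, j, k, l] \<longrightarrow>
        (family_poly i j l k :: ('n, ('k, 'n) base_ring) mpol) = family_poly_factored i j l k"
  proof (intro allI impI)
    fix i j k l :: 'n
    have anti: "pconst (base_param j i) = - (pconst (base_param i j) :: ('n, ('k, 'n) base_ring) mpol)" for i j
      using arg_cong[OF base_param_antisym[of i j], of pconst]
      by (simp add: ring_hom_simps[OF pconst_hom] eq_neg_iff_add_eq_0 add.commute)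
    show "(family_poly i j l k :: ('n, ('k, 'n) base_ring) mpol) = family_poly_factored i j l k"
      unfolding family_poly_def family_poly_factored_def Let_def anti[of j i] anti[of l i] anti[of k i] anti[of k j] anti[of k l]
      by (simp add: algebra_simps)
  qed
  show "deformation (lines_const :: 'k \<Rightarrow> ('k, 'n) lines_ring)
       base_const base_origin base_to_total total_to_lines"
    by (rule deformation_total[OF assms(1)])
  show "\<exists>\<gamma>\<^sub>B \<gamma>\<^sub>T \<gamma>\<^sub>L.
        good_Gm_action (base_const :: 'k \<Rightarrow> ('k, 'n) base_ring) \<gamma>\<^sub>B \<and>
        good_Gm_action (base_to_total \<circ> base_const :: 'k \<Rightarrow> ('k, 'n) total_ring) \<gamma>\<^sub>T \<and>
        good_Gm_action (lines_const :: 'k \<Rightarrow> ('k, 'n) lines_ring) \<gamma>\<^sub>L \<and>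
        (\<forall>i. \<gamma>\<^sub>L (lines_coord i) = monom (lines_coord i) 1) \<and>
        Gm_equivariant \<gamma>\<^sub>B \<gamma>\<^sub>T base_to_total \<and> Gm_equivariant \<gamma>\<^sub>T \<gamma>\<^sub>L total_to_lines"
    by (rule Gm_actions) blast
  obtain \<Pi> where \<Pi>: "\<Pi> \<circ> loc_T = loc_L \<circ> total_to_lines"
    "deformation (loc_L \<circ> lines_const) base_const base_origin (loc_T \<circ> base_to_total) \<Pi>"
    by (rule deformation_localized[OF assms])
  show "\<exists>\<Pi>. \<Pi> \<circ> loc_T = loc_L \<circ> total_to_lines \<and>
        miniversal
          TYPE('a::comm_ring_1 \<times> 'b::comm_ring_1 \<times> 'r::comm_ring_1 \<times> 'q::comm_ring_1)
          (loc_L \<circ> lines_const) (base_const :: 'k \<Rightarrow> ('k, 'n) base_ring) base_origin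
          (loc_T \<circ> base_to_total) \<Pi>"
    by (intro exI[of _ \<Pi>] conjI \<Pi>(1) miniversal_localized[OF assms \<Pi>])
qed

end
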